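(* Let $(X,d)$ be a locally compact, non-compact, separable ultrametric space, and let $m$ be a Radon measure on $X$ such that $m(B)>0$ for each ball $B$ of positive diameter and such that $m(\{x\})=0$ if and only if $x$ is a non-isolated point. Let $S\subseteq[0,\infty)$ be a closed set which contains $0$ as an accumulation point. Assume that if $X$ contains a non-isolated point then $S$ is unbounded. Then the following hold. (1) There exist a proper ultrametric $d'$ on $X$ which generates the same topology as $d$ and a choice function $C(B)$ defined for $(X,d')$ such that $\mathsf{Spec}(L_C)=S$. (2) Assume in addition that $d$ is proper and that there exists a partition $\Pi$ of $X$ made of $d$-balls containing infinitely many non-singletons. Then there exists a choice function $C(B)$ defined for $(X,d)$ such that $\mathsf{Spec}(L_C)=S$.
   Context: A metric is proper if all its closed balls are compact. Balls are sets $B_r(a)=\{x: d(x,a)<r\}$, $r>0$. The conditions on $m$ depend only on the topology of $X$: they say that every non-empty open set has positive measure and that $m(\{x\})=0$ exactly for non-isolated $x$. Let $(X,\rho)$ be a proper separable ultrametric space (with $\rho=d'$ in (1), $\rho=d$ in (2)), and let $\mathcal B$ be the set of all non-singleton $\rho$-balls. A choice function for $(X,\rho)$ is a function $C:\mathcal B\to(0,\infty)$ such that: (i) $\lambda(B):=\sum_{T\in\mathcal B:\,B\subseteq T}C(T)<\infty$ for every ball $B$; (ii) $\lim_{B\downarrow\{x\}}\lambda(B)=\infty$ (limit along balls $B\ni x$ shrinking to $\{x\}$) whenever $x$ is not an isolated point. Let $\mathcal D$ be the set of locally constant functions on $X$ with compact support. The hierarchical Laplacian associated with $m$ and $C$ is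 $$L_Cf(x)=-\sum_{B\in\mathcal B:\,x\in B}C(B)\bigl(P_Bf-f(x)\bigr),\qquad f\in\mathcal D,\qquad P_Bf=\frac1{m(B)}\int_B f\,dm .$$ The operator $(L_C,\mathcal D)$ is essentially self-adjoint in $L^2(X,m)$; $L_C$ also denotes its unique self-adjoint extension and $\mathsf{Spec}(L_C)$ is the spectrum of this extension. *)

theory Defs
  imports "HOL-Analysis.Analysis"
begin

section \<open>Ultrametric spaces and their balls\<close>

locale Ultrametric_space = Metric_space +
  assumes ultra: "\<And>x y z. \<lbrakk>x \<in> M; y \<in> M; z \<in> M\<rbrakk> \<Longrightarrow> d x z \<le> max (d x y) (d y z)"

context Metric_space
begin

definition proper_metric :: bool where
  "proper_metric \<longleftrightarrow> (\<forall>x\<in>M. \<forall>r. compactin mtopology (mcball x r))"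

definition balls :: "'a set set" where
  "balls = {mball x r | x r. x \<in> M \<and> 0 < r}"

definition nonsingleton_balls :: "'a set set" where
  "nonsingleton_balls = {B \<in> balls. \<not> is_singleton B}"

text \<open>Only meaningful for non-empty bounded sets, such as balls.\<close>
definition mdiameter :: "'a set \<Rightarrow> real" where
  "mdiameter A = (SUP p\<in>A \<times> A. d (fst p) (snd p))"

end

definition isolated_point :: "'a topology \<Rightarrow> 'a \<Rightarrow> bool" where
  "isolated_point X x \<longleftrightarrow> x \<in> topspace X \<and> openin X {x}"

definition radon_measure :: "'a topology \<Rightarrow> 'a measure \<Rightarrow> bool" where
  "radon_measure X m \<longleftrightarrow>
     space m = topspace X \<and>
     sets m = sigma_sets (topspace X) {U. openin X U} \<and>
     (\<forall>K. compactin X K \<longrightarrow> emeasure m K < \<infinity>) \<and>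
     (\<forall>A\<in>sets m. emeasure m A = (SUP K\<in>{K. compactin X K \<and> K \<subseteq> A}. emeasure m K))"

text \<open>The locally constant functions with compact support. They are represented by functions on
  the whole type; their values outside the space are irrelevant.\<close>
definition locally_constant_compact_support :: "'a topology \<Rightarrow> ('a \<Rightarrow> complex) set" where
  "locally_constant_compact_support X =
     {f. (\<forall>x\<in>topspace X. \<exists>U. openin X U \<and> x \<in> U \<and> (\<forall>y\<in>U. f y = f x)) \<and>
         compactin X (X closure_of {x \<in> topspace X. f x \<noteq> 0})}"


section \<open>Unbounded operators in complex \<open>L\<^sup>2(X,m)\<close>\<close>

text \<open>Elements of \<open>L\<^sup>2\<close> are represented by square integrable functions. An operator is represented
  by its graph, which is required to be closed under changing functions on null sets, so that it
  is the preimage of a graph in the quotient space modulo almost everywhere equality.\<close>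

definition L2 :: "'a measure \<Rightarrow> ('a \<Rightarrow> complex) set" where
  "L2 m = {f \<in> borel_measurable m. integrable m (\<lambda>x. (cmod (f x))\<^sup>2)}"

definition L2_inner :: "'a measure \<Rightarrow> ('a \<Rightarrow> complex) \<Rightarrow> ('a \<Rightarrow> complex) \<Rightarrow> complex" where
  "L2_inner m f g = (LINT x|m. f x * cnj (g x))"

definition L2_norm :: "'a measure \<Rightarrow> ('a \<Rightarrow> complex) \<Rightarrow> real" where
  "L2_norm m f = sqrt (LINT x|m. (cmod (f x))\<^sup>2)"

definition L2_operator :: "'a measure \<Rightarrow> ('a \<Rightarrow> complex) rel \<Rightarrow> bool" where
  "L2_operator m A \<longleftrightarrow>
     A \<subseteq> L2 m \<times> L2 m \<and>
     (\<forall>f\<in>L2 m. \<forall>u\<in>L2 m. \<forall>(g, v)\<in>A.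
        (AE x in m. f x = g x) \<and> (AE x in m. u x = v x) \<longrightarrow> (f, u) \<in> A) \<and>
     (\<lambda>x. 0, \<lambda>x. 0) \<in> A \<and>
     (\<forall>(f, u)\<in>A. \<forall>(g, v)\<in>A. \<forall>c. (\<lambda>x. c * f x + g x, \<lambda>x. c * u x + v x) \<in> A) \<and>
     (\<forall>f u v. (f, u) \<in> A \<and> (f, v) \<in> A \<longrightarrow> (AE x in m. u x = v x))"

definition densely_defined :: "'a measure \<Rightarrow> ('a \<Rightarrow> complex) rel \<Rightarrow> bool" where
  "densely_defined m A \<longleftrightarrow> (\<forall>g\<in>L2 m. \<forall>e>0. \<exists>f\<in>Domain A. L2_norm m (\<lambda>x. f x - g x) < e)"

definition adjoint_graph :: "'a measure \<Rightarrow> ('a \<Rightarrow> complex) rel \<Rightarrow> ('a \<Rightarrow> complex) rel" where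
  "adjoint_graph m A =
     {(g, h). g \<in> L2 m \<and> h \<in> L2 m \<and> (\<forall>(f, u)\<in>A. L2_inner m u g = L2_inner m f h)}"

definition selfadjoint_operator :: "'a measure \<Rightarrow> ('a \<Rightarrow> complex) rel \<Rightarrow> bool" where
  "selfadjoint_operator m A \<longleftrightarrow>
     L2_operator m A \<and> densely_defined m A \<and> adjoint_graph m A = A"

definition selfadjoint_extension :: "'a measure \<Rightarrow> ('a \<Rightarrow> complex) rel \<Rightarrow> ('a \<Rightarrow> complex) rel" where
  "selfadjoint_extension m A = (THE B. selfadjoint_operator m B \<and> A \<subseteq> B)"

text \<open>\<open>A - z\<close> maps the domain of \<open>A\<close> bijectively onto \<open>L\<^sup>2\<close> and its inverse is bounded; injectivity
  is part of the norm estimate.\<close>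
definition resolvent_set :: "'a measure \<Rightarrow> ('a \<Rightarrow> complex) rel \<Rightarrow> complex set" where
  "resolvent_set m A =
     {z. (\<forall>g\<in>L2 m. \<exists>(f, u)\<in>A. AE x in m. u x - z * f x = g x) \<and>
         (\<exists>c. \<forall>(f, u)\<in>A. L2_norm m f \<le> c * L2_norm m (\<lambda>x. u x - z * f x))}"

definition op_spectrum :: "'a measure \<Rightarrow> ('a \<Rightarrow> complex) rel \<Rightarrow> complex set" where
  "op_spectrum m A = - resolvent_set m A"


section \<open>Choice functions and hierarchical Laplacians\<close>

context Metric_space
begin

definition choice_lambda :: "('a set \<Rightarrow> real) \<Rightarrow> 'a set \<Rightarrow> real" where
  "choice_lambda C B = (\<Sum>\<^sub>\<infinity>T\<in>{T \<in> nonsingleton_balls. B \<subseteq> T}. C T)"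

text \<open>The filter of balls containing \<open>x\<close>, directed by reverse inclusion.\<close>
definition balls_shrinking_to :: "'a \<Rightarrow> 'a set filter" where
  "balls_shrinking_to x =
     (INF B0\<in>{B \<in> balls. x \<in> B}. principal {B \<in> balls. x \<in> B \<and> B \<subseteq> B0})"

text \<open>The values of \<open>C\<close> outside \<open>nonsingleton_balls\<close> are irrelevant.\<close>
definition choice_function :: "('a set \<Rightarrow> real) \<Rightarrow> bool" where
  "choice_function C \<longleftrightarrow>
     (\<forall>B\<in>nonsingleton_balls. 0 < C B) \<and>
     (\<forall>B\<in>balls. C summable_on {T \<in> nonsingleton_balls. B \<subseteq> T}) \<and>
     (\<forall>x\<in>M. \<not> isolated_point mtopology x \<longrightarrow>
        filterlim (choice_lambda C) at_top (balls_shrinking_to x))"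

definition ball_average :: "'a measure \<Rightarrow> 'a set \<Rightarrow> ('a \<Rightarrow> complex) \<Rightarrow> complex" where
  "ball_average m B f = (LINT y:B|m. f y) / of_real (measure m B)"

definition hier_Laplacian_fun ::
    "'a measure \<Rightarrow> ('a set \<Rightarrow> real) \<Rightarrow> ('a \<Rightarrow> complex) \<Rightarrow> 'a \<Rightarrow> complex" where
  "hier_Laplacian_fun m C f x =
     - (\<Sum>\<^sub>\<infinity>B\<in>{B \<in> nonsingleton_balls. x \<in> B}. of_real (C B) * (ball_average m B f - f x))"

definition hier_Laplacian_graph ::
    "'a measure \<Rightarrow> ('a set \<Rightarrow> real) \<Rightarrow> ('a \<Rightarrow> complex) rel" where
  "hier_Laplacian_graph m C =
     {(f, u). f \<in> L2 m \<and> u \<in> L2 m \<and>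
        (\<exists>g\<in>locally_constant_compact_support mtopology.
           (AE x in m. f x = g x) \<and> (AE x in m. u x = hier_Laplacian_fun m C g x))}"

definition hier_Laplacian :: "'a measure \<Rightarrow> ('a set \<Rightarrow> real) \<Rightarrow> ('a \<Rightarrow> complex) rel" where
  "hier_Laplacian m C = selfadjoint_extension m (hier_Laplacian_graph m C)"

end

end

theory Submission
  imports Defs
begin

text \<open>Part (1) follows from part (2): a compact open partition into sets with at least two points gives a
  proper ultrametric, inducing the same topology, in which these sets are balls.

  For part (2), the functions that are supported in a ball \<open>B\<close>, constant on its children and of mean zero
  are eigenfunctions of \<open>L\<^sub>C\<close> with eigenvalue \<open>\<lambda>(B)\<close>. Together with the constants, if \<open>m\<close> is finite, they span
  \<open>L\<^sup>2\<close>, so \<open>L\<^sub>C\<close> is diagonal in an orthonormal (Haar) basis and its spectrum is the closure of the values of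
  \<open>\<lambda>\<close>. Any function \<open>\<lambda>\<close> on balls that is strictly decreasing for inclusion, tends to \<open>0\<close> along increasing
  balls and to infinity at the non-isolated points comes from the choice function
  \<open>C(B) = \<lambda>(B) - \<lambda>(parent B)\<close>. Infinitely many disjoint non-singleton balls leave room to give \<open>\<lambda>\<close> a dense
  set of values in \<open>S\<close>.\<close>

section \<open>The Hilbert space of square integrable functions\<close>

text \<open>The constant function 1 is the delicate vector. Since \<open>M\<close> is not compact it
  is never a test function, yet for finite \<open>m\<close> the extension has to send it to 0.
  Pairing with the indicators of an increasing sequence of balls shows this, because
  \<open>choice_lambda C\<close> tends to 0 along such a sequence. The eigenvalue 0 so obtained
  belongs to \<open>S\<close>, which is closed and accumulates at 0. The obstacle in prescribing
  values is the order of inclusion: along a chain of balls the values can only decrease, whereas a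
  dense sequence in \<open>S\<close> comes in no order. Disjoint balls are not comparable, so their
  values are free; a ball containing some of them merely needs a value below finitely many positive
  numbers, and \<open>S\<close> has such values near 0. Balls inside them need ever larger values of
  \<open>S\<close>. If \<open>S\<close> is bounded the space is discrete, and the disjoint balls can
  be taken minimal, so that only singletons remain inside.\<close>

lemma L2_measurable: "f \<in> L2 m \<Longrightarrow> f \<in> borel_measurable m" by (simp add: L2_def)

lemma L2_integrable: "f \<in> L2 m \<Longrightarrow> integrable m (\<lambda>x. (cmod (f x))\<^sup>2)" by (simp add: L2_def)

lemma L2_zero [simp]: "(\<lambda>x. 0) \<in> L2 m" by (simp add: L2_def)

lemma L2_lincomb:
  assumes "f \<in> L2 m" "g \<in> L2 m"
  shows "(\<lambda>x. c * f x + g x) \<in> L2 m"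
proof -
  note [measurable] = L2_measurable[OF assms(1)] L2_measurable[OF assms(2)]
  have "integrable m (\<lambda>x. 2 * (cmod c)\<^sup>2 * (cmod (f x))\<^sup>2 + 2 * (cmod (g x))\<^sup>2)"
    using assms by (auto intro!: integrable_mult_right dest: L2_integrable)
  then have "integrable m (\<lambda>x. (cmod (c * f x + g x))\<^sup>2)"
  proof (rule Bochner_Integration.integrable_bound, measurable, intro AE_I2)
    fix x
    have "(cmod (c * f x + g x))\<^sup>2 \<le> (cmod (c * f x) + cmod (g x))\<^sup>2"
      by (intro power_mono norm_triangle_ineq) auto
    also have "\<dots> \<le> 2 * (cmod (c * f x))\<^sup>2 + 2 * (cmod (g x))\<^sup>2"
      using sum_squares_bound[of "cmod (c * f x)" "cmod (g x)"] unfolding power2_sum by linarith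
    finally show "norm ((cmod (c * f x + g x))\<^sup>2)
        \<le> norm (2 * (cmod c)\<^sup>2 * (cmod (f x))\<^sup>2 + 2 * (cmod (g x))\<^sup>2)"
      by (simp add: norm_mult power_mult_distrib)
  qed
  then show ?thesis by (simp add: L2_def)
qed

lemma L2_scale: "f \<in> L2 m \<Longrightarrow> (\<lambda>x. c * f x) \<in> L2 m" using L2_lincomb[of f m "\<lambda>x. 0" c] by simp

lemma L2_add: "f \<in> L2 m \<Longrightarrow> g \<in> L2 m \<Longrightarrow> (\<lambda>x. f x + g x) \<in> L2 m"
  using L2_lincomb[of f m g 1] by simp

lemma L2_diff: "f \<in> L2 m \<Longrightarrow> g \<in> L2 m \<Longrightarrow> (\<lambda>x. f x - g x) \<in> L2 m"
  using L2_lincomb[of g m f "-1"] by simp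

lemma L2_sum: "(\<And>i. i \<in> I \<Longrightarrow> f i \<in> L2 m) \<Longrightarrow> (\<lambda>x. \<Sum>i\<in>I. f i x) \<in> L2 m"
  by (induction I rule: infinite_finite_induct) (auto intro: L2_add)

lemma L2_cong_AE:
  assumes "f \<in> L2 m" "g \<in> borel_measurable m" "AE x in m. g x = f x"
  shows "g \<in> L2 m"
proof -
  note [measurable] = L2_measurable[OF assms(1)] assms(2)
  have "integrable m (\<lambda>x. (cmod (g x))\<^sup>2) \<longleftrightarrow> integrable m (\<lambda>x. (cmod (f x))\<^sup>2)"
    using assms(3) by (intro integrable_cong_AE) auto
  then show ?thesis using assms by (auto simp: L2_def)
qed

lemma borel_measurable_cnj [measurable (raw)]:
  "f \<in> borel_measurable m \<Longrightarrow> (\<lambda>x. cnj (f x)) \<in> borel_measurable m"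
  by (rule measurable_compose[OF _ borel_measurable_continuous_onI]) (auto intro: continuous_intros)

lemma integrable_L2_mult:
  assumes "f \<in> L2 m" "g \<in> L2 m"
  shows "integrable m (\<lambda>x. f x * cnj (g x))"
proof -
  note [measurable] = L2_measurable[OF assms(1)] L2_measurable[OF assms(2)]
  have *: "integrable m (\<lambda>x. (cmod (f x))\<^sup>2 + (cmod (g x))\<^sup>2)"
    using assms by (auto dest: L2_integrable)
  show ?thesis
  proof (rule Bochner_Integration.integrable_bound[OF *], measurable, intro AE_I2)
    fix x
    have "0 \<le> cmod (f x) * cmod (g x)" by simp
    then have "cmod (f x) * cmod (g x) \<le> (cmod (f x))\<^sup>2 + (cmod (g x))\<^sup>2"
      using sum_squares_bound[of "cmod (f x)" "cmod (g x)"] by linarith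
    then show "norm (f x * cnj (g x)) \<le> norm ((cmod (f x))\<^sup>2 + (cmod (g x))\<^sup>2)"
      by (simp add: norm_mult)
  qed
qed

lemma L2_inner_cong_AE:
  assumes "f \<in> L2 m" "f' \<in> L2 m" "AE x in m. f x = f' x"
    "g \<in> L2 m" "g' \<in> L2 m" "AE x in m. g x = g' x"
  shows "L2_inner m f g = L2_inner m f' g'"
proof -
  note [measurable] = assms(1,2,4,5)[THEN L2_measurable]
  have "AE x in m. f x * cnj (g x) = f' x * cnj (g' x)" using assms(3,6) by eventually_elim simp
  then show ?thesis unfolding L2_inner_def by (intro integral_cong_AE) measurable
qed

lemma L2_inner_lincomb_left:
  assumes "f \<in> L2 m" "g \<in> L2 m" "h \<in> L2 m"
  shows "L2_inner m (\<lambda>x. c * f x + g x) h = c * L2_inner m f h + L2_inner m g h"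
proof -
  have "L2_inner m (\<lambda>x. c * f x + g x) h = (LINT x|m. c * (f x * cnj (h x)) + g x * cnj (h x))"
    unfolding L2_inner_def by (simp add: algebra_simps)
  also have "\<dots> = c * L2_inner m f h + L2_inner m g h" unfolding L2_inner_def
    using integrable_L2_mult[OF assms(1,3)] integrable_L2_mult[OF assms(2,3)]
    by (subst Bochner_Integration.integral_add) auto
  finally show ?thesis .
qed

lemma L2_inner_cnj: "cnj (L2_inner m f g) = L2_inner m g f"
proof -
  have "cnj (L2_inner m f g) = (LINT x|m. cnj (f x * cnj (g x)))"
    unfolding L2_inner_def by (rule Bochner_Integration.integral_cnj[symmetric])
  then show ?thesis unfolding L2_inner_def by (simp add: mult.commute)
qed

lemma L2_inner_zero_left [simp]: "L2_inner m (\<lambda>x. 0) g = 0" by (simp add: L2_inner_def)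

lemma L2_inner_zero_right [simp]: "L2_inner m f (\<lambda>x. 0) = 0" by (simp add: L2_inner_def)

lemma L2_inner_add_left:
  "\<lbrakk>f \<in> L2 m; g \<in> L2 m; h \<in> L2 m\<rbrakk> \<Longrightarrow>
    L2_inner m (\<lambda>x. f x + g x) h = L2_inner m f h + L2_inner m g h"
  using L2_inner_lincomb_left[of f m g h 1] by simp

lemma L2_inner_scale_left:
  "\<lbrakk>f \<in> L2 m; h \<in> L2 m\<rbrakk> \<Longrightarrow> L2_inner m (\<lambda>x. c * f x) h = c * L2_inner m f h"
  using L2_inner_lincomb_left[of f m "\<lambda>x. 0" h c] by simp

lemma L2_inner_diff_left:
  "\<lbrakk>f \<in> L2 m; g \<in> L2 m; h \<in> L2 m\<rbrakk> \<Longrightarrow>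
    L2_inner m (\<lambda>x. f x - g x) h = L2_inner m f h - L2_inner m g h"
  using L2_inner_lincomb_left[of g m f h "-1"] by simp

lemma L2_inner_diff_right:
  "\<lbrakk>f \<in> L2 m; g \<in> L2 m; h \<in> L2 m\<rbrakk> \<Longrightarrow>
    L2_inner m h (\<lambda>x. f x - g x) = L2_inner m h f - L2_inner m h g"
  using arg_cong[OF L2_inner_diff_left[of f m g h], of cnj] by (simp add: L2_inner_cnj)

lemma L2_inner_scale_right:
  "\<lbrakk>f \<in> L2 m; h \<in> L2 m\<rbrakk> \<Longrightarrow> L2_inner m h (\<lambda>x. c * f x) = cnj c * L2_inner m h f"
  using arg_cong[OF L2_inner_scale_left[of f m h c], of cnj] by (simp add: L2_inner_cnj)

lemma L2_inner_sum_left: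
  assumes "\<And>i. i \<in> I \<Longrightarrow> f i \<in> L2 m" "g \<in> L2 m"
  shows "L2_inner m (\<lambda>x. \<Sum>i\<in>I. f i x) g = (\<Sum>i\<in>I. L2_inner m (f i) g)" using assms
  by (induction I rule: infinite_finite_induct) (auto simp: L2_inner_add_left L2_sum)

lemma L2_norm_nonneg [simp]: "0 \<le> L2_norm m f" by (simp add: L2_norm_def)

lemma L2_norm_power2: "(L2_norm m f)\<^sup>2 = (LINT x|m. (cmod (f x))\<^sup>2)" by (simp add: L2_norm_def)

lemma L2_inner_self: "L2_inner m f f = of_real ((L2_norm m f)\<^sup>2)"
  unfolding L2_inner_def L2_norm_power2
  by (subst integral_complex_of_real[symmetric], simp only: complex_norm_square)

lemma L2_norm_cong_AE:
  assumes "f \<in> L2 m" "g \<in> L2 m" "AE x in m. f x = g x"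
  shows "L2_norm m f = L2_norm m g"
proof -
  have "L2_inner m f f = L2_inner m g g" using assms by (intro L2_inner_cong_AE)
  then show ?thesis unfolding L2_inner_self of_real_eq_iff by (simp add: power2_eq_iff_nonneg)
qed

lemma L2_norm_scale: "L2_norm m (\<lambda>x. c * f x) = cmod c * L2_norm m f"
  by (simp add: L2_norm_def norm_mult power_mult_distrib real_sqrt_mult)

lemma L2_norm_minus_commute: "L2_norm m (\<lambda>x. f x - g x) = L2_norm m (\<lambda>x. g x - f x)"
  by (simp add: L2_norm_def norm_minus_commute)

lemma L2_norm_eq_0:
  assumes "f \<in> L2 m"
  shows "L2_norm m f = 0 \<longleftrightarrow> (AE x in m. f x = 0)"
  using integral_nonneg_eq_0_iff_AE[OF L2_integrable[OF assms]] by (simp add: L2_norm_def)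

lemma L2_Cauchy_Schwarz:
  assumes f: "f \<in> L2 m" and g: "g \<in> L2 m"
  shows "cmod (L2_inner m f g) \<le> L2_norm m f * L2_norm m g"
proof (cases "L2_norm m g = 0")
  case True
  then have "L2_inner m f g = L2_inner m f (\<lambda>x. 0)"
    using f g L2_norm_eq_0[OF g] by (intro L2_inner_cong_AE) auto
  then show ?thesis by (simp add: True)
next
  case False
  \<comment> \<open>The projection coefficient: it makes \<open>f - c * g\<close> orthogonal to
    \<open>g\<close>, and the inequality is then the non-negativity of the squared norm of this
    difference.\<close>
  define c where "c = L2_inner m f g / of_real ((L2_norm m g)\<^sup>2)"
  have cg: "(\<lambda>x. c * g x) \<in> L2 m" by (rule L2_scale[OF g])
  have "of_real ((L2_norm m (\<lambda>x. f x - c * g x))\<^sup>2)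
      = L2_inner m (\<lambda>x. f x - c * g x) (\<lambda>x. f x - c * g x)"
    by (simp add: L2_inner_self)
  also have "\<dots> = L2_inner m f f - cnj c * L2_inner m f g
      - c * (L2_inner m g f - cnj c * L2_inner m g g)"
    using f g cg
    by (simp add: L2_inner_diff_left L2_inner_diff_right L2_diff L2_inner_scale_left
        L2_inner_scale_right algebra_simps)
  also have "L2_inner m g f - cnj c * L2_inner m g g = 0"
    using False by (simp add: c_def L2_inner_cnj L2_inner_self)
  also have "cnj c * L2_inner m f g = of_real ((cmod (L2_inner m f g))\<^sup>2 / (L2_norm m g)\<^sup>2)"
    by (simp add: c_def complex_norm_square[symmetric] mult.commute del: of_real_power)
  finally have "complex_of_real ((L2_norm m (\<lambda>x. f x - c * g x))\<^sup>2)
      = of_real ((L2_norm m f)\<^sup>2 - (cmod (L2_inner m f g))\<^sup>2 / (L2_norm m g)\<^sup>2)"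
    unfolding L2_inner_self by (simp only: of_real_diff mult_zero_right diff_zero)
  then have "(L2_norm m (\<lambda>x. f x - c * g x))\<^sup>2
      = (L2_norm m f)\<^sup>2 - (cmod (L2_inner m f g))\<^sup>2 / (L2_norm m g)\<^sup>2"
    unfolding of_real_eq_iff .
  then have "(cmod (L2_inner m f g))\<^sup>2 / (L2_norm m g)\<^sup>2 \<le> (L2_norm m f)\<^sup>2"
    by (metis zero_le_power2 diff_ge_0_iff_ge)
  then have "(cmod (L2_inner m f g))\<^sup>2 \<le> (L2_norm m f * L2_norm m g)\<^sup>2"
    using False by (simp add: field_simps power_mult_distrib)
  then show ?thesis by (rule power2_le_imp_le) simp
qed

subsection \<open>Orthonormal bases\<close>

text \<open>Completeness is assumed as triviality of the orthogonal complement, the form in which it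
  can be checked for Haar vectors. Convergence of expansions is derived from it by way of
  Riesz-Fischer.\<close>

locale L2_basis =
  fixes m :: "'a measure" and e :: "nat \<Rightarrow> 'a \<Rightarrow> complex"
  assumes e_L2: "\<And>n. e n \<in> L2 m"
    and orthonormal: "\<And>i j. L2_inner m (e i) (e j) = (if i = j then 1 else 0)"
    and complete: "\<And>f. \<lbrakk>f \<in> L2 m; \<And>n. L2_inner m f (e n) = 0\<rbrakk> \<Longrightarrow> AE x in m. f x = 0"
begin

definition partial :: "(nat \<Rightarrow> complex) \<Rightarrow> nat set \<Rightarrow> 'a \<Rightarrow> complex" where
  "partial c I = (\<lambda>x. \<Sum>i\<in>I. c i * e i x)"

lemma partial_L2: "partial c I \<in> L2 m" unfolding partial_def by (intro L2_sum L2_scale e_L2)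

lemma inner_partial:
  assumes "finite I" "g \<in> L2 m"
  shows "L2_inner m (partial c I) g = (\<Sum>i\<in>I. c i * L2_inner m (e i) g)"
  unfolding partial_def using assms
  by (subst L2_inner_sum_left) (auto simp: L2_scale L2_inner_scale_left e_L2)

lemma inner_partial_e:
  assumes "finite I"
  shows "L2_inner m (partial c I) (e n) = (if n \<in> I then c n else 0)"
  using assms by (simp add: inner_partial e_L2 orthonormal if_distrib sum.delta cong: if_cong)

lemma norm_partial:
  assumes "finite I"
  shows "(L2_norm m (partial c I))\<^sup>2 = (\<Sum>i\<in>I. (cmod (c i))\<^sup>2)"
proof -
  have "complex_of_real ((L2_norm m (partial c I))\<^sup>2) = (\<Sum>i\<in>I. c i * L2_inner m (e i) (partial c I))"
    unfolding L2_inner_self[symmetric] using assms by (simp add: inner_partial partial_L2)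
  also have "\<dots> = (\<Sum>i\<in>I. c i * cnj (c i))"
    using assms by (intro sum.cong refl) (simp add: L2_inner_cnj[of m "partial c I", symmetric] inner_partial_e)
  also have "\<dots> = complex_of_real (\<Sum>i\<in>I. (cmod (c i))\<^sup>2)"
    by (simp only: complex_norm_square[symmetric] of_real_sum)
  finally show ?thesis unfolding of_real_eq_iff .
qed

lemma bessel:
  assumes "f \<in> L2 m" "finite I"
  shows "(\<Sum>i\<in>I. (cmod (L2_inner m f (e i)))\<^sup>2) \<le> (L2_norm m f)\<^sup>2"
proof -
  define c where "c = (\<lambda>i. L2_inner m f (e i))"
  define N where "N = (\<Sum>i\<in>I. (cmod (c i))\<^sup>2)"
  have 1: "L2_inner m (partial c I) f = of_real N"
    using assms unfolding N_def of_real_sum complex_norm_square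
    by (simp add: inner_partial c_def L2_inner_cnj)
  have 2: "L2_inner m f (partial c I) = of_real N"
    using arg_cong[OF 1, of cnj] by (simp add: L2_inner_cnj)
  have "complex_of_real ((L2_norm m (\<lambda>x. f x - partial c I x))\<^sup>2)
      = L2_inner m f f - L2_inner m f (partial c I)
        - (L2_inner m (partial c I) f - L2_inner m (partial c I) (partial c I))"
    unfolding L2_inner_self[symmetric] using assms
    by (simp add: L2_inner_diff_left L2_inner_diff_right L2_diff partial_L2)
  also have "\<dots> = of_real ((L2_norm m f)\<^sup>2 - N)" using norm_partial[OF assms(2), of c]
    by (simp add: 1 2 L2_inner_self N_def del: of_real_power)
  finally have "(L2_norm m (\<lambda>x. f x - partial c I x))\<^sup>2 = (L2_norm m f)\<^sup>2 - N"
    unfolding of_real_eq_iff .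
  then show ?thesis unfolding N_def c_def by (smt (verit) zero_le_power2)
qed

lemma coefficients_summable:
  "f \<in> L2 m \<Longrightarrow> summable (\<lambda>i. (cmod (L2_inner m f (e i)))\<^sup>2)"
  by (rule summableI_nonneg_bounded[OF _ bessel]) auto

end

section \<open>Riesz-Fischer, Fourier expansions and Parseval's identity\<close>

context L2_basis
begin

text \<open>Along a subsequence with \<open>\<parallel>\<Delta>\<^sub>k\<parallel>\<^sup>2 \<le> 8\<^sup>-\<^sup>k\<close> the sum \<open>\<Sum>k. 4\<^sup>k |\<Delta>\<^sub>k(x)|\<^sup>2\<close> is finite almost everywhere, so that
  the partial sums converge pointwise; norm convergence then follows from Fatou's lemma.\<close>

lemma riesz_fischer_limit:
  assumes c: "summable (\<lambda>i. (cmod (c i))\<^sup>2)"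
  shows "\<exists>f\<in>L2 m. \<forall>n. (L2_norm m (\<lambda>x. f x - partial c {..<n} x))\<^sup>2 \<le> (\<Sum>i. (cmod (c (i + n)))\<^sup>2)"
proof -
  define tail where "tail n = (\<Sum>i. (cmod (c (i + n)))\<^sup>2)" for n
  define s where "s n = partial c {..<n}" for n
  have sL2: "s n \<in> L2 m" for n unfolding s_def by (rule partial_L2)
  note [measurable] = L2_measurable[OF sL2]
  have diff: "s n' x - s n x = partial c {n..<n'} x" if "n \<le> n'" for n n' x
    unfolding s_def partial_def
    using sum.atLeastLessThan_concat[of 0 n n' "\<lambda>i. c i * e i x"] that
    by (simp add: atLeast0LessThan add.commute diff_eq_eq)
  have normdiff: "(L2_norm m (\<lambda>x. s n' x - s n x))\<^sup>2 \<le> tail n" if "n \<le> n'" for n n'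
  proof -
    have "(L2_norm m (\<lambda>x. s n' x - s n x))\<^sup>2 = (\<Sum>i\<in>{n..<n'}. (cmod (c i))\<^sup>2)"
      using diff[OF that] by (simp add: norm_partial)
    also have "\<dots> = (\<Sum>i<n' - n. (cmod (c (i + n)))\<^sup>2)"
      using that by (intro sum.reindex_bij_witness[of _ "\<lambda>i. i + n" "\<lambda>i. i - n"]) auto
    also have "\<dots> \<le> tail n"
      unfolding tail_def by (rule sum_le_suminf) (auto simp: summable_iff_shift[of "\<lambda>i. (cmod (c i))\<^sup>2"] c)
    finally show ?thesis .
  qed
  have nn_diff: "(\<integral>\<^sup>+x. ennreal ((cmod (s n' x - s n x))\<^sup>2) \<partial>m) \<le> ennreal (tail n)" if "n \<le> n'" for n n'
  proof -
    have "(\<integral>\<^sup>+x. ennreal ((cmod (s n' x - s n x))\<^sup>2) \<partial>m) = ennreal ((L2_norm m (\<lambda>x. s n' x - s n x))\<^sup>2)"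
      unfolding L2_norm_power2 by (rule nn_integral_eq_integral) (auto intro!: L2_integrable L2_diff sL2)
    then show ?thesis using normdiff[OF that] by (simp add: ennreal_leI)
  qed
  have tail0: "tail \<longlonglongrightarrow> 0" unfolding tail_def[abs_def] by (rule suminf_exist_split2[OF c])
  have "\<exists>r. \<forall>k. tail (r k) \<le> (1/8)^k \<and> r k < r (Suc k)"
  proof -
    have "\<exists>n. N < n \<and> tail n \<le> (1/8)^k" for N k
    proof -
      have "\<forall>\<^sub>F n in sequentially. tail n < (1/8)^k" using tail0 by (rule order_tendstoD) simp
      moreover have "\<forall>\<^sub>F n in sequentially. N < n" by (rule eventually_gt_at_top)
      ultimately have "\<forall>\<^sub>F n in sequentially. N < n \<and> tail n \<le> (1/8)^k" by eventually_elim auto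
      then show ?thesis using eventually_happens trivial_limit_sequentially by blast
    qed
    then show ?thesis
      by (intro dependent_nat_choice[where P="\<lambda>k n. tail n \<le> (1/8)^k" and Q="\<lambda>k n n'. n < n'"]) blast+
  qed
  then obtain r where r: "\<And>k. tail (r k) \<le> (1/8)^k" and rmono: "\<And>k. r k < r (Suc k)" by blast
  define D where "D k x = s (r (Suc k)) x - s (r k) x" for k x
  have "(\<integral>\<^sup>+x. (\<Sum>k. ennreal (4^k * (cmod (D k x))\<^sup>2)) \<partial>m) = (\<Sum>k. \<integral>\<^sup>+x. ennreal (4^k * (cmod (D k x))\<^sup>2) \<partial>m)"
    unfolding D_def by (rule nn_integral_suminf) measurable
  also have "\<dots> \<le> (\<Sum>k. ennreal ((1/2)^k))"
  proof (rule suminf_le)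
    fix k
    have "(\<integral>\<^sup>+x. ennreal (4^k * (cmod (D k x))\<^sup>2) \<partial>m) = ennreal (4^k) * (\<integral>\<^sup>+x. ennreal ((cmod (D k x))\<^sup>2) \<partial>m)"
      unfolding D_def by (subst nn_integral_cmult[symmetric]) (auto simp: ennreal_mult)
    also have "\<dots> \<le> ennreal (4^k) * ennreal (tail (r k))"
      unfolding D_def using nn_diff rmono[of k] by (intro mult_left_mono) auto
    also have "\<dots> \<le> ennreal (4^k) * ennreal ((1/8)^k)"
      by (intro mult_left_mono ennreal_leI r) auto
    also have "\<dots> = ennreal ((1/2)^k)" by (simp flip: ennreal_mult power_mult_distrib)
    finally show "(\<integral>\<^sup>+x. ennreal (4^k * (cmod (D k x))\<^sup>2) \<partial>m) \<le> ennreal ((1/2)^k)" .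
  qed auto
  also have "\<dots> < \<infinity>" by (subst suminf_ennreal2) (auto intro: summable_geometric)
  finally have "AE x in m. (\<Sum>k. ennreal (4^k * (cmod (D k x))\<^sup>2)) \<noteq> \<infinity>"
    unfolding D_def by (intro nn_integral_noteq_infinite) auto
  then have conv: "AE x in m. convergent (\<lambda>k. s (r k) x)"
  proof eventually_elim
    case (elim x)
    \<comment> \<open>The terms of a convergent series are eventually below 1, that is,
      \<open>cmod (D k x)\<close> is at most 2^(-k); so the increments along \<open>r\<close> are
      dominated by a geometric series.\<close>
    have sm: "summable (\<lambda>k. 4^k * (cmod (D k x))\<^sup>2)"
      using elim by (intro summable_suminf_not_top) auto
    then have "(\<lambda>k. 4^k * (cmod (D k x))\<^sup>2) \<longlonglongrightarrow> 0" by (rule summable_LIMSEQ_zero)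
    then have "\<forall>\<^sub>F k in sequentially. 4^k * (cmod (D k x))\<^sup>2 < 1" by (rule order_tendstoD) simp
    then have "\<forall>\<^sub>F k in sequentially. norm (D k x) \<le> (1/2)^k"
    proof eventually_elim
      case (elim k)
      have "(2^k * cmod (D k x))\<^sup>2 \<le> 1\<^sup>2"
        using elim by (simp add: power_mult_distrib power_mult[symmetric] mult.commute[of k] power_mult)
      then have "2^k * cmod (D k x) \<le> 1" by (rule power2_le_imp_le) simp
      then show ?case by (simp add: power_one_over field_simps)
    qed
    then have "summable (\<lambda>k. D k x)"
      by (rule summable_comparison_test_ev) (simp add: summable_geometric)
    then have "convergent (\<lambda>n. \<Sum>k<n. D k x)" by (simp add: summable_iff_convergent)
    then have "convergent (\<lambda>n. (\<Sum>k<n. D k x) + s (r 0) x)"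
      by (intro convergent_add convergent_const)
    moreover have "(\<Sum>k<n. D k x) + s (r 0) x = s (r n) x" for n
      unfolding D_def by (subst sum_lessThan_telescope) simp
    ultimately show ?case by simp
  qed
  define f where "f x = lim (\<lambda>k. s (r k) x)" for x
  have [measurable]: "f \<in> borel_measurable m" unfolding f_def by measurable
  \<comment> \<open>Ensures that \<open>nn_diff\<close> applies to the pair \<open>n\<close>,
    \<open>r k\<close> as soon as \<open>k\<close> is at least \<open>n\<close>.\<close>
  have rge: "k \<le> r k" for k
    using rmono by (induction k) (auto intro: Suc_leI order.strict_trans1)
  have fatou: "(\<integral>\<^sup>+x. ennreal ((cmod (f x - s n x))\<^sup>2) \<partial>m) \<le> ennreal (tail n)" for n
  proof -
    have "AE x in m. ennreal ((cmod (f x - s n x))\<^sup>2) = liminf (\<lambda>k. ennreal ((cmod (s (r k) x - s n x))\<^sup>2))"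
      using conv
    proof eventually_elim
      case (elim x)
      then have "(\<lambda>k. s (r k) x) \<longlonglongrightarrow> f x" by (simp add: f_def convergent_LIMSEQ_iff)
      then have "(\<lambda>k. ennreal ((cmod (s (r k) x - s n x))\<^sup>2)) \<longlonglongrightarrow> ennreal ((cmod (f x - s n x))\<^sup>2)"
        by (intro tendsto_intros) auto
      then show ?case by (intro lim_imp_Liminf[symmetric]) auto
    qed
    then have "(\<integral>\<^sup>+x. ennreal ((cmod (f x - s n x))\<^sup>2) \<partial>m)
        = (\<integral>\<^sup>+x. liminf (\<lambda>k. ennreal ((cmod (s (r k) x - s n x))\<^sup>2)) \<partial>m)"
      by (rule nn_integral_cong_AE)
    also have "\<dots> \<le> liminf (\<lambda>k. \<integral>\<^sup>+x. ennreal ((cmod (s (r k) x - s n x))\<^sup>2) \<partial>m)"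
      by (rule nn_integral_liminf) measurable
    also have "\<dots> \<le> ennreal (tail n)"
    proof (rule Liminf_le)
      show "\<forall>\<^sub>F k in sequentially. (\<integral>\<^sup>+x. ennreal ((cmod (s (r k) x - s n x))\<^sup>2) \<partial>m) \<le> ennreal (tail n)"
        using eventually_ge_at_top[of n]
        by eventually_elim (use nn_diff rge order_trans in blast)
    qed simp
    finally show ?thesis .
  qed
  have fs: "(\<lambda>x. f x - s n x) \<in> L2 m" for n
  proof -
    have "integrable m (\<lambda>x. (cmod (f x - s n x))\<^sup>2)"
      using fatou[of n] by (intro integrableI_bounded) (auto simp: le_less_trans)
    then show ?thesis by (simp add: L2_def)
  qed
  show ?thesis
  proof (rule bexI, rule allI)
    show "f \<in> L2 m" using L2_add[OF fs[of 0] sL2[of 0]] by simp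
    fix n
    have "ennreal ((L2_norm m (\<lambda>x. f x - s n x))\<^sup>2) = (\<integral>\<^sup>+x. ennreal ((cmod (f x - s n x))\<^sup>2) \<partial>m)"
      unfolding L2_norm_power2 by (rule nn_integral_eq_integral[symmetric]) (auto intro!: L2_integrable fs)
    also have "\<dots> \<le> ennreal (tail n)" by (rule fatou)
    finally have "(L2_norm m (\<lambda>x. f x - s n x))\<^sup>2 \<le> tail n" by (subst (asm) ennreal_le_iff)
         (auto simp: tail_def intro!: suminf_nonneg c summable_ignore_initial_segment)
    then show "(L2_norm m (\<lambda>x. f x - partial c {..<n} x))\<^sup>2 \<le> (\<Sum>i. (cmod (c (i + n)))\<^sup>2)"
      by (simp add: s_def tail_def)
  qed
qed

lemma riesz_fischer:
  assumes c: "summable (\<lambda>i. (cmod (c i))\<^sup>2)"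
  shows "\<exists>f\<in>L2 m. (\<forall>i. L2_inner m f (e i) = c i) \<and>
    (\<lambda>n. L2_norm m (\<lambda>x. f x - partial c {..<n} x)) \<longlonglongrightarrow> 0"
proof -
  obtain f where f: "f \<in> L2 m" and
    bound: "\<And>n. (L2_norm m (\<lambda>x. f x - partial c {..<n} x))\<^sup>2 \<le> (\<Sum>i. (cmod (c (i + n)))\<^sup>2)"
    using riesz_fischer_limit[OF c] by blast
  have "(\<lambda>n. (L2_norm m (\<lambda>x. f x - partial c {..<n} x))\<^sup>2) \<longlonglongrightarrow> 0"
    by (rule tendsto_sandwich[OF _ _ tendsto_const suminf_exist_split2[OF c]]) (use bound in auto)
  then have lim: "(\<lambda>n. L2_norm m (\<lambda>x. f x - partial c {..<n} x)) \<longlonglongrightarrow> 0"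
    by (auto dest!: tendsto_real_sqrt)
  have "L2_inner m f (e i) = c i" for i
  proof -
    have "(\<lambda>n. L2_norm m (\<lambda>x. f x - partial c {..<n} x) * L2_norm m (e i)) \<longlonglongrightarrow> 0"
      using tendsto_mult_left_zero[OF lim] by simp
    then have "(\<lambda>n. L2_inner m (\<lambda>x. f x - partial c {..<n} x) (e i)) \<longlonglongrightarrow> 0"
      by (rule Lim_null_comparison[rotated])
         (auto intro!: always_eventually L2_Cauchy_Schwarz L2_diff f e_L2 partial_L2)
    moreover have "\<forall>\<^sub>F n in sequentially. L2_inner m (\<lambda>x. f x - partial c {..<n} x) (e i) = L2_inner m f (e i) - c i"
      using eventually_gt_at_top[of i]
      by eventually_elim (simp add: L2_inner_diff_left f e_L2 partial_L2 inner_partial_e)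
    ultimately have "(\<lambda>n. L2_inner m f (e i) - c i) \<longlonglongrightarrow> 0" using tendsto_cong by fast
    then show ?thesis by (simp add: LIMSEQ_const_iff)
  qed
  then show ?thesis using f lim by blast
qed

text \<open>Riesz-Fischer produces some \<open>g\<close> with the coefficients of \<open>f\<close>
  that is the limit of the partial sums; completeness of the basis identifies it with
  \<open>f\<close> almost everywhere.\<close>

lemma expansion:
  assumes f: "f \<in> L2 m"
  shows "(\<lambda>n. L2_norm m (\<lambda>x. f x - partial (\<lambda>i. L2_inner m f (e i)) {..<n} x)) \<longlonglongrightarrow> 0"
proof -
  define c where "c = (\<lambda>i. L2_inner m f (e i))"
  obtain g where g: "g \<in> L2 m" "\<And>i. L2_inner m g (e i) = c i"
    and lim: "(\<lambda>n. L2_norm m (\<lambda>x. g x - partial c {..<n} x)) \<longlonglongrightarrow> 0"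
    using riesz_fischer[of c] coefficients_summable[OF f] unfolding c_def by blast
  have "AE x in m. f x - g x = 0"
    using f g by (intro complete) (auto simp: L2_diff L2_inner_diff_left e_L2 c_def)
  then have "L2_norm m (\<lambda>x. f x - partial c {..<n} x) = L2_norm m (\<lambda>x. g x - partial c {..<n} x)" for n
    using f g by (intro L2_norm_cong_AE) (auto intro: L2_diff partial_L2)
  with lim show ?thesis by (simp add: c_def)
qed

lemma parseval:
  assumes f: "f \<in> L2 m" and g: "g \<in> L2 m"
  shows "(\<lambda>i. L2_inner m f (e i) * cnj (L2_inner m g (e i))) sums L2_inner m f g"
proof -
  define c where "c = (\<lambda>i. L2_inner m f (e i))"
  have "(\<lambda>n. L2_norm m (\<lambda>x. f x - partial c {..<n} x) * L2_norm m g) \<longlonglongrightarrow> 0"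
    using tendsto_mult_left_zero[OF expansion[OF f]] by (simp add: c_def)
  then have "(\<lambda>n. L2_inner m (\<lambda>x. f x - partial c {..<n} x) g) \<longlonglongrightarrow> 0"
    by (rule Lim_null_comparison[rotated])
       (auto intro!: always_eventually L2_Cauchy_Schwarz L2_diff f g partial_L2)
  then have "(\<lambda>n. L2_inner m f g - L2_inner m (partial c {..<n}) g) \<longlonglongrightarrow> 0"
    by (simp add: L2_inner_diff_left f g partial_L2)
  then have "(\<lambda>n. L2_inner m f g - (L2_inner m f g - L2_inner m (partial c {..<n}) g))
      \<longlonglongrightarrow> L2_inner m f g - 0"
    by (intro tendsto_diff tendsto_const)
  then show ?thesis unfolding sums_def by (simp add: inner_partial g c_def L2_inner_cnj)
qed

lemma parseval_norm:
  assumes f: "f \<in> L2 m"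
  shows "(\<lambda>i. (cmod (L2_inner m f (e i)))\<^sup>2) sums (L2_norm m f)\<^sup>2"
proof -
  have "(\<lambda>i. complex_of_real ((cmod (L2_inner m f (e i)))\<^sup>2)) sums complex_of_real ((L2_norm m f)\<^sup>2)"
    using parseval[OF f f] by (simp only: L2_inner_self complex_norm_square)
  then show ?thesis by (simp only: sums_of_real_iff)
qed

lemma AE_eq_iff_coefficients:
  assumes "f \<in> L2 m" "g \<in> L2 m"
  shows "(AE x in m. f x = g x) \<longleftrightarrow> (\<forall>i. L2_inner m f (e i) = L2_inner m g (e i))"
proof
  assume "AE x in m. f x = g x"
  then show "\<forall>i. L2_inner m f (e i) = L2_inner m g (e i)"
    using assms by (auto intro!: L2_inner_cong_AE e_L2)
next
  assume "\<forall>i. L2_inner m f (e i) = L2_inner m g (e i)"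
  then have "AE x in m. f x - g x = 0"
    using assms by (intro complete) (auto simp: L2_diff L2_inner_diff_left e_L2)
  then show "AE x in m. f x = g x" by simp
qed

subsection \<open>Diagonal operators\<close>

text \<open>The multiplication operator on coefficients with its maximal domain. Maximality is what
  makes it equal to its adjoint, and a condition on coefficients alone is automatically insensitive
  to null sets.\<close>

definition diagonal :: "(nat \<Rightarrow> real) \<Rightarrow> ('a \<Rightarrow> complex) rel" where
  "diagonal l = {(f, u). f \<in> L2 m \<and> u \<in> L2 m \<and>
     (\<forall>i. L2_inner m u (e i) = of_real (l i) * L2_inner m f (e i))}"

lemma e_diagonal: "(e i, \<lambda>x. of_real (l i) * e i x) \<in> diagonal l"
  by (simp add: diagonal_def e_L2 L2_scale L2_inner_scale_left orthonormal)

lemma L2_operator_diagonal: "L2_operator m (diagonal l)" unfolding L2_operator_def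
proof (intro conjI ballI allI impI; (clarify)?)
  fix f u g v
  assume "f \<in> L2 m" "u \<in> L2 m" "(g, v) \<in> diagonal l" "AE x in m. f x = g x" "AE x in m. u x = v x"
  then show "(f, u) \<in> diagonal l" unfolding diagonal_def by (auto simp: AE_eq_iff_coefficients)
next
  fix f u g v c
  assume "(f, u) \<in> diagonal l" "(g, v) \<in> diagonal l"
  then show "(\<lambda>x. c * f x + g x, \<lambda>x. c * u x + v x) \<in> diagonal l"
    unfolding diagonal_def by (auto simp: L2_lincomb L2_inner_lincomb_left e_L2 distrib_left)
qed (auto simp: diagonal_def AE_eq_iff_coefficients)

lemma densely_defined_diagonal: "densely_defined m (diagonal l)" unfolding densely_defined_def
proof (intro ballI allI impI)
  fix g and r :: real
  assume g: "g \<in> L2 m" and "r > 0"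
  define c where "c = (\<lambda>i. L2_inner m g (e i))"
  obtain n where n: "L2_norm m (\<lambda>x. g x - partial c {..<n} x) < r"
    using order_tendstoD(2)[OF expansion[OF g] \<open>r > 0\<close>] eventually_happens trivial_limit_sequentially
    unfolding c_def by blast
  have "(partial c {..<n}, partial (\<lambda>i. l i * c i) {..<n}) \<in> diagonal l"
    unfolding diagonal_def by (auto simp: partial_L2 inner_partial_e)
  then show "\<exists>f\<in>Domain (diagonal l). L2_norm m (\<lambda>x. f x - g x) < r"
    using n L2_norm_minus_commute by (metis Domain.DomainI)
qed

text \<open>Testing an element of the adjoint against the basis vectors forces the eigenvalue
  relation. Conversely, Parseval turns both inner products into the same series, because
  \<open>l\<close> is real.\<close>

lemma adjoint_diagonal: "adjoint_graph m (diagonal l) = diagonal l"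
proof (intro set_eqI iffI; clarify)
  fix f u
  assume "(f, u) \<in> adjoint_graph m (diagonal l)"
  then have fu: "f \<in> L2 m" "u \<in> L2 m"
    and *: "\<And>g v. (g, v) \<in> diagonal l \<Longrightarrow> L2_inner m v f = L2_inner m g u"
    by (auto simp: adjoint_graph_def)
  have "L2_inner m u (e i) = of_real (l i) * L2_inner m f (e i)" for i
    using arg_cong[OF *[OF e_diagonal], of cnj i]
    by (simp add: L2_inner_scale_left e_L2 fu L2_inner_cnj)
  then show "(f, u) \<in> diagonal l" by (simp add: diagonal_def fu)
next
  fix f u
  assume fu: "(f, u) \<in> diagonal l"
  have "L2_inner m v f = L2_inner m g u" if "(g, v) \<in> diagonal l" for g v
  proof (rule sums_unique2)
    show "(\<lambda>i. L2_inner m v (e i) * cnj (L2_inner m f (e i))) sums L2_inner m v f"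
      using fu that by (intro parseval) (auto simp: diagonal_def)
    have "(\<lambda>i. L2_inner m g (e i) * cnj (L2_inner m u (e i))) sums L2_inner m g u"
      using fu that by (intro parseval) (auto simp: diagonal_def)
    then show "(\<lambda>i. L2_inner m v (e i) * cnj (L2_inner m f (e i))) sums L2_inner m g u"
      using fu that by (simp add: diagonal_def algebra_simps)
  qed
  then show "(f, u) \<in> adjoint_graph m (diagonal l)"
    using fu by (auto simp: adjoint_graph_def diagonal_def)
qed

lemma selfadjoint_diagonal: "selfadjoint_operator m (diagonal l)"
  by (simp add: selfadjoint_operator_def L2_operator_diagonal densely_defined_diagonal adjoint_diagonal)

section \<open>Identification of the self-adjoint extension and its spectrum\<close>

lemma adjoint_graph_antimono: "A \<subseteq> B \<Longrightarrow> adjoint_graph m B \<subseteq> adjoint_graph m A"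
  by (auto simp: adjoint_graph_def)

text \<open>A self-adjoint \<open>B\<close> containing \<open>G\<close> equals its adjoint, which
  lies in the adjoint of \<open>G\<close> and hence in the diagonal operator; passing to adjoints
  once more reverses this inclusion. Two inclusions about \<open>G\<close> thus settle existence and
  uniqueness together.\<close>

lemma selfadjoint_extension_eq_diagonal:
  assumes "G \<subseteq> diagonal l" "adjoint_graph m G \<subseteq> diagonal l"
  shows "selfadjoint_extension m G = diagonal l" unfolding selfadjoint_extension_def
proof (rule the_equality)
  show "selfadjoint_operator m (diagonal l) \<and> G \<subseteq> diagonal l"
    using assms selfadjoint_diagonal by simp
next
  fix B
  assume B: "selfadjoint_operator m B \<and> G \<subseteq> B"
  then have "B \<subseteq> diagonal l"
    using adjoint_graph_antimono[of G B] assms(2) by (auto simp: selfadjoint_operator_def)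
  moreover from this have "diagonal l \<subseteq> B"
    using adjoint_graph_antimono[of B "diagonal l"] B adjoint_diagonal[of l]
    by (auto simp: selfadjoint_operator_def)
  ultimately show "B = diagonal l" by simp
qed

text \<open>At a point of \<open>S\<close> there are eigenvalues arbitrarily close, and their unit
  eigenvectors contradict every resolvent bound. Away from \<open>S\<close>, division of
  coefficients by \<open>l i - z\<close> is bounded by the reciprocal of the distance to
  \<open>S\<close>, so Riesz-Fischer solves the equation and Parseval gives the norm
  estimate.\<close>

lemma op_spectrum_diagonal:
  assumes "closed S" "range l \<subseteq> S" "S \<subseteq> closure (range l)"
  shows "op_spectrum m (diagonal l) = complex_of_real ` S"
proof -
  have "z \<in> resolvent_set m (diagonal l) \<longleftrightarrow> z \<notin> complex_of_real ` S" for z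
  proof
    assume "z \<in> resolvent_set m (diagonal l)"
    then obtain c where c: "\<And>f u. (f, u) \<in> diagonal l \<Longrightarrow>
        L2_norm m f \<le> c * L2_norm m (\<lambda>x. u x - z * f x)"
      unfolding resolvent_set_def by blast
    have e1: "L2_norm m (e i) = 1" for i using L2_inner_self[of m "e i"] orthonormal[of i i]
      by (metis L2_norm_nonneg of_real_1 of_real_eq_iff power2_eq_1_iff one_neq_neg_one
          zero_le_one neg_0_le_iff_le not_one_le_zero)
    have ge: "1 \<le> c * cmod (of_real (l i) - z)" for i
      using c[OF e_diagonal[of i l]] L2_norm_scale[of m "of_real (l i) - z" "e i"] e1
      by (simp add: algebra_simps)
    show "z \<notin> complex_of_real ` S"
    proof
      assume "z \<in> complex_of_real ` S"
      then obtain s where s: "z = of_real s" "s \<in> closure (range l)" using assms by blast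
      have "c > 0"
        using ge[of 0] by (smt (verit) mult_nonneg_nonneg mult_nonpos_nonneg norm_ge_zero)
      then obtain i where "dist (l i) s < 1 / c"
        using s(2) unfolding closure_approachable by (metis rangeE zero_less_divide_1_iff)
      then have "c * cmod (of_real (l i) - z) < 1"
        using \<open>c > 0\<close> by (simp add: s dist_real_def field_simps flip: of_real_diff)
      with ge[of i] show False by simp
    qed
  next
    assume z: "z \<notin> complex_of_real ` S"
    have "closed (complex_of_real ` S)"
      using assms(1) by (rule closed_injective_linear_image) (auto intro: linearI simp: scaleR_conv_of_real inj_on_def)
    then obtain \<delta> where \<delta>: "\<delta> > 0" "\<And>s. s \<in> S \<Longrightarrow> \<delta> \<le> cmod (of_real s - z)"
      using z separate_point_closed[of "complex_of_real ` S" z] by (auto simp: dist_norm norm_minus_commute)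
    have \<delta>l: "\<delta> \<le> cmod (of_real (l i) - z)" for i using \<delta>(2) assms(2) by blast
    then have nz: "of_real (l i) - z \<noteq> 0" for i
      using \<delta>(1) order.strict_trans2[OF \<delta>(1) \<delta>l[of i]] by (metis norm_zero less_irrefl)
    have bound: "cmod w / cmod (of_real (l i) - z) \<le> cmod w / \<delta>" for w i
      using \<delta>(1) \<delta>l[of i] nz[of i] by (intro divide_left_mono mult_pos_pos) (simp_all only: zero_less_norm_iff norm_ge_zero not_False_eq_True)
    have "\<exists>(f, u)\<in>diagonal l. AE x in m. u x - z * f x = g x" if g: "g \<in> L2 m" for g
    proof -
      define c where "c i = L2_inner m g (e i)" for i
      \<comment> \<open>The coefficients that the solution \<open>f\<close> must have, since
        \<open>c i = (l i - z) * a i\<close>.\<close>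
      define a where "a i = c i / (of_real (l i) - z)" for i
      have "summable (\<lambda>i. (cmod (a i))\<^sup>2)"
      proof (rule summable_comparison_test)
        show "\<exists>N. \<forall>n\<ge>N. norm ((cmod (a n))\<^sup>2) \<le> (1 / \<delta>\<^sup>2) * (cmod (c n))\<^sup>2"
        proof (intro exI allI impI)
          fix n :: nat
          have "(cmod (a n))\<^sup>2 \<le> (cmod (c n) / \<delta>)\<^sup>2"
            unfolding a_def norm_divide by (intro power_mono bound) auto
          then show "norm ((cmod (a n))\<^sup>2) \<le> (1 / \<delta>\<^sup>2) * (cmod (c n))\<^sup>2"
            by (simp add: power_divide)
        qed
        show "summable (\<lambda>n. (1 / \<delta>\<^sup>2) * (cmod (c n))\<^sup>2)"
          unfolding c_def by (intro summable_mult coefficients_summable g)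
      qed
      then obtain f where f: "f \<in> L2 m" "\<And>i. L2_inner m f (e i) = a i"
        using riesz_fischer[of a] by blast
      define u where "u x = z * f x + g x" for x
      have u: "u \<in> L2 m" unfolding u_def by (rule L2_lincomb[OF f(1) g])
      have "L2_inner m u (e i) = of_real (l i) * L2_inner m f (e i)" for i
        unfolding u_def using f g nz[of i]
        by (subst L2_inner_lincomb_left) (auto simp: e_L2 a_def c_def[symmetric] field_simps)
      then have "(f, u) \<in> diagonal l" using f u by (simp add: diagonal_def)
      then show ?thesis by (auto simp: u_def intro!: bexI[of _ "(f, u)"])
    qed
    moreover have "L2_norm m f \<le> (1 / \<delta>) * L2_norm m (\<lambda>x. u x - z * f x)" if "(f, u) \<in> diagonal l" for f u
    proof -
      define g where "g = (\<lambda>x. u x - z * f x)"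
      have fu: "f \<in> L2 m" "u \<in> L2 m" and
        eq: "\<And>i. L2_inner m u (e i) = of_real (l i) * L2_inner m f (e i)"
        using that by (auto simp: diagonal_def)
      have g: "g \<in> L2 m" unfolding g_def by (intro L2_diff L2_scale fu)
      have ge: "L2_inner m g (e i) = (of_real (l i) - z) * L2_inner m f (e i)" for i
        unfolding g_def using fu eq[of i]
        by (simp add: L2_inner_diff_left L2_scale L2_inner_scale_left e_L2 algebra_simps)
      have "\<delta>\<^sup>2 * (L2_norm m f)\<^sup>2 \<le> (L2_norm m g)\<^sup>2"
      proof (rule sums_le)
        show "(\<lambda>i. \<delta>\<^sup>2 * (cmod (L2_inner m f (e i)))\<^sup>2) sums (\<delta>\<^sup>2 * (L2_norm m f)\<^sup>2)"
          by (intro sums_mult parseval_norm fu)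
        show "(\<lambda>i. (cmod (L2_inner m g (e i)))\<^sup>2) sums (L2_norm m g)\<^sup>2"
          by (intro parseval_norm g)
        show "\<delta>\<^sup>2 * (cmod (L2_inner m f (e i)))\<^sup>2 \<le> (cmod (L2_inner m g (e i)))\<^sup>2" for i
          unfolding ge norm_mult power_mult_distrib using \<delta>(1) \<delta>l
          by (intro mult_right_mono power_mono) auto
      qed
      then have "(\<delta> * L2_norm m f)\<^sup>2 \<le> (L2_norm m g)\<^sup>2" by (simp add: power_mult_distrib)
      then have "\<delta> * L2_norm m f \<le> L2_norm m g" by (rule power2_le_imp_le) simp
      then show ?thesis using \<delta>(1) by (simp add: g_def field_simps)
    qed
    ultimately show "z \<in> resolvent_set m (diagonal l)" unfolding resolvent_set_def by blast
  qed
  then show ?thesis by (auto simp: op_spectrum_def)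
qed

end

section \<open>Balls of a proper non-compact ultrametric space\<close>

context Ultrametric_space
begin

lemma mball_eq_of_mem:
  assumes "y \<in> mball x r"
  shows "mball y r = mball x r" using assms ultra[of y x] ultra[of x y]
  by (auto simp: commute) (metis commute le_less_trans max_less_iff_conj)+

lemma ball_recentre:
  assumes "B \<in> balls" "x \<in> B"
  obtains r where "0 < r" "B = mball x r"
  using assms mball_eq_of_mem unfolding balls_def by blast

lemma mball_in_balls: "x \<in> M \<Longrightarrow> 0 < r \<Longrightarrow> mball x r \<in> balls" unfolding balls_def by blast

lemma ball_subset: "B \<in> balls \<Longrightarrow> B \<subseteq> M" unfolding balls_def by auto

lemma ball_nonempty: "B \<in> balls \<Longrightarrow> B \<noteq> {}" unfolding balls_def by (auto simp: mball_eq_empty)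

lemma nonsingletonD: "B \<in> nonsingleton_balls \<Longrightarrow> B \<in> balls"
  by (simp add: nonsingleton_balls_def)

lemma balls_nested:
  assumes "A \<in> balls" "B \<in> balls" "A \<inter> B \<noteq> {}"
  shows "A \<subseteq> B \<or> B \<subseteq> A"
proof -
  obtain x where x: "x \<in> A" "x \<in> B" using assms by blast
  obtain r s where "A = mball x r" "B = mball x s" using assms x by (metis ball_recentre)
  then show ?thesis
    using mball_subset_concentric[of r s x] mball_subset_concentric[of s r x] by (cases "r \<le> s") auto
qed

lemma openin_ball: "B \<in> balls \<Longrightarrow> openin mtopology B" unfolding balls_def by auto

lemma closedin_ball:
  assumes "B \<in> balls"
  shows "closedin mtopology B"
proof -
  obtain x r where B: "x \<in> M" "0 < r" "B = mball x r" using assms unfolding balls_def by blast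
  have "openin mtopology (M - B)" unfolding openin_mtopology
  proof (intro conjI allI impI)
    fix y
    assume y: "y \<in> M - B"
    have "mball y r \<inter> B = {}"
    proof (rule ccontr)
      assume "mball y r \<inter> B \<noteq> {}"
      then obtain z where "z \<in> mball y r" "z \<in> mball x r" using B by blast
      then have "mball y r = mball x r" using mball_eq_of_mem by metis
      then show False using y B by auto
    qed
    then show "\<exists>r>0. mball y r \<subseteq> M - B" using B(2) mball_subset_mspace by blast
  qed auto
  then show ?thesis using ball_subset[OF assms] by (simp add: closedin_def)
qed

lemma openin_iff_balls:
  "openin mtopology U \<longleftrightarrow> U \<subseteq> M \<and> (\<forall>x\<in>U. \<exists>B\<in>balls. x \<in> B \<and> B \<subseteq> U)"
proof
  assume U: "openin mtopology U"
  then show "U \<subseteq> M \<and> (\<forall>x\<in>U. \<exists>B\<in>balls. x \<in> B \<and> B \<subseteq> U)"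
    unfolding openin_mtopology by (metis mball_in_balls centre_in_mball_iff subsetD)
next
  assume U: "U \<subseteq> M \<and> (\<forall>x\<in>U. \<exists>B\<in>balls. x \<in> B \<and> B \<subseteq> U)"
  then have "U = \<Union>{B \<in> balls. B \<subseteq> U}" by blast
  moreover have "openin mtopology (\<Union>{B \<in> balls. B \<subseteq> U})"
    by (rule openin_Union) (auto intro: openin_ball)
  ultimately show "openin mtopology U" by simp
qed

end

locale proper_ultrametric = Ultrametric_space +
  assumes proper: proper_metric
    and noncompact: "\<not> compact_space mtopology"
begin

lemma compactin_ball:
  assumes "B \<in> balls"
  shows "compactin mtopology B"
proof -
  obtain x r where B: "x \<in> M" "0 < r" "B = mball x r" using assms unfolding balls_def by blast
  show ?thesis
    using proper B closedin_ball[OF assms] mball_subset_mcball unfolding proper_metric_def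
    by (metis closed_compactin)
qed

lemma M_not_ball: "M \<notin> balls" using compactin_ball noncompact by (auto simp: compact_space_def)

lemma M_nonempty: "M \<noteq> {}" using noncompact by (auto simp: compact_space_def)

lemma ex_larger_ball:
  assumes "B \<in> balls" "y \<in> M"
  obtains Q where "Q \<in> balls" "B \<subseteq> Q" "y \<in> Q"
proof -
  obtain x r where B: "x \<in> M" "0 < r" "B = mball x r" using assms unfolding balls_def by blast
  have "mball x (max r (d x y + 1)) \<in> balls" using B by (auto intro: mball_in_balls)
  moreover have "B \<subseteq> mball x (max r (d x y + 1))"
    unfolding B by (rule mball_subset_concentric) simp
  moreover have "y \<in> mball x (max r (d x y + 1))" using B assms by auto
  ultimately show thesis using that by blast
qed

lemma ball_covering_two:
  assumes "A \<in> balls" "B \<in> balls"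
  obtains Q where "Q \<in> balls" "A \<subseteq> Q" "B \<subseteq> Q"
proof -
  obtain y where y: "y \<in> B" using ball_nonempty[OF assms(2)] by blast
  then obtain Q where Q: "Q \<in> balls" "A \<subseteq> Q" "y \<in> Q"
    using ex_larger_ball[OF assms(1)] ball_subset[OF assms(2)] by blast
  then have "B \<subseteq> Q \<or> Q \<subseteq> B" using balls_nested[of B Q] assms y by blast
  then show thesis using that Q assms by blast
qed

lemma compact_subset_ball:
  assumes "compactin mtopology K"
  obtains B where "B \<in> balls" "K \<subseteq> B"
proof -
  obtain x r where "0 < r" "K \<subseteq> mcball x r"
    using compactin_imp_mbounded[OF assms] unfolding mbounded_pos by blast
  moreover obtain a where a: "a \<in> M" using M_nonempty by blast
  ultimately show thesis
  proof (cases "x \<in> M")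
    case True
    have "mcball x r \<subseteq> mball x (r + 1)" by (rule mcball_subset_mball_concentric) simp
    then show thesis
      using that[OF mball_in_balls[OF True, of "r + 1"]] \<open>0 < r\<close> \<open>K \<subseteq> mcball x r\<close> by auto
  next
    \<comment> \<open>A bounding closed ball may have its centre outside the space, and is then
      empty.\<close>
    case False
    then have "K = {}" using \<open>K \<subseteq> mcball x r\<close> by auto
    then show thesis using that[OF mball_in_balls[OF a, of 1]] by auto
  qed
qed

text \<open>A ball between \<open>V\<close> and \<open>B\<close> is determined by the distances from \<open>x \<in> V\<close> to its points outside \<open>V\<close>; these
  distances are locally constant in the compact set \<open>B - V\<close>.\<close>

lemma finite_balls_between:
  assumes V: "V \<in> balls" and B: "B \<in> balls"
  shows "finite {Q \<in> balls. V \<subseteq> Q \<and> Q \<subseteq> B}"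
proof -
  obtain x where x: "x \<in> V" using ball_nonempty[OF V] by blast
  then have xM: "x \<in> M" using ball_subset[OF V] by blast
  have "compactin mtopology (B - V)"
  proof (rule closed_compactin[OF compactin_ball[OF B]])
    show "closedin mtopology (B - V)"
      by (rule closedin_diff[OF closedin_ball[OF B] openin_ball[OF V]])
  qed auto
  define W where "W = (\<lambda>y. mball y (d x y)) ` (B - V)"
  have pos: "0 < d x y" "y \<in> M" if "y \<in> B - V" for y using that x xM ball_subset[OF B] by auto
  have "\<exists>F. finite F \<and> F \<subseteq> W \<and> B - V \<subseteq> \<Union>F"
  proof (rule compactinD[OF \<open>compactin mtopology (B - V)\<close>])
    show "B - V \<subseteq> \<Union>W" using pos unfolding W_def by fastforce
  qed (auto simp: W_def)
  then obtain F where F: "finite F" "F \<subseteq> W" "B - V \<subseteq> \<Union>F" by blast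
  \<comment> \<open>Triangles are isosceles: \<open>z\<close> is nearer to \<open>y\<close> than
    \<open>x\<close> is, so \<open>x\<close> has the same distance from both.\<close>
  have const: "d x z = d x y" if "y \<in> B - V" "z \<in> mball y (d x y)" for y z
    using that ultra[of x y z] ultra[of x z y] xM by (auto simp: commute[of y])
  have "\<exists>Y. finite Y \<and> Y \<subseteq> B - V \<and> F = (\<lambda>y. mball y (d x y)) ` Y"
    using F(1,2) unfolding W_def by (metis finite_subset_image)
  then obtain Y where Y: "finite Y" "Y \<subseteq> B - V" "F = (\<lambda>y. mball y (d x y)) ` Y" by blast
  have "d x ` (B - V) \<subseteq> d x ` Y"
  proof (rule image_subsetI)
    fix z assume "z \<in> B - V"
    then obtain y where "y \<in> Y" "z \<in> mball y (d x y)" using F(3) unfolding Y(3) by blast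
    then have "y \<in> Y" "d x z = d x y" using const Y(2) by blast+
    then show "d x z \<in> d x ` Y" by simp
  qed
  then have fin: "finite (d x ` (B - V))" using Y(1) finite_surj by blast
  have Q_eq: "Q = V \<union> {y \<in> B. \<exists>t \<in> d x ` (Q - V). d x y \<le> t}" if Q: "Q \<in> balls" "V \<subseteq> Q" "Q \<subseteq> B" for Q
  proof -
    obtain r where r: "Q = mball x r" using Q x by (metis ball_recentre subsetD)
    show ?thesis
    proof (intro equalityI subsetI)
      fix z assume "z \<in> Q"
      then show "z \<in> V \<union> {y \<in> B. \<exists>t \<in> d x ` (Q - V). d x y \<le> t}" using Q by (cases "z \<in> V") auto
    next
      fix z assume "z \<in> V \<union> {y \<in> B. \<exists>t \<in> d x ` (Q - V). d x y \<le> t}"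
      then show "z \<in> Q" using Q ball_subset[OF B] unfolding r by (fastforce simp: xM)
    qed
  qed
  have "inj_on (\<lambda>Q. d x ` (Q - V)) {Q \<in> balls. V \<subseteq> Q \<and> Q \<subseteq> B}"
  proof (rule inj_onI, clarify)
    fix P Q
    assume PQ: "P \<in> balls" "V \<subseteq> P" "P \<subseteq> B" "Q \<in> balls" "V \<subseteq> Q" "Q \<subseteq> B"
      "d x ` (P - V) = d x ` (Q - V)"
    then show "P = Q" using Q_eq[of P] Q_eq[of Q] by simp
  qed
  moreover have "(\<lambda>Q. d x ` (Q - V)) ` {Q \<in> balls. V \<subseteq> Q \<and> Q \<subseteq> B} \<subseteq> Pow (d x ` (B - V))" by auto
  ultimately show ?thesis using fin by (meson finite_Pow_iff finite_imageD finite_subset)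
qed

section \<open>The tree of balls: parents, ancestors and children\<close>

lemma ball_psubsetI:
  assumes "A \<in> balls" "B \<in> balls" "x \<in> A" "x \<in> B" "\<not> B \<subseteq> A"
  shows "A \<subset> B" using balls_nested[of A B] assms by blast

text \<open>As \<open>M\<close> is not a ball, some ball \<open>Q\<close> is strictly larger than
  \<open>B\<close>. Only finitely many balls lie between them, and a minimal one is contained in
  every strictly larger ball by nesting. This applies also to the singleton balls at isolated
  points.\<close>

lemma ex_parent:
  assumes B: "B \<in> balls"
  shows "\<exists>P\<in>balls. B \<subset> P \<and> (\<forall>R\<in>balls. B \<subset> R \<longrightarrow> P \<subseteq> R)"
proof -
  obtain y where y: "y \<in> M" "y \<notin> B" using B M_not_ball ball_subset[OF B] by (cases "B = M") auto
  obtain Q where Q: "Q \<in> balls" "B \<subseteq> Q" "y \<in> Q" using ex_larger_ball[OF B y(1)] by blast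
  define F where "F = {R \<in> balls. B \<subset> R \<and> R \<subseteq> Q}"
  have "F \<subseteq> {R \<in> balls. B \<subseteq> R \<and> R \<subseteq> Q}" "Q \<in> F" using Q y by (auto simp: F_def)
  then have "finite F" "F \<noteq> {}" using finite_balls_between[OF B Q(1)] finite_subset by auto
  then obtain P where P: "P \<in> F" "\<And>R. R \<in> F \<Longrightarrow> R \<subseteq> P \<Longrightarrow> R = P"
    using finite_has_minimal[of F] by metis
  obtain x where x: "x \<in> B" using ball_nonempty[OF B] by blast
  have "P \<subseteq> R" if R: "R \<in> balls" "B \<subset> R" for R
  proof (rule ccontr)
    assume "\<not> P \<subseteq> R"
    then have "R \<subset> P" using ball_psubsetI[of R P x] R P x unfolding F_def by blast
    moreover from this have "R \<in> F" using P(1) R unfolding F_def by blast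
    ultimately show False using P(2)[of R] by blast
  qed
  then show ?thesis using P(1) unfolding F_def by blast
qed

definition parent :: "'a set \<Rightarrow> 'a set" where
  "parent B = (SOME P. P \<in> balls \<and> B \<subset> P \<and> (\<forall>R\<in>balls. B \<subset> R \<longrightarrow> P \<subseteq> R))"

lemma
  assumes "B \<in> balls"
  shows parent_ball: "parent B \<in> balls"
    and psubset_parent: "B \<subset> parent B"
    and parent_least: "R \<in> balls \<Longrightarrow> B \<subset> R \<Longrightarrow> parent B \<subseteq> R"
proof -
  have "\<exists>P. P \<in> balls \<and> B \<subset> P \<and> (\<forall>R\<in>balls. B \<subset> R \<longrightarrow> P \<subseteq> R)" using ex_parent[OF assms] by blast
  then have "parent B \<in> balls \<and> B \<subset> parent B \<and> (\<forall>R\<in>balls. B \<subset> R \<longrightarrow> parent B \<subseteq> R)"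
    unfolding parent_def by (rule someI_ex)
  then show "parent B \<in> balls" "B \<subset> parent B" "R \<in> balls \<Longrightarrow> B \<subset> R \<Longrightarrow> parent B \<subseteq> R" by simp_all
qed

lemma psupset_ball_nonsingleton:
  assumes "A \<in> balls" "B \<in> balls" "A \<subset> B"
  shows "B \<in> nonsingleton_balls"
  using assms ball_nonempty[of A] by (auto simp: nonsingleton_balls_def is_singleton_def)

lemma parent_ns: "B \<in> balls \<Longrightarrow> parent B \<in> nonsingleton_balls"
  by (rule psupset_ball_nonsingleton[OF _ parent_ball psubset_parent])

lemma parent_unique:
  assumes "B \<in> balls" "P \<in> balls" "B \<subset> P" "\<And>R. R \<in> balls \<Longrightarrow> B \<subset> R \<Longrightarrow> P \<subseteq> R"
  shows "parent B = P"
proof (rule subset_antisym)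
  show "parent B \<subseteq> P" by (rule parent_least[OF assms(1-3)])
  show "P \<subseteq> parent B" by (rule assms(4)[OF parent_ball psubset_parent]) (rule assms)+
qed

abbreviation ancestor :: "'a set \<Rightarrow> nat \<Rightarrow> 'a set" where
  "ancestor B n \<equiv> (parent ^^ n) B"

lemma ancestor_ball: "B \<in> balls \<Longrightarrow> ancestor B n \<in> balls"
  by (induction n) (auto intro: parent_ball)

lemma ancestor_ns: "B \<in> nonsingleton_balls \<Longrightarrow> ancestor B n \<in> nonsingleton_balls"
  by (induction n) (auto intro: parent_ns nonsingletonD)

lemma ancestor_strict_mono:
  assumes "B \<in> balls" "i < j"
  shows "ancestor B i \<subset> ancestor B j"
  by (rule lift_Suc_mono_less[OF _ assms(2)]) (simp only: funpow.simps comp_apply psubset_parent ancestor_ball assms)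

lemma ancestor_mono:
  assumes "B \<in> balls" "i \<le> j"
  shows "ancestor B i \<subseteq> ancestor B j"
  using ancestor_strict_mono[of B i j] assms by (cases "i = j") auto

lemma ball_subset_ancestor: "B \<in> balls \<Longrightarrow> B \<subseteq> ancestor B n" using ancestor_mono[of B 0 n] by simp

lemma inj_ancestor: "B \<in> balls \<Longrightarrow> inj (ancestor B)"
  by (rule injI) (metis ancestor_strict_mono linorder_neqE_nat psubset_eq)

text \<open>Induction on the finite number of balls between \<open>B\<close> and \<open>Q\<close>;
  passing to the parent removes \<open>B\<close> from them. The balls above \<open>B\<close>
  therefore form one sequence, which turns sums over them into ordinary series.\<close>

lemma superball_is_ancestor:
  assumes "B \<in> balls" "Q \<in> balls" "B \<subseteq> Q"
  shows "\<exists>n. Q = ancestor B n" using assms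
proof (induction "card {R \<in> balls. B \<subseteq> R \<and> R \<subseteq> Q}" arbitrary: B rule: less_induct)
  case (less B)
  show ?case
  proof (cases "Q = B")
    case True
    then show ?thesis by (intro exI[of _ 0]) simp
  next
    case False
    then have sub: "parent B \<subseteq> Q" using less.prems by (intro parent_least) auto
    have "{R \<in> balls. parent B \<subseteq> R \<and> R \<subseteq> Q} \<subset> {R \<in> balls. B \<subseteq> R \<and> R \<subseteq> Q}"
      using psubset_parent[OF less.prems(1)] less.prems by blast
    then have "card {R \<in> balls. parent B \<subseteq> R \<and> R \<subseteq> Q} < card {R \<in> balls. B \<subseteq> R \<and> R \<subseteq> Q}"
      by (rule psubset_card_mono[OF finite_balls_between[OF less.prems(1,2)]])
    then obtain n where "Q = ancestor (parent B) n"
      using less.hyps[OF _ parent_ball[OF less.prems(1)] less.prems(2) sub] by blast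
    then show ?thesis by (intro exI[of _ "Suc n"]) (simp add: funpow_swap1)
  qed
qed

lemma superballs_eq_range:
  assumes "B \<in> balls"
  shows "{Q \<in> balls. B \<subseteq> Q} = range (ancestor B)"
proof (intro equalityI subsetI)
  fix Q assume "Q \<in> {Q \<in> balls. B \<subseteq> Q}"
  then show "Q \<in> range (ancestor B)" using superball_is_ancestor[OF assms] by blast
next
  fix Q assume "Q \<in> range (ancestor B)"
  then show "Q \<in> {Q \<in> balls. B \<subseteq> Q}"
    using ancestor_ball[OF assms] ball_subset_ancestor[OF assms] by blast
qed

lemma nonsingleton_superballs_eq_range:
  assumes "B \<in> nonsingleton_balls"
  shows "{Q \<in> nonsingleton_balls. B \<subseteq> Q} = range (ancestor B)"
proof -
  have "{Q \<in> nonsingleton_balls. B \<subseteq> Q} = {Q \<in> balls. B \<subseteq> Q} \<inter> nonsingleton_balls"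
    using nonsingletonD by blast
  then show ?thesis using ancestor_ns[OF assms]
    unfolding superballs_eq_range[OF nonsingletonD[OF assms]] by blast
qed

lemma nonsingleton_strict_superballs:
  assumes "B \<in> balls"
  shows "{Q \<in> nonsingleton_balls. B \<subset> Q} = {Q \<in> nonsingleton_balls. parent B \<subseteq> Q}"
  using parent_least[OF assms] psubset_parent[OF assms] nonsingletonD by blast

lemma ancestor_covers:
  assumes "B \<in> balls" "y \<in> M"
  obtains n where "y \<in> ancestor B n"
  using ex_larger_ball[OF assms] superball_is_ancestor[OF assms(1)] by metis

lemma parent_eqD_disjoint:
  assumes "A \<in> balls" "B \<in> balls" "parent A = parent B" "A \<inter> B \<noteq> {}"
  shows "A = B"
proof (rule ccontr)
  assume "A \<noteq> B"
  then have "A \<subset> B \<or> B \<subset> A" using balls_nested[of A B] assms by blast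
  then have "parent A \<subseteq> B \<or> parent B \<subseteq> A" using parent_least assms by blast
  then show False using assms psubset_parent by blast
qed

lemma subball_subset_child:
  assumes "B \<in> balls" "Q \<in> balls" "Q \<subset> B"
  obtains T where "T \<in> balls" "parent T = B" "Q \<subseteq> T"
proof -
  define F where "F = {R \<in> balls. Q \<subseteq> R \<and> R \<subset> B}"
  have "F \<subseteq> {R \<in> balls. Q \<subseteq> R \<and> R \<subseteq> B}" "Q \<in> F" using assms by (auto simp: F_def)
  then have "finite F" "F \<noteq> {}" using finite_balls_between[OF assms(2,1)] finite_subset by auto
  then obtain T where T: "T \<in> F" "\<And>R. R \<in> F \<Longrightarrow> T \<subseteq> R \<Longrightarrow> R = T"
    using finite_has_maximal[of F] by metis
  obtain x where x: "x \<in> Q" using ball_nonempty assms by blast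
  have "parent T = B"
  proof (rule parent_unique)
    show "T \<in> balls" "B \<in> balls" "T \<subset> B" using T assms by (auto simp: F_def)
    fix R
    assume R: "R \<in> balls" "T \<subset> R"
    show "B \<subseteq> R"
    proof (rule ccontr)
      assume "\<not> B \<subseteq> R"
      then have "R \<subset> B" using ball_psubsetI[of R B x] R T x assms unfolding F_def by blast
      moreover from this have "R \<in> F" using T(1) R unfolding F_def by blast
      ultimately show False using T(2)[of R] R by blast
    qed
  qed
  then show thesis using that T(1) unfolding F_def by blast
qed

text \<open>A second point \<open>y\<close> of \<open>B\<close> gives the open ball around
  \<open>x\<close> of radius \<open>d x y\<close>, which misses \<open>y\<close> and so is a proper
  subball; the child containing this subball is the one wanted.\<close>

lemma point_in_child:
  assumes "B \<in> nonsingleton_balls" "x \<in> B"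
  obtains T where "T \<in> balls" "parent T = B" "x \<in> T"
proof -
  have B: "B \<in> balls" using assms by (simp add: nonsingletonD)
  then obtain r where r: "0 < r" "B = mball x r" using assms by (meson ball_recentre)
  have "B \<noteq> {x}" using assms by (auto simp: nonsingleton_balls_def is_singleton_def)
  then obtain y where y: "y \<in> B" "y \<noteq> x" using assms by blast
  have *: "mball x (d x y) \<in> balls" "x \<in> mball x (d x y)"
    using r y by (auto intro: mball_in_balls)
  moreover have "\<not> B \<subseteq> mball x (d x y)" using y by auto
  ultimately have "mball x (d x y) \<subset> B" using ball_psubsetI assms B by blast
  then obtain T where "T \<in> balls" "parent T = B" "mball x (d x y) \<subseteq> T"
    by (rule subball_subset_child[OF B *(1)])
  then show thesis using *(2) by (intro that[of T]) blast+
qed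

text \<open>The children form an open cover of the compact ball \<open>B\<close> by disjoint
  non-empty sets, so no finite subcover can omit any of them.\<close>

lemma finite_children:
  assumes "B \<in> balls"
  shows "finite {T \<in> balls. parent T = B}"
proof (cases "B \<in> nonsingleton_balls")
  case True
  have "\<exists>F. finite F \<and> F \<subseteq> {T \<in> balls. parent T = B} \<and> B \<subseteq> \<Union>F"
  proof (rule compactinD[OF compactin_ball[OF assms]])
    show "B \<subseteq> \<Union>{T \<in> balls. parent T = B}" using point_in_child[OF True] by blast
  qed (auto intro: openin_ball)
  then obtain F where F: "finite F" "F \<subseteq> {T \<in> balls. parent T = B}" "B \<subseteq> \<Union>F" by blast
  have "{T \<in> balls. parent T = B} \<subseteq> F"
  proof clarify
    fix T assume T: "T \<in> balls" "B = parent T"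
    then obtain x where x: "x \<in> T" "x \<in> B" using ball_nonempty psubset_parent by blast
    then obtain T' where "T' \<in> F" "x \<in> T'" using F by blast
    then show "T \<in> F" using parent_eqD_disjoint[of T T'] T F x by blast
  qed
  then show ?thesis using F finite_subset by blast
next
  case False
  then have "{T \<in> balls. parent T = B} = {}" using parent_ns by blast
  then show ?thesis by (simp only: finite.emptyI)
qed

text \<open>Every ball contains a point \<open>q\<close> of a countable dense set and lies between
  balls around \<open>q\<close> of radii 1/n and n for large n; only finitely many balls do so for a
  given \<open>q\<close> and n.\<close>

lemma countable_balls:
  assumes "separable_space mtopology"
  shows "countable balls"
proof -
  obtain D where D: "countable D" "D \<subseteq> M" "mtopology closure_of D = M"
    using assms unfolding separable_space_def by auto
  have "balls \<subseteq> (\<Union>q\<in>D. \<Union>n::nat. {Q \<in> balls. mball q (1 / Suc n) \<subseteq> Q \<and> Q \<subseteq> mball q (Suc n)})"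
  proof
    fix B assume B: "B \<in> balls"
    then have "B \<inter> D \<noteq> {}"
      using D(3) dense_intersects_open[of mtopology D] openin_ball[OF B] ball_nonempty[OF B]
      by (auto simp: Int_commute)
    then obtain q where q: "q \<in> B" "q \<in> D" by blast
    then obtain r where r: "0 < r" "B = mball q r" using B by (meson ball_recentre)
    obtain n1 n2 :: nat where "r < real n1" "1 / r < real n2" by (meson reals_Archimedean2)
    then have n: "r \<le> real (Suc (n1 + n2))" "1 / r \<le> real (Suc (n1 + n2))" by auto
    then have "1 / real (Suc (n1 + n2)) \<le> r" using r(1) by (simp add: field_simps)
    then have "B \<in> {Q \<in> balls. mball q (1 / Suc (n1 + n2)) \<subseteq> Q \<and> Q \<subseteq> mball q (Suc (n1 + n2))}"
      using n B unfolding r by (auto intro!: mball_subset_concentric simp del: of_nat_Suc)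
    then show "B \<in> (\<Union>q\<in>D. \<Union>n::nat. {Q \<in> balls. mball q (1 / Suc n) \<subseteq> Q \<and> Q \<subseteq> mball q (Suc n)})"
      using q by blast
  qed
  moreover have "countable {Q \<in> balls. mball q (1 / Suc n) \<subseteq> Q \<and> Q \<subseteq> mball q (Suc n)}" if "q \<in> D" for q and n :: nat
    using that D by (intro countable_finite finite_balls_between mball_in_balls) auto
  ultimately show ?thesis using D(1) by (auto intro: countable_subset countable_UN)
qed

end

section \<open>The hierarchical Laplacian on locally constant functions\<close>

text \<open>The assumptions on \<open>m\<close> speak only of the topology, so they carry over to
  any metric that induces the same one. \<open>pos_open\<close> unites the positivity on balls and
  the positivity on isolated points.\<close>

locale proper_ultrametric_measure = proper_ultrametric M d for M :: "'a set" and d +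
  fixes m :: "'a measure"
  assumes separable: "separable_space mtopology"
    and space_m: "space m = M"
    and sets_m: "sets m = sigma_sets M {U. openin mtopology U}"
    and finite_compact: "\<And>K. compactin mtopology K \<Longrightarrow> emeasure m K < \<infinity>"
    and pos_open: "\<And>U. openin mtopology U \<Longrightarrow> U \<noteq> {} \<Longrightarrow> 0 < emeasure m U"
begin

lemma open_sets: "openin mtopology U \<Longrightarrow> U \<in> sets m" unfolding sets_m by auto

lemma ball_sets [measurable]: "B \<in> balls \<Longrightarrow> B \<in> sets m" by (intro open_sets openin_ball)

lemma emeasure_ball_finite: "B \<in> balls \<Longrightarrow> emeasure m B < \<infinity>"
  by (intro finite_compact compactin_ball)

lemma emeasure_ball: "B \<in> balls \<Longrightarrow> emeasure m B = ennreal (measure m B)"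
  using emeasure_ball_finite[of B] by (intro emeasure_eq_ennreal_measure) auto

lemma measure_ball_pos: "B \<in> balls \<Longrightarrow> 0 < measure m B"
  using pos_open[OF openin_ball ball_nonempty, of B] emeasure_ball[of B]
  by (simp add: ennreal_less_zero_iff)

lemma sigma_finite: "sigma_finite_measure m"
proof
  have "\<Union>balls = M"
  proof (rule subset_antisym)
    show "\<Union>balls \<subseteq> M" using ball_subset by blast
    show "M \<subseteq> \<Union>balls"
    proof
      fix x assume "x \<in> M"
      then show "x \<in> \<Union>balls" by (intro UnionI[OF mball_in_balls[of x 1]]) auto
    qed
  qed
  then show "\<exists>A. countable A \<and> A \<subseteq> sets m \<and> \<Union>A = space m \<and> (\<forall>a\<in>A. emeasure m a \<noteq> \<infinity>)"
    using countable_balls[OF separable] emeasure_ball_finite ball_sets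
    by (intro exI[of _ balls]) (auto simp: space_m less_top)
qed

definition supported :: "'a set \<Rightarrow> ('a \<Rightarrow> complex) \<Rightarrow> bool" where
  "supported B f \<longleftrightarrow> (\<forall>x\<in>M - B. f x = 0)"

definition bounded_by :: "real \<Rightarrow> ('a \<Rightarrow> complex) \<Rightarrow> bool" where
  "bounded_by K f \<longleftrightarrow> (\<forall>x\<in>M. cmod (f x) \<le> K)"

lemma integrable_supported:
  assumes "f \<in> borel_measurable m" "B \<in> balls" "supported B f" "bounded_by K f"
  shows "integrable m f"
proof -
  have "integrable m (\<lambda>x. indicator B x * K)"
    using assms(2) emeasure_ball_finite by (intro integrable_mult_left integrable_real_indicator ball_sets) auto
  then show ?thesis by (rule Bochner_Integration.integrable_bound)
       (use assms in \<open>auto intro!: AE_I2 simp: supported_def bounded_by_def space_m indicator_def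
          split: if_splits intro: order_trans[OF _ abs_ge_self]\<close>)
qed

lemma L2_supported:
  assumes "f \<in> borel_measurable m" "B \<in> balls" "supported B f" "bounded_by K f"
  shows "f \<in> L2 m"
proof -
  have "integrable m (\<lambda>x. f x * cnj (f x))"
  proof (rule integrable_supported[OF _ assms(2)])
    show "bounded_by (K * K) (\<lambda>x. f x * cnj (f x))" using assms(4) unfolding bounded_by_def
      by (auto simp: norm_mult intro!: mult_mono elim!: order_trans[rotated])
  qed (use assms in \<open>auto simp: supported_def\<close>)
  then have "integrable m (\<lambda>x. Re (f x * cnj (f x)))" by (rule integrable_Re)
  then show ?thesis using assms(1) by (simp add: L2_def complex_mult_cnj cmod_power2)
qed

lemma integrable_indicator_ball: "B \<in> balls \<Longrightarrow> integrable m (indicator B :: 'a \<Rightarrow> complex)"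
  by (rule integrable_supported[of _ B 1]) (auto simp: supported_def bounded_by_def indicator_def)

lemma indicator_L2: "B \<in> balls \<Longrightarrow> (indicator B :: 'a \<Rightarrow> complex) \<in> L2 m"
  by (rule L2_supported[of _ B 1]) (auto simp: supported_def bounded_by_def indicator_def)

lemma integral_indicator_ball: "B \<in> balls \<Longrightarrow> (LINT x|m. indicator B x) = complex_of_real (measure m B)"
  by (subst of_real_indicator[symmetric], subst integral_complex_of_real)
     (simp add: Int_absorb2 ball_subset space_m)

lemma ball_average_eq:
  "ball_average m B f = (LINT x|m. indicator B x * f x) / of_real (measure m B)"
  by (simp add: ball_average_def set_lebesgue_integral_def scaleR_conv_of_real of_real_indicator)

lemma ball_average_const:
  assumes "B \<in> balls" "\<And>y. y \<in> B \<Longrightarrow> f y = c"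
  shows "ball_average m B f = c"
proof -
  have "(LINT x|m. indicator B x * f x) = (LINT x|m. indicator B x * c)"
    using assms by (intro Bochner_Integration.integral_cong) (auto simp: indicator_def)
  then show ?thesis
    using measure_ball_pos[OF assms(1)] by (simp add: ball_average_eq integral_indicator_ball assms)
qed

lemma ball_average_supported:
  assumes "B \<in> balls" "A \<in> balls" "A \<subseteq> B" "supported A f"
  shows "ball_average m B f = (LINT x|m. f x) / of_real (measure m B)"
proof -
  have "(LINT x|m. indicator B x * f x) = (LINT x|m. f x)"
    using assms by (intro Bochner_Integration.integral_cong) (auto simp: indicator_def supported_def space_m)
  then show ?thesis by (simp add: ball_average_eq)
qed

lemma norm_ball_average:
  assumes "B \<in> balls" "bounded_by K f"
  shows "cmod (ball_average m B f) \<le> K"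
proof -
  have K: "0 \<le> K"
    using assms M_nonempty unfolding bounded_by_def by (meson all_not_in_conv norm_ge_zero order_trans)
  have "cmod (LINT x|m. indicator B x * f x) \<le> (LINT x|m. cmod (indicator B x * f x))"
    by (rule integral_norm_bound)
  also have "\<dots> \<le> (LINT x|m. indicator B x * K)"
  proof (rule integral_mono_AE')
    show "integrable m (\<lambda>x. indicator B x * K)"
      using assms(1) emeasure_ball_finite by (intro integrable_mult_left integrable_real_indicator ball_sets) auto
  qed (use assms K in \<open>auto simp: bounded_by_def space_m indicator_def\<close>)
  also have "\<dots> = measure m B * K" using assms by (simp add: Int_absorb2 ball_subset space_m)
  finally show ?thesis
    using measure_ball_pos[OF assms(1)] by (simp add: ball_average_eq norm_divide field_simps)
qed

definition const_on :: "'a set \<Rightarrow> ('a \<Rightarrow> complex) \<Rightarrow> bool" where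
  "const_on B f \<longleftrightarrow> (\<exists>c. \<forall>x\<in>B. f x = c)"

definition loc_const :: "('a \<Rightarrow> complex) \<Rightarrow> bool" where
  "loc_const f \<longleftrightarrow> (\<forall>x\<in>M. \<exists>B\<in>balls. x \<in> B \<and> const_on B f)"

lemma const_onD: "const_on B f \<Longrightarrow> x \<in> B \<Longrightarrow> y \<in> B \<Longrightarrow> f x = f y" unfolding const_on_def by force

lemma const_onI: "(\<And>x. x \<in> B \<Longrightarrow> f x = c) \<Longrightarrow> const_on B f" unfolding const_on_def by blast

lemma const_on_subset: "const_on B f \<Longrightarrow> A \<subseteq> B \<Longrightarrow> const_on A f" unfolding const_on_def by blast

lemma loc_const_measurable:
  assumes "loc_const f"
  shows "f \<in> borel_measurable m"
proof (rule borel_measurableI)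
  fix S :: "complex set"
  assume "open S"
  have "openin mtopology (f -` S \<inter> space m)" unfolding openin_iff_balls
  proof (intro conjI ballI)
    fix x assume x: "x \<in> f -` S \<inter> space m"
    then obtain B where B: "B \<in> balls" "x \<in> B" "const_on B f"
      using assms unfolding loc_const_def space_m by blast
    have "B \<subseteq> f -` S \<inter> space m"
    proof
      fix y assume "y \<in> B"
      then show "y \<in> f -` S \<inter> space m"
        using x ball_subset[OF B(1)] const_onD[OF B(3) \<open>y \<in> B\<close> B(2)] unfolding space_m by auto
    qed
    then show "\<exists>B\<in>balls. x \<in> B \<and> B \<subseteq> f -` S \<inter> space m" using B by blast
  qed (auto simp: space_m)
  then show "f -` S \<inter> space m \<in> sets m" by (rule open_sets)
qed

text \<open>Every compact set lies in a ball, and balls are closed and compact, so compactness of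
  the support amounts to vanishing outside some ball.\<close>

lemma test_fun_iff:
  "f \<in> locally_constant_compact_support mtopology \<longleftrightarrow> loc_const f \<and> (\<exists>B\<in>balls. supported B f)"
proof -
  have "loc_const f \<longleftrightarrow> (\<forall>x\<in>M. \<exists>U. openin mtopology U \<and> x \<in> U \<and> (\<forall>y\<in>U. f y = f x))" (is "_ \<longleftrightarrow> ?lc")
  proof
    assume lc: "loc_const f"
    show ?lc
    proof
      fix x assume "x \<in> M"
      then obtain B where B: "B \<in> balls" "x \<in> B" "const_on B f"
        using lc unfolding loc_const_def by blast
      then show "\<exists>U. openin mtopology U \<and> x \<in> U \<and> (\<forall>y\<in>U. f y = f x)"
        using const_onD[OF B(3) _ B(2)] openin_ball[OF B(1)] by (intro exI[of _ B]) blast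
    qed
  next
    assume lc: ?lc
    show "loc_const f" unfolding loc_const_def
    proof
      fix x assume "x \<in> M"
      then obtain U where U: "openin mtopology U" "x \<in> U" "\<forall>y\<in>U. f y = f x" using lc by blast
      then obtain B where "B \<in> balls" "x \<in> B" "B \<subseteq> U" unfolding openin_iff_balls by blast
      then show "\<exists>B\<in>balls. x \<in> B \<and> const_on B f"
        using U(3) by (intro bexI[of _ B] conjI const_onI[of B f "f x"]) auto
    qed
  qed
  moreover have "compactin mtopology (mtopology closure_of {x \<in> M. f x \<noteq> 0}) \<longleftrightarrow> (\<exists>B\<in>balls. supported B f)"
  proof
    assume "compactin mtopology (mtopology closure_of {x \<in> M. f x \<noteq> 0})"
    then obtain B where B: "B \<in> balls" "mtopology closure_of {x \<in> M. f x \<noteq> 0} \<subseteq> B"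
      by (rule compact_subset_ball)
    moreover have "{x \<in> M. f x \<noteq> 0} \<subseteq> mtopology closure_of {x \<in> M. f x \<noteq> 0}"
      by (rule closure_of_subset) auto
    ultimately show "\<exists>B\<in>balls. supported B f" unfolding supported_def by blast
  next
    assume "\<exists>B\<in>balls. supported B f"
    then obtain B where B: "B \<in> balls" "supported B f" by blast
    then have "mtopology closure_of {x \<in> M. f x \<noteq> 0} \<subseteq> B"
      by (intro closure_of_minimal closedin_ball) (auto simp: supported_def)
    then show "compactin mtopology (mtopology closure_of {x \<in> M. f x \<noteq> 0})"
      by (rule closed_compactin[OF compactin_ball[OF B(1)]]) simp
  qed
  ultimately show ?thesis by (simp add: locally_constant_compact_support_def)
qed

lemma finite_const_cover:
  assumes "loc_const f" "B \<in> balls"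
  obtains F where "finite F" "F \<subseteq> {V \<in> balls. const_on V f}" "B \<subseteq> \<Union>F"
proof -
  have "\<exists>F. finite F \<and> F \<subseteq> {V \<in> balls. const_on V f} \<and> B \<subseteq> \<Union>F"
  proof (rule compactinD[OF compactin_ball[OF assms(2)]])
    show "B \<subseteq> \<Union>{V \<in> balls. const_on V f}"
      using assms ball_subset unfolding loc_const_def by blast
  qed (auto intro: openin_ball)
  then show thesis using that by blast
qed

text \<open>Cover \<open>B\<close> by finitely many balls on which \<open>f\<close> is constant. A
  ball on which \<open>f\<close> is not constant meets one of these, cannot lie in it, and hence
  contains it; between two balls there are only finitely many.\<close>

lemma finite_nonconst:
  assumes "loc_const f" "B \<in> balls"
  shows "finite {Q \<in> balls. Q \<subseteq> B \<and> \<not> const_on Q f}"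
proof -
  obtain F where F: "finite F" "F \<subseteq> {V \<in> balls. const_on V f}" "B \<subseteq> \<Union>F"
    using finite_const_cover[OF assms] .
  have "{Q \<in> balls. Q \<subseteq> B \<and> \<not> const_on Q f} \<subseteq> (\<Union>V\<in>F. {Q \<in> balls. V \<subseteq> Q \<and> Q \<subseteq> B})"
  proof clarify
    fix Q assume Q: "Q \<in> balls" "Q \<subseteq> B" "\<not> const_on Q f"
    then obtain x where "x \<in> Q" using ball_nonempty by blast
    then obtain V where V: "V \<in> F" "x \<in> V" using F(3) Q(2) by blast
    have "\<not> Q \<subseteq> V" using Q(3) F(2) V(1) const_on_subset by blast
    then have "V \<subseteq> Q" using balls_nested[of V Q] V \<open>x \<in> Q\<close> F(2) Q(1) by blast
    then show "Q \<in> (\<Union>V\<in>F. {Q \<in> balls. V \<subseteq> Q \<and> Q \<subseteq> B})" using V Q by blast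
  qed
  then show ?thesis by (rule finite_subset) (use F assms in \<open>auto intro!: finite_balls_between\<close>)
qed

lemma test_fun_bounded:
  assumes "loc_const f" "B \<in> balls" "supported B f"
  obtains K where "0 \<le> K" "bounded_by K f"
proof -
  obtain F where F: "finite F" "F \<subseteq> {V \<in> balls. const_on V f}" "B \<subseteq> \<Union>F"
    using finite_const_cover[OF assms(1,2)] .
  define K where "K = (\<Sum>V\<in>F. cmod (f (SOME x. x \<in> V)))"
  have "cmod (f x) \<le> K" if "x \<in> M" for x
  proof (cases "x \<in> B")
    case True
    then obtain V where V: "V \<in> F" "x \<in> V" using F by blast
    then have "f x = f (SOME x. x \<in> V)"
      using F(2) V someI[of "\<lambda>x. x \<in> V"] const_onD[of V f] by blast
    then show ?thesis unfolding K_def using F(1) V(1) by (auto intro: member_le_sum)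
  next
    case False
    then show ?thesis using assms that by (simp add: supported_def K_def sum_nonneg)
  qed
  then show thesis using that[of K] by (simp add: bounded_by_def K_def sum_nonneg)
qed

lemma test_fun_L2:
  assumes "loc_const f" "B \<in> balls" "supported B f"
  shows "f \<in> L2 m"
proof (rule test_fun_bounded[OF assms])
  fix K assume "bounded_by K f"
  then show ?thesis by (rule L2_supported[OF loc_const_measurable[OF assms(1)] assms(2,3)])
qed

lemma loc_const_indicator: "B \<in> balls \<Longrightarrow> loc_const (indicator B)"
  unfolding loc_const_def
proof
  fix x assume B: "B \<in> balls" and x: "x \<in> M"
  have "openin mtopology (if x \<in> B then B else M - B)"
    using openin_ball[OF B] closedin_ball[OF B] by (auto simp: closedin_def)
  then obtain Q where "Q \<in> balls" "x \<in> Q" "Q \<subseteq> (if x \<in> B then B else M - B)"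
    using x unfolding openin_iff_balls by (cases "x \<in> B") auto
  then show "\<exists>Q\<in>balls. x \<in> Q \<and> const_on Q (indicator B)"
    by (intro bexI[of _ Q] conjI const_onI[of Q _ "indicator B x"])
       (auto simp: indicator_def split: if_splits)
qed

end

section \<open>The operator on test functions\<close>

locale hierarchical_laplacian = proper_ultrametric_measure M d m
  for M :: "'a set" and d and m :: "'a measure" +
  fixes C :: "'a set \<Rightarrow> real"
  assumes choice: "choice_function C"
begin

abbreviation lam :: "'a set \<Rightarrow> real" where
  "lam \<equiv> choice_lambda C"

abbreviation above :: "'a set \<Rightarrow> 'a set set" where
  "above B \<equiv> {Q \<in> nonsingleton_balls. B \<subseteq> Q}"

abbreviation Lap :: "('a \<Rightarrow> complex) \<Rightarrow> 'a \<Rightarrow> complex" where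
  "Lap \<equiv> hier_Laplacian_fun m C"

lemma C_pos: "B \<in> nonsingleton_balls \<Longrightarrow> 0 < C B" using choice by (simp add: choice_function_def)

lemma C_summable: "B \<in> balls \<Longrightarrow> C summable_on above B"
  using choice by (simp add: choice_function_def)

lemma lam_eq: "lam B = (\<Sum>\<^sub>\<infinity>Q\<in>above B. C Q)" by (simp add: choice_lambda_def)

lemma
  assumes B: "B \<in> balls" and g: "\<And>Q. Q \<in> above B \<Longrightarrow> cmod (g Q) \<le> K"
  shows weighted_summable: "(\<lambda>Q. of_real (C Q) * g Q) summable_on above B"
    and norm_weighted_sum: "cmod (\<Sum>\<^sub>\<infinity>Q\<in>above B. of_real (C Q) * g Q) \<le> K * lam B"
proof -
  have le: "norm (of_real (C Q) * g Q) \<le> K * C Q" if "Q \<in> above B" for Q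
    using g[OF that] C_pos[of Q] that by (simp add: norm_mult mult.commute mult_right_mono)
  have sK: "(\<lambda>Q. K * C Q) summable_on above B" by (intro summable_on_cmult_right C_summable B)
  have abs: "(\<lambda>Q. norm (of_real (C Q) * g Q)) summable_on above B"
    by (rule Infinite_Sum.abs_summable_on_comparison_test'[OF sK le])
  then show "(\<lambda>Q. of_real (C Q) * g Q) summable_on above B" by (rule abs_summable_summable)
  have "cmod (\<Sum>\<^sub>\<infinity>Q\<in>above B. of_real (C Q) * g Q) \<le> (\<Sum>\<^sub>\<infinity>Q\<in>above B. norm (of_real (C Q) * g Q))"
    by (rule norm_infsum_bound[OF abs])
  also have "\<dots> \<le> (\<Sum>\<^sub>\<infinity>Q\<in>above B. K * C Q)" by (rule infsum_mono[OF abs sK le])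
  also have "\<dots> = K * lam B" by (simp add: lam_eq infsum_cmult_right')
  finally show "cmod (\<Sum>\<^sub>\<infinity>Q\<in>above B. of_real (C Q) * g Q) \<le> K * lam B" .
qed

lemma weighted_sum_const:
  assumes "B \<in> balls"
  shows "(\<Sum>\<^sub>\<infinity>Q\<in>above B. of_real (C Q) * c) = complex_of_real (lam B) * c"
proof -
  have "(C has_sum lam B) (above B)"
    unfolding lam_eq by (rule has_sum_infsum[OF C_summable[OF assms]])
  then show ?thesis by (intro infsumI has_sum_cmult_left has_sum_of_real)
qed

lemma ball_average_const_on:
  assumes "Q \<in> balls" "const_on Q f" "x \<in> Q"
  shows "ball_average m Q f = f x"
  using ball_average_const[OF assms(1)] const_onD[OF assms(2) _ assms(3)] by blast

text \<open>Replaces the sum over the balls containing \<open>x\<close> by one over an index set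
  that does not depend on \<open>x\<close> and on which \<open>C\<close> is summable. The
  \<open>if\<close> accounts for balls above \<open>V\<close> that miss \<open>x\<close>, which
  occur when \<open>x\<close> is outside \<open>V\<close>.\<close>

lemma Lap_eq:
  assumes V: "V \<in> balls"
    and vanish: "\<And>Q. \<lbrakk>Q \<in> nonsingleton_balls; x \<in> Q; \<not> V \<subseteq> Q\<rbrakk> \<Longrightarrow> ball_average m Q f = f x"
  shows "Lap f x = - (\<Sum>\<^sub>\<infinity>Q\<in>above V. of_real (C Q) * (if x \<in> Q then ball_average m Q f - f x else 0))"
  unfolding hier_Laplacian_fun_def using vanish
  by (intro arg_cong[where f=uminus] infsum_cong_neutral) auto

lemma Lap_on_const:
  assumes V: "V \<in> balls" "const_on V f" "x \<in> V"
  shows "Lap f x = - (\<Sum>\<^sub>\<infinity>Q\<in>above V. of_real (C Q) * (ball_average m Q f - f x))"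
proof -
  have "ball_average m Q f = f x" if "Q \<in> nonsingleton_balls" "x \<in> Q" "\<not> V \<subseteq> Q" for Q
  proof (rule ball_average_const_on[OF nonsingletonD[OF that(1)] _ that(2)])
    have "Q \<subseteq> V" using balls_nested[of V Q] V(1,3) that nonsingletonD by blast
    then show "const_on Q f" using V(2) const_on_subset by blast
  qed
  then have "Lap f x = - (\<Sum>\<^sub>\<infinity>Q\<in>above V. of_real (C Q) * (if x \<in> Q then ball_average m Q f - f x else 0))"
    by (intro Lap_eq V)
  also have "(\<Sum>\<^sub>\<infinity>Q\<in>above V. of_real (C Q) * (if x \<in> Q then ball_average m Q f - f x else 0))
      = (\<Sum>\<^sub>\<infinity>Q\<in>above V. of_real (C Q) * (ball_average m Q f - f x))"
    using V(3) by (intro infsum_cong) auto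
  finally show ?thesis .
qed

lemma Lap_loc_const:
  assumes "loc_const f"
  shows "loc_const (Lap f)" unfolding loc_const_def
proof
  fix x assume "x \<in> M"
  then obtain V where V: "V \<in> balls" "x \<in> V" "const_on V f"
    using assms unfolding loc_const_def by blast
  have "Lap f y = - (\<Sum>\<^sub>\<infinity>Q\<in>above V. of_real (C Q) * (ball_average m Q f - f x))" if "y \<in> V" for y
    using Lap_on_const[OF V(1,3) that] const_onD[OF V(3) that V(2)] by simp
  then show "\<exists>B\<in>balls. x \<in> B \<and> const_on B (Lap f)"
    using V by (intro bexI[of _ V] conjI const_onI) auto
qed

text \<open>The balls containing \<open>x \<in> B\<close> are those containing \<open>B\<close>, which contribute an affine function of \<open>f x\<close>, and
  those strictly inside \<open>B\<close>, of which only finitely many contribute.\<close>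

definition outer_avg :: "'a set \<Rightarrow> ('a \<Rightarrow> complex) \<Rightarrow> complex" where
  "outer_avg B f = (\<Sum>\<^sub>\<infinity>Q\<in>above B. of_real (C Q) * ball_average m Q f)"

definition nonconst_in :: "'a set \<Rightarrow> ('a \<Rightarrow> complex) \<Rightarrow> 'a set set" where
  "nonconst_in B f = {Q \<in> nonsingleton_balls. Q \<subset> B \<and> \<not> const_on Q f}"

lemma finite_nonconst_in: "loc_const f \<Longrightarrow> B \<in> balls \<Longrightarrow> finite (nonconst_in B f)"
  unfolding nonconst_in_def
  by (rule finite_subset[OF _ finite_nonconst]) (auto dest: nonsingletonD)

lemma norm_outer_avg: "bounded_by K f \<Longrightarrow> B \<in> balls \<Longrightarrow> cmod (outer_avg B f) \<le> K * lam B"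
  unfolding outer_avg_def
  by (rule norm_weighted_sum) (auto intro: norm_ball_average nonsingletonD)

lemma Lap_decompose:
  assumes f: "loc_const f" "bounded_by K f" and B: "B \<in> balls" "x \<in> B"
  shows "Lap f x = - outer_avg B f + of_real (lam B) * f x
      - (\<Sum>Q\<in>nonconst_in B f. if x \<in> Q then of_real (C Q) * (ball_average m Q f - f x) else 0)"
proof -
  let ?t = "\<lambda>Q. complex_of_real (C Q) * (ball_average m Q f - f x)"
  let ?inn = "{Q \<in> nonsingleton_balls. x \<in> Q \<and> Q \<subset> B}"
  let ?F = "{Q \<in> nonconst_in B f. x \<in> Q}"
  have split: "{Q \<in> nonsingleton_balls. x \<in> Q} = above B \<union> ?inn"
    using B balls_nested[of B] nonsingletonD by blast
  have s2: "(\<lambda>Q. of_real (C Q) * f x) summable_on above B"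
    by (rule weighted_summable[OF B(1), of _ "cmod (f x)"]) simp
  have s3: "?t summable_on above B"
  proof (rule weighted_summable[OF B(1), of _ "K + cmod (f x)"])
    fix Q assume "Q \<in> above B"
    then have "cmod (ball_average m Q f) \<le> K"
      by (intro norm_ball_average f) (auto intro: nonsingletonD)
    then show "cmod (ball_average m Q f - f x) \<le> K + cmod (f x)"
      using norm_triangle_ineq4[of "ball_average m Q f" "f x"] by linarith
  qed
  have zero: "?t Q = 0" if "Q \<in> ?inn - ?F" for Q
    using that ball_average_const_on[of Q f x] nonsingletonD[of Q]
    by (auto simp: nonconst_in_def)
  have FI: "?F \<subseteq> ?inn" by (auto simp: nonconst_in_def)
  have fin: "finite ?F" using finite_nonconst_in[OF f(1) B(1)] by simp
  have s4: "?t summable_on ?inn"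
  proof -
    have "?t summable_on ?F \<longleftrightarrow> ?t summable_on ?inn"
      using zero FI by (intro summable_on_cong_neutral) auto
    then show ?thesis using summable_on_finite[OF fin, of ?t] by simp
  qed
  have "(\<Sum>\<^sub>\<infinity>Q\<in>{Q \<in> nonsingleton_balls. x \<in> Q}. ?t Q) = (\<Sum>\<^sub>\<infinity>Q\<in>above B. ?t Q) + (\<Sum>\<^sub>\<infinity>Q\<in>?inn. ?t Q)"
    unfolding split by (rule infsum_Un_disjoint[OF s3 s4]) auto
  also have "(\<Sum>\<^sub>\<infinity>Q\<in>above B. ?t Q) = outer_avg B f - of_real (lam B) * f x"
  proof -
    have "outer_avg B f = (\<Sum>\<^sub>\<infinity>Q\<in>above B. ?t Q + of_real (C Q) * f x)"
      unfolding outer_avg_def by (simp add: right_diff_distrib)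
    also have "\<dots> = (\<Sum>\<^sub>\<infinity>Q\<in>above B. ?t Q) + of_real (lam B) * f x"
      unfolding weighted_sum_const[OF B(1), symmetric] by (rule infsum_add[OF s3 s2])
    finally show ?thesis by simp
  qed
  also have "(\<Sum>\<^sub>\<infinity>Q\<in>?inn. ?t Q) = (\<Sum>\<^sub>\<infinity>Q\<in>?F. ?t Q)"
    using zero FI by (intro infsum_cong_neutral) auto
  also have "\<dots> = (\<Sum>Q\<in>nonconst_in B f. if x \<in> Q then ?t Q else 0)"
    using finite_nonconst_in[OF f(1) B(1)] fin by (simp add: sum.inter_filter)
  finally show ?thesis by (simp add: hier_Laplacian_fun_def)
qed

lemma integrable_mult_supported:
  assumes "f \<in> L2 m" "B \<in> balls" "h \<in> borel_measurable m" "supported B h" "bounded_by K h"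
  shows "integrable m (\<lambda>x. f x * h x)"
proof -
  have "(\<lambda>x. cnj (h x)) \<in> L2 m"
    using assms by (intro L2_supported[of _ B K]) (auto simp: supported_def bounded_by_def)
  then show ?thesis using integrable_L2_mult[OF assms(1)] by fastforce
qed

text \<open>A ball \<open>Q\<close> strictly inside \<open>B\<close> contributes a multiple of the
  integral of \<open>P_Q f - f\<close> over \<open>Q\<close>, because \<open>h\<close> is constant
  on \<open>Q\<close>, and this integral is 0. The mean of \<open>h\<close> stays general: Haar
  vectors have mean 0, but the indicator of \<open>B\<close> is used as well.\<close>

lemma integral_Lap_mult:
  assumes f: "loc_const f" "A \<in> balls" "supported A f"
    and B: "B \<in> balls"
    and h: "h \<in> borel_measurable m" "supported B h" "bounded_by Kh h"
      "\<And>Q. \<lbrakk>Q \<in> balls; Q \<subset> B\<rbrakk> \<Longrightarrow> const_on Q h"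
  shows "(LINT x|m. Lap f x * h x) = - outer_avg B f * (LINT x|m. h x) + of_real (lam B) * (LINT x|m. f x * h x)"
proof -
  obtain K where K: "0 \<le> K" "bounded_by K f" using test_fun_bounded[OF f] by blast
  let ?r = "\<lambda>Q x. of_real (C Q) * ((ball_average m Q f * indicator Q x - indicator Q x * f x) * h x)"
  have eq: "Lap f x * h x = - outer_avg B f * h x + of_real (lam B) * (f x * h x)
      - (\<Sum>Q\<in>nonconst_in B f. ?r Q x)" if "x \<in> M" for x
  proof (cases "x \<in> B")
    case True
    have "(\<Sum>Q\<in>nonconst_in B f. if x \<in> Q then of_real (C Q) * (ball_average m Q f - f x) else 0) * h x
        = (\<Sum>Q\<in>nonconst_in B f. ?r Q x)"
      unfolding sum_distrib_right by (intro sum.cong) (auto simp: indicator_def)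
    then show ?thesis unfolding Lap_decompose[OF f(1) K(2) B True] by (simp add: algebra_simps)
  next
    case False
    then show ?thesis using h(2) that by (simp add: supported_def)
  qed
  have fL2: "f \<in> L2 m" by (rule test_fun_L2[OF f])
  note [measurable] = L2_measurable[OF fL2] h(1)
  have int_h: "integrable m h" by (rule integrable_supported[OF h(1) B h(2,3)])
  have int_fh: "integrable m (\<lambda>x. f x * h x)"
    by (rule integrable_mult_supported[OF fL2 B h(1-3)])
  have rest: "integrable m (?r Q) \<and> (LINT x|m. ?r Q x) = 0" if Q: "Q \<in> nonconst_in B f" for Q
  proof -
    have Qb: "Q \<in> balls" "Q \<subset> B" using Q nonsingletonD by (auto simp: nonconst_in_def)
    note [measurable] = ball_sets[OF Qb(1)]
    obtain c where c: "\<And>x. x \<in> Q \<Longrightarrow> h x = c" using h(4)[OF Qb] unfolding const_on_def by blast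
    have r: "?r Q = (\<lambda>x. (of_real (C Q) * c * ball_average m Q f) * indicator Q x
        - (of_real (C Q) * c) * (f x * indicator Q x))"
      using c by (auto simp: indicator_def algebra_simps)
    note i1 = integrable_indicator_ball[OF Qb(1)]
    have i2: "integrable m (\<lambda>x. f x * indicator Q x)"
      by (rule integrable_mult_supported[OF fL2 Qb(1), of _ 1])
         (auto simp: supported_def bounded_by_def indicator_def)
    have "(LINT x|m. f x * indicator Q x) = ball_average m Q f * of_real (measure m Q)"
      using measure_ball_pos[OF Qb(1)] by (simp add: ball_average_eq mult.commute)
    then show ?thesis unfolding r using i1 i2 by (simp add: integral_indicator_ball[OF Qb(1)])
  qed
  have ints: "integrable m (\<lambda>x. - outer_avg B f * h x)" "integrable m (\<lambda>x. of_real (lam B) * (f x * h x))"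
    using int_h int_fh by simp_all
  have "(LINT x|m. Lap f x * h x) = (LINT x|m. - outer_avg B f * h x + of_real (lam B) * (f x * h x)
      - (\<Sum>Q\<in>nonconst_in B f. ?r Q x))"
    by (rule Bochner_Integration.integral_cong) (simp_all add: eq space_m)
  also have "\<dots> = (LINT x|m. - outer_avg B f * h x + of_real (lam B) * (f x * h x))
      - (LINT x|m. (\<Sum>Q\<in>nonconst_in B f. ?r Q x))"
    by (intro Bochner_Integration.integral_diff Bochner_Integration.integrable_add
        Bochner_Integration.integrable_sum ints rest[THEN conjunct1])
  also have "(LINT x|m. (\<Sum>Q\<in>nonconst_in B f. ?r Q x)) = 0"
    using rest by (subst Bochner_Integration.integral_sum) (blast intro: sum.neutral)+
  also have "(LINT x|m. - outer_avg B f * h x + of_real (lam B) * (f x * h x))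
      = - outer_avg B f * (LINT x|m. h x) + of_real (lam B) * (LINT x|m. f x * h x)"
    using int_h int_fh by (subst Bochner_Integration.integral_add) auto
  finally show ?thesis by simp
qed

text \<open>Balls containing \<open>B\<close> average \<open>f\<close> to 0, and those disjoint from
  \<open>B\<close> or strictly inside it leave the value at \<open>x\<close> unchanged. What remains
  is the sum of \<open>C Q * f x\<close> over the balls above \<open>B\<close>; for \<open>x\<close>
  outside \<open>B\<close> it is 0 as \<open>f x = 0\<close>.\<close>

lemma Lap_eigenfunction:
  assumes f: "f \<in> borel_measurable m" "bounded_by K f" and B: "B \<in> balls" "supported B f"
    "\<And>Q. \<lbrakk>Q \<in> balls; Q \<subset> B\<rbrakk> \<Longrightarrow> const_on Q f"
    and mean: "(LINT x|m. f x) = 0" and x: "x \<in> M"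
  shows "Lap f x = of_real (lam B) * f x"
proof -
  have avg: "ball_average m Q f = 0" if "Q \<in> balls" "B \<subseteq> Q" for Q
    using ball_average_supported[OF that(1) B(1) that(2) B(2)] mean by simp
  have "Lap f x = - (\<Sum>\<^sub>\<infinity>Q\<in>above B. of_real (C Q) * (if x \<in> Q then ball_average m Q f - f x else 0))"
  proof (rule Lap_eq[OF B(1)])
    fix Q assume Q: "Q \<in> nonsingleton_balls" "x \<in> Q" "\<not> B \<subseteq> Q"
    have Qb: "Q \<in> balls" using Q nonsingletonD by blast
    show "ball_average m Q f = f x"
    proof (cases "Q \<inter> B = {}")
      case True
      then have "f y = 0" if "y \<in> Q" for y
        using B(2) that ball_subset[OF Qb] by (auto simp: supported_def)
      then show ?thesis using ball_average_const[OF Qb, of f 0] Q(2) by simp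
    next
      case False
      then have "Q \<subset> B" using balls_nested[OF Qb B(1)] Q(3) by blast
      then show ?thesis using ball_average_const_on B(3) Qb Q(2) by blast
    qed
  qed
  also have "(\<Sum>\<^sub>\<infinity>Q\<in>above B. of_real (C Q) * (if x \<in> Q then ball_average m Q f - f x else 0))
      = (\<Sum>\<^sub>\<infinity>Q\<in>above B. of_real (C Q) * (- f x))"
  proof (rule infsum_cong)
    fix Q assume "Q \<in> above B"
    then have Q: "Q \<in> balls" "B \<subseteq> Q" using nonsingletonD by auto
    then have "f x = 0" if "x \<notin> Q" using B(2) that x by (auto simp: supported_def)
    then show "of_real (C Q) * (if x \<in> Q then ball_average m Q f - f x else 0) = of_real (C Q) * (- f x)"
      using avg[OF Q] by auto
  qed
  also have "\<dots> = of_real (lam B) * (- f x)" by (rule weighted_sum_const[OF B(1)])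
  finally show ?thesis by simp
qed

end

section \<open>A Haar basis\<close>

context proper_ultrametric_measure
begin

text \<open>The vectors attached to a ball \<open>B\<close> compare each child of \<open>B\<close> with the union of the siblings preceding it
  in a fixed enumeration of all balls; unlike differences of averages over pairs of children, they are
  orthogonal.\<close>

definition rank :: "'a set \<Rightarrow> nat" where
  "rank = to_nat_on balls"

definition earlier :: "'a set \<Rightarrow> 'a set set" where
  "earlier T = {S \<in> balls. parent S = parent T \<and> rank S < rank T}"

text \<open>A ball with n children provides n - 1 indices, namely all children except the one of
  least rank. Indexing by the child means that the relevant eigenvalue is that of
  \<open>parent T\<close>.\<close>

definition haar_index :: "'a set set" where
  "haar_index = {T \<in> balls. earlier T \<noteq> {}}"

definition haar :: "'a set \<Rightarrow> 'a \<Rightarrow> complex" where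
  "haar T x = of_real (1 / measure m T) * indicator T x
     + of_real (- 1 / (\<Sum>S\<in>earlier T. measure m S)) * (\<Sum>S\<in>earlier T. indicator S x)"

lemma rank_eq_iff: "A \<in> balls \<Longrightarrow> B \<in> balls \<Longrightarrow> rank A = rank B \<longleftrightarrow> A = B"
  unfolding rank_def using countable_balls[OF separable] by simp

lemma earlier_ball: "S \<in> earlier T \<Longrightarrow> S \<in> balls" by (simp add: earlier_def)

lemma haar_index_ball: "T \<in> haar_index \<Longrightarrow> T \<in> balls" by (simp add: haar_index_def)

lemma finite_earlier: "T \<in> balls \<Longrightarrow> finite (earlier T)"
  by (rule finite_subset[OF _ finite_children[OF parent_ball]]) (auto simp: earlier_def)

lemma earlier_measure_pos:
  assumes "T \<in> haar_index"
  shows "0 < (\<Sum>S\<in>earlier T. measure m S)" using assms finite_earlier[of T] measure_ball_pos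
  by (intro sum_pos) (auto simp: haar_index_def earlier_def)

lemma indicator_sibling:
  assumes "S \<in> balls" "T \<in> balls" "parent S = parent T" "x \<in> T"
  shows "indicator S x = (if S = T then 1 else (0::complex))"
  using parent_eqD_disjoint[OF assms(1,2,3)] assms(4) by (auto simp: indicator_def)

lemma haar_on_child:
  assumes T: "T \<in> haar_index" and R: "R \<in> balls" "parent R = parent T" "x \<in> R"
  shows "haar T x = (if R = T then of_real (1 / measure m T)
    else if R \<in> earlier T then of_real (- 1 / (\<Sum>S\<in>earlier T. measure m S)) else 0)"
proof -
  have "(\<Sum>S\<in>earlier T. indicator S x) = (\<Sum>S\<in>earlier T. if S = R then 1 else (0::complex))"
    using R by (intro sum.cong refl indicator_sibling) (auto simp: earlier_def)
  also have "\<dots> = (if R \<in> earlier T then 1 else 0)"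
    using finite_earlier[OF haar_index_ball[OF T]] by simp
  finally have sum: "(\<Sum>S\<in>earlier T. indicator S x) = (if R \<in> earlier T then 1 else (0::complex))" .
  have ind: "indicator T x = (if R = T then 1 else (0::complex))"
    using indicator_sibling[of T R x] R haar_index_ball[OF T] by auto
  have "T \<notin> earlier T" by (simp add: earlier_def)
  then show ?thesis unfolding haar_def sum ind by auto
qed

lemma haar_const_on:
  assumes T: "T \<in> haar_index" and Q: "Q \<in> balls" "Q \<subset> parent T"
  shows "const_on Q (haar T)"
proof -
  obtain R where "R \<in> balls" "parent R = parent T" "Q \<subseteq> R"
    by (rule subball_subset_child[OF parent_ball[OF haar_index_ball[OF T]] Q])
  then show ?thesis using haar_on_child[OF T] by (intro const_onI) blast
qed

lemma haar_supported:
  assumes T: "T \<in> haar_index"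
  shows "supported (parent T) (haar T)"
proof -
  have "S \<subseteq> parent T" if "S \<in> insert T (earlier T)" for S
    using that psubset_parent[of S] haar_index_ball[OF T] by (auto simp: earlier_def)
  then have "indicator S x = (0::complex)" if "S \<in> insert T (earlier T)" "x \<notin> parent T" for S x
    using that by (auto simp: indicator_def)
  then show ?thesis by (simp add: supported_def haar_def)
qed

lemma locally_constI:
  assumes B: "B \<in> nonsingleton_balls" "supported B f"
    and c: "\<And>Q. \<lbrakk>Q \<in> balls; Q \<subset> B\<rbrakk> \<Longrightarrow> const_on Q f"
  shows "loc_const f" unfolding loc_const_def
proof
  fix x assume x: "x \<in> M"
  have Bb: "B \<in> balls" by (rule nonsingletonD[OF B(1)])
  show "\<exists>Q\<in>balls. x \<in> Q \<and> const_on Q f"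
  proof (cases "x \<in> B")
    case True
    then obtain R where "R \<in> balls" "parent R = B" "x \<in> R" by (rule point_in_child[OF B(1)])
    then show ?thesis using c psubset_parent by blast
  next
    case False
    then have "\<exists>Q\<in>balls. x \<in> Q \<and> Q \<subseteq> M - B"
      using closedin_ball[OF Bb] x unfolding closedin_def topspace_mtopology openin_iff_balls by blast
    then obtain Q where Q: "Q \<in> balls" "x \<in> Q" "Q \<subseteq> M - B" by blast
    then have "const_on Q f"
      using B(2) by (intro const_onI[of Q f 0]) (auto simp: supported_def)
    then show ?thesis using Q by blast
  qed
qed

lemma haar_loc_const: "T \<in> haar_index \<Longrightarrow> loc_const (haar T)"
  by (rule locally_constI[OF parent_ns[OF haar_index_ball] haar_supported haar_const_on])

lemma haar_L2: "T \<in> haar_index \<Longrightarrow> haar T \<in> L2 m"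
  by (intro test_fun_L2[of _ "parent T"] haar_loc_const haar_supported parent_ball haar_index_ball)

lemma haar_bounded: "T \<in> haar_index \<Longrightarrow> \<exists>K. bounded_by K (haar T)"
  using test_fun_bounded[OF haar_loc_const parent_ball haar_supported] haar_index_ball by metis

lemma inner_haar:
  assumes T: "T \<in> haar_index" and f: "f \<in> L2 m"
  shows "L2_inner m (haar T) f = of_real (1 / measure m T) * L2_inner m (indicator T) f
    + of_real (- 1 / (\<Sum>S\<in>earlier T. measure m S)) * (\<Sum>S\<in>earlier T. L2_inner m (indicator S) f)"
proof -
  have iT: "(indicator T :: 'a \<Rightarrow> complex) \<in> L2 m"
    by (rule indicator_L2[OF haar_index_ball[OF T]])
  have iS: "(\<lambda>x. \<Sum>S\<in>earlier T. indicator S x :: complex) \<in> L2 m"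
    by (intro L2_sum indicator_L2 earlier_ball)
  show ?thesis unfolding haar_def[abs_def]
    by (simp only: L2_inner_lincomb_left[OF iT L2_scale[OF iS] f] L2_inner_scale_left[OF iS f]
        L2_inner_sum_left[OF indicator_L2[OF earlier_ball] f])
qed

lemma integral_haar:
  assumes T: "T \<in> haar_index"
  shows "(LINT x|m. haar T x) = 0"
proof -
  note int = integrable_indicator_ball
  have iT: "integrable m (\<lambda>x. of_real (1 / measure m T) * indicator T x :: complex)"
    using int[OF haar_index_ball[OF T]] by simp
  have iS: "integrable m (\<lambda>x. \<Sum>S\<in>earlier T. indicator S x :: complex)"
    by (intro Bochner_Integration.integrable_sum int earlier_ball)
  have sum: "(LINT x|m. (\<Sum>S\<in>earlier T. indicator S x)) = complex_of_real (\<Sum>S\<in>earlier T. measure m S)"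
    by (subst Bochner_Integration.integral_sum) (auto intro: int earlier_ball simp: integral_indicator_ball[OF earlier_ball])
  have "(LINT x|m. haar T x) = of_real (1 / measure m T) * (LINT x|m. indicator T x)
      + of_real (- 1 / (\<Sum>S\<in>earlier T. measure m S)) * (LINT x|m. (\<Sum>S\<in>earlier T. indicator S x))"
    unfolding haar_def using iT iS by (subst Bochner_Integration.integral_add) auto
  also have "\<dots> = of_real (1 / measure m T * measure m T
      + (- 1 / (\<Sum>S\<in>earlier T. measure m S)) * (\<Sum>S\<in>earlier T. measure m S))"
    unfolding sum integral_indicator_ball[OF haar_index_ball[OF T]] by (simp only: of_real_mult of_real_add)
  also have "\<dots> = 0"
    using earlier_measure_pos[OF T] measure_ball_pos[OF haar_index_ball[OF T]] by simp
  finally show ?thesis .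
qed

lemma inner_haar_const:
  assumes T: "T \<in> haar_index" and g: "\<And>x. x \<in> M \<Longrightarrow> haar T x \<noteq> 0 \<Longrightarrow> g x = c"
  shows "L2_inner m (haar T) g = 0"
proof -
  have "L2_inner m (haar T) g = (LINT x|m. haar T x * cnj c)"
    unfolding L2_inner_def using g by (intro Bochner_Integration.integral_cong) (auto simp: space_m)
  then show ?thesis using integral_haar[OF T] by simp
qed

text \<open>One vector is constant on the support of the other, which has mean 0. If the parents
  coincide, the vector of higher rank is constant on the siblings up to the lower index; if one
  parent is strictly smaller, it lies in a single child of the larger one.\<close>

lemma haar_orthogonal:
  assumes S: "S \<in> haar_index" and T: "T \<in> haar_index" and "S \<noteq> T"
  shows "L2_inner m (haar S) (haar T) = 0"
proof -
  have *: "L2_inner m (haar S) (haar T) = 0"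
    if S: "S \<in> haar_index" and T: "T \<in> haar_index"
      and sub: "parent S \<subset> parent T \<or> parent S = parent T \<and> rank S < rank T" for S T
  proof (cases "parent S = parent T")
    case True
    then have less: "rank S < rank T" using sub by blast
    show ?thesis
    proof (rule inner_haar_const[OF S])
      fix x assume x: "x \<in> M" "haar S x \<noteq> 0"
      then have "x \<in> parent S" using haar_supported[OF S] by (auto simp: supported_def)
      then obtain R where R: "R \<in> balls" "parent R = parent S" "x \<in> R"
        by (rule point_in_child[OF parent_ns[OF haar_index_ball[OF S]]])
      then have "R = S \<or> R \<in> earlier S"
        using x(2) haar_on_child[OF S R] by (auto split: if_splits)
      then have "R \<in> earlier T" "R \<noteq> T"
        using less True haar_index_ball[OF S] by (auto simp: earlier_def)
      then show "haar T x = of_real (- 1 / (\<Sum>S\<in>earlier T. measure m S))"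
        using haar_on_child[OF T R(1) _ R(3)] R(2) True by simp
    qed
  next
    case False
    then have "const_on (parent S) (haar T)"
      using sub by (intro haar_const_on T parent_ball haar_index_ball S) blast
    then obtain c where "\<And>x. x \<in> parent S \<Longrightarrow> haar T x = c" unfolding const_on_def by blast
    then show ?thesis
      using haar_supported[OF S] by (intro inner_haar_const[OF S]) (auto simp: supported_def)
  qed
  have sym: "L2_inner m (haar S) (haar T) = 0" if "L2_inner m (haar T) (haar S) = 0"
    using arg_cong[OF that, of cnj] by (simp add: L2_inner_cnj)
  show ?thesis
  proof (cases "parent S \<inter> parent T = {}")
    case True
    then show ?thesis using haar_supported[OF S] haar_supported[OF T]
      by (intro inner_haar_const[OF S, of _ 0]) (auto simp: supported_def)
  next
    case False
    then have "parent S \<subset> parent T \<or> parent T \<subset> parent S \<or> parent S = parent T"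
      using balls_nested parent_ball haar_index_ball S T by (metis psubsetI)
    moreover have "rank S < rank T \<or> rank T < rank S"
      using rank_eq_iff[OF haar_index_ball[OF S] haar_index_ball[OF T]] assms(3) by linarith
    ultimately show ?thesis using *[OF S T] *[OF T S] sym by metis
  qed
qed

section \<open>Completeness of the Haar system\<close>

lemma indicator_children:
  assumes B: "B \<in> nonsingleton_balls"
  shows "indicator B x = (\<Sum>T\<in>{T \<in> balls. parent T = B}. indicator T x :: complex)"
proof (cases "x \<in> B")
  case True
  then obtain R where R: "R \<in> balls" "parent R = B" "x \<in> R" by (rule point_in_child[OF B])
  have "(\<Sum>T\<in>{T \<in> balls. parent T = B}. indicator T x :: complex) = (\<Sum>T\<in>{T \<in> balls. parent T = B}. if T = R then 1 else 0)"
    using R by (intro sum.cong refl indicator_sibling) auto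
  also have "\<dots> = 1" using R finite_children[OF nonsingletonD[OF B]] by simp
  finally show ?thesis using True by simp
next
  case False
  then have "indicator T x = (0::complex)" if "T \<in> {T \<in> balls. parent T = B}" for T
    using that psubset_parent by (auto simp: indicator_def)
  then show ?thesis using False by simp
qed

lemma measure_children:
  assumes B: "B \<in> nonsingleton_balls"
  shows "measure m B = (\<Sum>T\<in>{T \<in> balls. parent T = B}. measure m T)"
proof -
  note int = integrable_indicator_ball
  have "complex_of_real (measure m B) = (LINT x|m. indicator B x)"
    by (simp add: integral_indicator_ball nonsingletonD[OF B])
  also have "\<dots> = (\<Sum>T\<in>{T \<in> balls. parent T = B}. (LINT x|m. indicator T x))"
    unfolding indicator_children[OF B] by (rule Bochner_Integration.integral_sum) (auto intro: int)
  also have "\<dots> = complex_of_real (\<Sum>T\<in>{T \<in> balls. parent T = B}. measure m T)"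
    by (auto intro!: sum.cong simp: integral_indicator_ball)
  finally show ?thesis unfolding of_real_eq_iff .
qed

text \<open>Orthogonality to \<open>haar R\<close> says that \<open>f\<close> has the same average
  over \<open>R\<close> as over the union of its earlier siblings. By induction on the rank all
  siblings share one average, which is then also that of their parent. Hence averages are constant
  along ancestor chains, and any two balls have a common ancestor.\<close>

lemma haar_kernel_averages:
  assumes f: "f \<in> L2 m" and orth: "\<And>T. T \<in> haar_index \<Longrightarrow> L2_inner m (haar T) f = 0"
  obtains c where "\<And>B. B \<in> balls \<Longrightarrow> L2_inner m (indicator B) f = c * of_real (measure m B)"
proof -
  define J where "J = (\<lambda>B. L2_inner m (indicator B) f)"
  define a where "a = (\<lambda>B. J B / of_real (measure m B))"
  have J_a: "J B = a B * of_real (measure m B)" if "B \<in> balls" for B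
    using measure_ball_pos[OF that] by (simp add: a_def)
  have parent_a: "a T = a (parent T)" if T: "T \<in> balls" for T
  proof -
    define Ch where "Ch = {R \<in> balls. parent R = parent T}"
    have PT: "parent T \<in> nonsingleton_balls" by (rule parent_ns[OF T])
    have finCh: "finite Ch" unfolding Ch_def by (rule finite_children[OF parent_ball[OF T]])
    have "T \<in> Ch" using T by (simp add: Ch_def)
    \<comment> \<open>The first child, the only one that carries no Haar vector; it starts the
      induction over the siblings.\<close>
    then obtain T0 where T0: "T0 \<in> Ch" "\<And>R. R \<in> Ch \<Longrightarrow> rank T0 \<le> rank R"
      using ex_has_least_nat[of "\<lambda>R. R \<in> Ch" T rank] by blast
    have eq: "a R = a T0" if "R \<in> Ch" for R using that
    proof (induction "rank R" arbitrary: R rule: less_induct)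
      case (less R)
      have Rb: "R \<in> balls" using less.prems by (simp add: Ch_def)
      show ?case
      proof (cases "R \<in> haar_index")
        case True
        let ?w = "\<Sum>S\<in>earlier R. measure m S"
        have sibl: "earlier R \<subseteq> Ch" using less.prems by (auto simp: earlier_def Ch_def)
        have "J S = a T0 * of_real (measure m S)" if "S \<in> earlier R" for S
          using J_a[OF earlier_ball[OF that]] less.hyps[of S] that sibl by (auto simp: earlier_def)
        then have "(\<Sum>S\<in>earlier R. J S) = a T0 * of_real ?w" by (simp add: sum_distrib_left)
        then have "of_real (1 / measure m R) * J R + of_real (- 1 / ?w) * (a T0 * of_real ?w) = 0"
          using inner_haar[OF True f] orth[OF True] by (simp add: J_def)
        moreover have "of_real (- 1 / ?w) * (a T0 * of_real ?w) = - a T0"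
          using earlier_measure_pos[OF True] by (simp flip: of_real_sum)
        ultimately show ?thesis by (simp add: a_def)
      next
        case False
        then have "\<not> rank T0 < rank R"
          using T0(1) less.prems Rb by (auto simp: haar_index_def earlier_def Ch_def)
        then have "rank T0 = rank R" using T0(2)[OF less.prems] by simp
        then show ?thesis using rank_eq_iff[of T0 R] T0(1) Rb by (simp add: Ch_def)
      qed
    qed
    have "J (parent T) = L2_inner m (\<lambda>x. \<Sum>R\<in>Ch. indicator R x) f"
      unfolding J_def Ch_def by (simp only: indicator_children[OF PT, symmetric])
    also have "\<dots> = (\<Sum>R\<in>Ch. J R)"
      unfolding J_def using f by (intro L2_inner_sum_left) (auto simp: Ch_def intro: indicator_L2)
    also have "\<dots> = (\<Sum>R\<in>Ch. a T0 * of_real (measure m R))"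
      using J_a eq by (intro sum.cong) (auto simp: Ch_def)
    also have "\<dots> = a T0 * of_real (measure m (parent T))"
      by (simp add: measure_children[OF PT] Ch_def sum_distrib_left)
    finally have "a (parent T) = a T0"
      using measure_ball_pos[OF parent_ball[OF T]] by (simp add: a_def)
    then show ?thesis using eq[OF \<open>T \<in> Ch\<close>] by simp
  qed
  have ancestor_a: "a (ancestor T n) = a T" if "T \<in> balls" for T n
    using parent_a[OF ancestor_ball[OF that]] by (induction n) simp_all
  obtain B0 where B0: "B0 \<in> balls" using M_nonempty mball_in_balls[of _ 1] by auto
  have "a B = a B0" if B: "B \<in> balls" for B
  proof -
    obtain Q where Q: "Q \<in> balls" "B \<subseteq> Q" "B0 \<subseteq> Q" by (rule ball_covering_two[OF B B0])
    obtain i j where "Q = ancestor B i" "Q = ancestor B0 j"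
      using superball_is_ancestor[OF B Q(1,2)] superball_is_ancestor[OF B0 Q(1,3)] by blast
    then show ?thesis using ancestor_a[OF B, of i] ancestor_a[OF B0, of j] by simp
  qed
  then show thesis using that[of "a B0"] J_a unfolding J_def by simp
qed

lemma sets_m_balls: "sets m = sigma_sets M (insert {} balls)"
proof -
  have "sigma_sets M {U. openin mtopology U} = sigma_sets M (insert {} balls)"
  proof (rule sigma_sets_eqI)
    fix U assume "U \<in> {U. openin mtopology U}"
    then have "U = \<Union>{B \<in> balls. B \<subseteq> U}" unfolding openin_iff_balls by blast
    moreover have "\<Union>{B \<in> balls. B \<subseteq> U} \<in> sigma_sets M (insert {} balls)"
      by (rule sigma_sets_UNION[OF countable_subset[OF _ countable_balls[OF separable]]]) auto
    ultimately show "U \<in> sigma_sets M (insert {} balls)" by simp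
  qed (auto intro: openin_ball)
  then show ?thesis by (simp add: sets_m)
qed

text \<open>The ancestors of a ball exhaust \<open>M\<close>, so dominated convergence applies. It
  allows the constant 1 to be approximated by functions supported in balls.\<close>

lemma tendsto_integral_ancestor:
  assumes f: "integrable m f" and B: "B \<in> balls"
  shows "(\<lambda>n. LINT x|m. indicator (ancestor B n) x * f x) \<longlonglongrightarrow> (LINT x|m. f x :: complex)"
proof (rule integral_dominated_convergence)
  note [measurable] = ball_sets[OF ancestor_ball[OF B]] borel_measurable_integrable[OF f]
  show "f \<in> borel_measurable m" "(\<lambda>x. indicator (ancestor B n) x * f x) \<in> borel_measurable m" for n
    by measurable
  show "integrable m (\<lambda>x. cmod (f x))" using f by simp
  show "AE x in m. (\<lambda>n. indicator (ancestor B n) x * f x) \<longlonglongrightarrow> f x"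
  proof (rule AE_I2)
    fix x assume "x \<in> space m"
    then obtain k where k: "x \<in> ancestor B k"
      using ancestor_covers[OF B, of x] unfolding space_m by blast
    have "\<forall>\<^sub>F n in sequentially. indicator (ancestor B n) x * f x = f x"
      using eventually_ge_at_top[of k]
      by eventually_elim (use k ancestor_mono[OF B] in \<open>auto simp: indicator_def\<close>)
    then show "(\<lambda>n. indicator (ancestor B n) x * f x) \<longlonglongrightarrow> f x" by (rule tendsto_eventually)
  qed
qed (auto simp: indicator_def)

text \<open>The difference of \<open>f\<close> and the common average has integral 0 over every
  ball. Balls and the empty set are closed under intersection and generate the measurable sets, so
  the integral vanishes over all of these. Cutting off with \<open>indicator B\<close> makes the
  difference integrable; countably many balls then cover the space.\<close>

lemma haar_kernel:
  assumes f: "f \<in> L2 m" and orth: "\<And>T. T \<in> haar_index \<Longrightarrow> L2_inner m (haar T) f = 0"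
  obtains c where "AE x in m. f x = c"
proof -
  obtain c where c: "\<And>B. B \<in> balls \<Longrightarrow> L2_inner m (indicator B) f = c * of_real (measure m B)"
    using haar_kernel_averages[OF f orth] by blast
  note int1 = integrable_indicator_ball
  have int2: "integrable m (\<lambda>x. indicator B x * f x)" if "B \<in> balls" for B
  proof -
    have "(\<lambda>x. indicator B x * f x) = (\<lambda>x. f x * cnj (indicator B x))"
      by (auto simp: indicator_def)
    then show ?thesis using integrable_L2_mult[OF f indicator_L2[OF that]] by simp
  qed
  have zero: "(LINT x|m. indicator B x * (f x - cnj c)) = 0" if B: "B \<in> balls" for B
  proof -
    have "(LINT x|m. indicator B x * f x) = cnj (L2_inner m (indicator B) f)"
      unfolding L2_inner_cnj unfolding L2_inner_def
      by (intro Bochner_Integration.integral_cong) (auto simp: indicator_def)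
    also have "\<dots> = cnj c * of_real (measure m B)" by (simp add: c[OF B])
    finally have 1: "(LINT x|m. indicator B x * f x) = cnj c * of_real (measure m B)" .
    have 2: "(LINT x|m. indicator B x * cnj c) = cnj c * of_real (measure m B)"
      by (simp add: integral_indicator_ball[OF B])
    have "(LINT x|m. indicator B x * f x - indicator B x * cnj c) = 0"
      using int1[OF B] int2[OF B] by (subst Bochner_Integration.integral_diff) (simp_all only: 1 2, simp_all)
    then show ?thesis by (simp add: right_diff_distrib)
  qed
  \<comment> \<open>The conjugate appears because \<open>f\<close> stood in the conjugate-linear
    argument of the inner product that defined \<open>c\<close>.\<close>
  have AE_ball: "AE x in m. x \<in> B \<longrightarrow> f x = cnj c" if B: "B \<in> balls" for B
  proof -
    define g where "g = (\<lambda>x. indicator B x * (f x - cnj c))"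
    have g: "integrable m g"
      unfolding g_def right_diff_distrib using int1[OF B] int2[OF B] by simp
    have "set_lebesgue_integral m A g = 0" if "A \<in> sets m" for A
    proof -
      have "Int_stable (insert {} balls)"
      proof (rule Int_stableI)
        fix A B assume "A \<in> insert {} balls" "B \<in> insert {} balls"
        then show "A \<inter> B \<in> insert {} balls"
          using balls_nested[of A B] by (cases "A \<inter> B = {}") (auto simp: Int_absorb1 Int_absorb2)
      qed
      moreover have "insert {} balls \<subseteq> Pow M" using ball_subset by blast
      moreover have "A \<in> sigma_sets M (insert {} balls)" using that by (simp add: sets_m_balls)
      ultimately show ?thesis
      proof (induction rule: sigma_sets_induct_disjoint)
        case (basic A)
        then have "A \<inter> B = {} \<or> A \<inter> B \<in> balls"
          using balls_nested[of A B] B by (cases "A \<inter> B = {}") (auto simp: Int_absorb1 Int_absorb2)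
        moreover have "set_lebesgue_integral m A g = (LINT x|m. indicator (A \<inter> B) x * (f x - cnj c))"
          unfolding set_lebesgue_integral_def g_def
          by (intro Bochner_Integration.integral_cong) (auto simp: indicator_def)
        ultimately show ?case using zero by auto
      next
        case empty
        then show ?case by (simp add: set_lebesgue_integral_def)
      next
        case (compl A)
        then have A: "A \<in> sets m" "A \<subseteq> M"
          using sets.sets_into_space[of A m] by (auto simp: sets_m_balls space_m)
        have "set_lebesgue_integral m (M - A) g = (LINT x|m. g x - indicator A x *\<^sub>R g x)"
          unfolding set_lebesgue_integral_def
          by (intro Bochner_Integration.integral_cong) (auto simp: indicator_def space_m)
        also have "\<dots> = (LINT x|m. g x) - set_lebesgue_integral m A g"
          unfolding set_lebesgue_integral_def
          using g A by (intro Bochner_Integration.integral_diff integrable_mult_indicator)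
        finally show ?case using compl zero[OF B] by (simp add: g_def)
      next
        case (union A)
        then have "\<And>i. A i \<in> sets m" by (auto simp: sets_m_balls)
        then have "set_lebesgue_integral m (\<Union>i. A i) g = (\<Sum>i. set_lebesgue_integral m (A i) g)"
          using union.hyps(1) g by (intro lebesgue_integral_countable_add)
             (auto simp: disjoint_family_on_def set_integrable_def intro!: integrable_mult_indicator)
        then show ?case using union by simp
      qed
    qed
    then have "AE x in m. g x = 0"
      by (rule sigma_finite_measure.density_zero[OF sigma_finite g])
    then show ?thesis by eventually_elim (auto simp: g_def)
  qed
  have "AE x in m. \<forall>B\<in>balls. x \<in> B \<longrightarrow> f x = cnj c"
    using AE_ball by (subst AE_ball_countable[OF countable_balls[OF separable]]) blast
  then have "AE x in m. f x = cnj c" using AE_space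
  proof eventually_elim
    case (elim x)
    then show ?case
      by (intro elim(1)[rule_format, of "mball x 1"] mball_in_balls) (auto simp: space_m)
  qed
  then show thesis by (rule that)
qed

end

section \<open>The spectrum of the hierarchical Laplacian\<close>

context proper_ultrametric_measure
begin

text \<open>\<open>M\<close> is not a ball; as an index it stands for the constant function \<open>1\<close>, which belongs to the basis when
  the measure is finite.\<close>

definition basis_index :: "'a set set" where
  "basis_index = haar_index \<union> (if emeasure m M < \<infinity> then {M} else {})"

definition bvec :: "'a set \<Rightarrow> 'a \<Rightarrow> complex" where
  "bvec T = (if T = M then (\<lambda>x. 1) else haar T)"

abbreviation index :: "nat \<Rightarrow> 'a set" where
  "index \<equiv> from_nat_into basis_index"

definition basis :: "nat \<Rightarrow> 'a \<Rightarrow> complex" where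
  "basis n = (\<lambda>x. of_real (1 / L2_norm m (bvec (index n))) * bvec (index n) x)"

lemma haar_index_not_M: "T \<in> haar_index \<Longrightarrow> T \<noteq> M" using haar_index_ball M_not_ball by blast

lemma integrable_const_iff: "integrable m (\<lambda>x. c :: real) \<longleftrightarrow> c = 0 \<or> emeasure m M < \<infinity>"
  by (auto simp: integrable_iff_bounded space_m ennreal_mult_less_top)

lemma const_L2: "emeasure m M < \<infinity> \<Longrightarrow> (\<lambda>x. c) \<in> L2 m" by (simp add: L2_def integrable_const_iff)

lemma M_sets: "M \<in> sets m" using sets.top[of m] by (simp add: space_m)

lemma bvec_L2: "T \<in> basis_index \<Longrightarrow> bvec T \<in> L2 m" using haar_index_not_M
  by (auto simp: basis_index_def bvec_def const_L2 haar_L2 split: if_splits)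

lemma bvec_norm_pos:
  assumes T: "T \<in> basis_index"
  shows "0 < L2_norm m (bvec T)"
proof (rule ccontr)
  assume "\<not> 0 < L2_norm m (bvec T)"
  then have "L2_norm m (bvec T) = 0" using L2_norm_nonneg[of m "bvec T"] by linarith
  then have AE: "AE x in m. bvec T x = 0" using L2_norm_eq_0[OF bvec_L2[OF T]] by simp
  have ball: "T \<in> balls" if "T \<noteq> M"
    using T that haar_index_ball by (auto simp: basis_index_def split: if_splits)
  have Top: "openin mtopology T" "T \<noteq> {}"
    using ball openin_ball[of T] ball_nonempty[of T] M_nonempty openin_topspace[of mtopology]
    by (cases "T = M"; auto)+
  have "bvec T x \<noteq> 0" if "x \<in> T" for x
  proof (cases "T = M")
    case False
    then have TI: "T \<in> haar_index" using T by (auto simp: basis_index_def split: if_splits)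
    show ?thesis
      using haar_on_child[OF TI ball[OF False] refl that] measure_ball_pos[OF ball[OF False]] False
      by (simp add: bvec_def)
  qed (simp add: bvec_def)
  then have "AE x in m. x \<notin> T" using AE by (auto elim: eventually_mono)
  then have "T \<in> null_sets m" using AE_iff_null_sets[OF open_sets[OF Top(1)]] by simp
  then show False using pos_open[OF Top] by (simp add: null_sets_def)
qed

lemma bvec_orthogonal:
  assumes S: "S \<in> basis_index" and T: "T \<in> basis_index" and "S \<noteq> T"
  shows "L2_inner m (bvec S) (bvec T) = 0"
proof -
  have *: "L2_inner m (haar R) (\<lambda>x. 1) = 0" if "R \<in> haar_index" for R
    by (rule inner_haar_const[OF that refl])
  have **: "L2_inner m (\<lambda>x. 1) (haar R) = 0" if "R \<in> haar_index" for R
    using arg_cong[OF *[OF that], of cnj] by (simp add: L2_inner_cnj)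
  show ?thesis using assms * ** haar_orthogonal haar_index_not_M
    by (auto simp: basis_index_def bvec_def split: if_splits)
qed

text \<open>Only constants are orthogonal to all Haar vectors. For finite measure the additional
  vector 1 excludes non-zero constants; for infinite measure they are not square integrable.\<close>

lemma bvec_complete:
  assumes f: "f \<in> L2 m" and orth: "\<And>T. T \<in> basis_index \<Longrightarrow> L2_inner m (bvec T) f = 0"
  shows "AE x in m. f x = 0"
proof -
  have "L2_inner m (haar T) f = 0" if "T \<in> haar_index" for T
    using orth[of T] that haar_index_not_M by (simp add: basis_index_def bvec_def)
  then obtain c where c: "AE x in m. f x = c" using haar_kernel[OF f] by blast
  note [measurable] = L2_measurable[OF f]
  have "c = 0"
  proof (cases "emeasure m M < \<infinity>")
    case True
    have "L2_inner m (\<lambda>x. 1) f = L2_inner m (\<lambda>x. 1) (\<lambda>x. c)"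
      using c by (intro L2_inner_cong_AE const_L2[OF True] f) auto
    also have "\<dots> = cnj c * of_real (measure m M)"
      by (simp add: L2_inner_def space_m scaleR_conv_of_real)
    finally have "cnj c * of_real (measure m M) = 0"
      using orth[of M] True by (simp add: basis_index_def bvec_def)
    moreover have "0 < measure m M"
      using pos_open[OF openin_topspace[of mtopology]] M_nonempty True
      by (simp add: measure_def enn2real_positive_iff)
    ultimately show ?thesis by simp
  next
    case False
    have "integrable m (\<lambda>x. (cmod (f x))\<^sup>2) \<longleftrightarrow> integrable m (\<lambda>x. (cmod c)\<^sup>2)"
      using c by (intro integrable_cong_AE) (auto elim: eventually_mono)
    then show ?thesis
      using L2_integrable[OF f] False by (simp add: integrable_const_iff space_m)
  qed
  with c show ?thesis by simp
qed

text \<open>A non-singleton ball has two different children, and the one of higher rank is an index.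
  Hence every value of \<open>lam\<close> on non-singleton balls occurs as an eigenvalue.\<close>

lemma child_in_haar_index:
  assumes B: "B \<in> nonsingleton_balls"
  obtains T where "T \<in> haar_index" "parent T = B"
proof -
  have Bb: "B \<in> balls" by (rule nonsingletonD[OF B])
  obtain x where "x \<in> B" using ball_nonempty[OF Bb] by blast
  then obtain S where S: "S \<in> balls" "parent S = B" using point_in_child[OF B] by blast
  then obtain y where y: "y \<in> B" "y \<notin> S" using psubset_parent[OF S(1)] by blast
  obtain T where T: "T \<in> balls" "parent T = B" "y \<in> T" by (rule point_in_child[OF B y(1)])
  have "rank S \<noteq> rank T" using rank_eq_iff[OF S(1) T(1)] y T by blast
  then have "S \<in> earlier T \<or> T \<in> earlier S" using S T by (auto simp: earlier_def)
  then show thesis using that[of S] that[of T] S T by (auto simp: haar_index_def)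
qed

text \<open>The parents of the Haar indices include an infinite chain of ancestors. With an infinite
  index set the enumeration by natural numbers has no repetitions, which orthonormality
  requires.\<close>

lemma infinite_basis_index: "infinite basis_index"
proof
  assume "finite basis_index"
  then have fin: "finite (parent ` haar_index)" by (simp add: basis_index_def)
  obtain B where B: "B \<in> balls" using M_nonempty mball_in_balls[of _ 1] by auto
  have "range (ancestor (parent B)) \<subseteq> nonsingleton_balls"
    using ancestor_ns[OF parent_ns[OF B]] by blast
  also have "\<dots> \<subseteq> parent ` haar_index"
  proof
    fix Q assume "Q \<in> nonsingleton_balls"
    then obtain T where "T \<in> haar_index" "parent T = Q" by (rule child_in_haar_index)
    then show "Q \<in> parent ` haar_index" by blast
  qed
  finally have "finite (range (ancestor (parent B)))" using fin by (rule finite_subset)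
  then show False using inj_ancestor[OF parent_ball[OF B]] finite_imageD by blast
qed

lemma countable_basis_index: "countable basis_index"
  by (rule countable_subset[of _ "insert M balls"])
     (auto simp: basis_index_def haar_index_ball countable_balls[OF separable] split: if_splits)

lemma enum_in: "index n \<in> basis_index" using infinite_basis_index by (intro from_nat_into) auto

lemma inner_basis:
  assumes "f \<in> L2 m"
  shows "L2_inner m f (basis n) = of_real (1 / L2_norm m (bvec (index n)))
    * L2_inner m f (bvec (index n))"
  unfolding basis_def by (subst L2_inner_scale_right[OF bvec_L2[OF enum_in] assms]) simp

lemma L2_basis_basis: "L2_basis m basis"
proof
  show basis_L2: "basis n \<in> L2 m" for n unfolding basis_def by (intro L2_scale bvec_L2 enum_in)
  show "L2_inner m (basis i) (basis j) = (if i = j then 1 else 0)" for i j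
  proof -
    let ?S = "index i" and ?T = "index j"
    have eq: "L2_inner m (basis i) (basis j) = of_real (1 / L2_norm m (bvec ?T))
        * (of_real (1 / L2_norm m (bvec ?S)) * L2_inner m (bvec ?S) (bvec ?T))"
      unfolding inner_basis[OF basis_L2] unfolding basis_def
      by (subst L2_inner_scale_left) (auto intro: bvec_L2 enum_in)
    show ?thesis
    proof (cases "i = j")
      case True
      then show ?thesis unfolding eq using bvec_norm_pos[OF enum_in[of j]]
        by (simp add: L2_inner_self power2_eq_square)
    next
      case False
      then have "?S \<noteq> ?T"
        using from_nat_into_inj_infinite[OF countable_basis_index infinite_basis_index] by blast
      then show ?thesis unfolding eq using bvec_orthogonal[OF enum_in enum_in] False by simp
    qed
  qed
  fix f assume f: "f \<in> L2 m" and orth: "\<And>n. L2_inner m f (basis n) = 0"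
  show "AE x in m. f x = 0"
  proof (rule bvec_complete[OF f])
    fix T assume "T \<in> basis_index"
    then obtain n where n: "T = index n" by (metis from_nat_into_surj countable_basis_index)
    have "L2_inner m f (bvec T) = 0"
      using orth[of n] inner_basis[OF f, of n] bvec_norm_pos[OF enum_in[of n]] n by simp
    from arg_cong[OF this, of cnj] show "L2_inner m (bvec T) f = 0" by (simp add: L2_inner_cnj)
  qed
qed

end

section \<open>Eigenvalues, and the constant function when the measure is finite\<close>

context hierarchical_laplacian
begin

text \<open>The value 0 at \<open>M\<close> belongs to the constant function 1, which lies in the
  domain of the extension for finite measure although it is not a test function.\<close>

definition eigenvalue :: "'a set \<Rightarrow> real" where
  "eigenvalue T = (if T = M then 0 else lam (parent T))"

definition eigenvalues :: "nat \<Rightarrow> real" where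
  "eigenvalues n = eigenvalue (index n)"

lemma Lap_haar: "T \<in> haar_index \<Longrightarrow> x \<in> M \<Longrightarrow> Lap (haar T) x = of_real (lam (parent T)) * haar T x"
  using haar_bounded[of T] haar_const_on[of T] haar_supported[of T] integral_haar[of T]
    parent_ball[OF haar_index_ball[of T]] loc_const_measurable[OF haar_loc_const[of T]]
  by (auto intro!: Lap_eigenfunction)

lemma haar_graph:
  assumes T: "T \<in> haar_index"
  shows "(haar T, \<lambda>x. of_real (lam (parent T)) * haar T x) \<in> hier_Laplacian_graph m C"
proof -
  have "haar T \<in> locally_constant_compact_support mtopology" unfolding test_fun_iff
    using haar_loc_const[OF T] haar_supported[OF T] parent_ball[OF haar_index_ball[OF T]] by blast
  moreover have "AE x in m. of_real (lam (parent T)) * haar T x = Lap (haar T) x"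
    using Lap_haar[OF T] by (intro AE_I2) (simp add: space_m)
  ultimately show ?thesis
    unfolding hier_Laplacian_graph_def using haar_L2[OF T] L2_scale[OF haar_L2[OF T]] by blast
qed

text \<open>The values are the tails of the convergent series that defines
  \<open>lam B\<close>.\<close>

lemma lam_ancestor_tendsto_0:
  assumes B: "B \<in> nonsingleton_balls"
  shows "(\<lambda>n. lam (ancestor B n)) \<longlonglongrightarrow> 0"
proof -
  have Bb: "B \<in> balls" by (rule nonsingletonD[OF B])
  define c where "c k = C (ancestor B k)" for k
  have sums: "(\<lambda>k. c (k + n)) sums lam (ancestor B n)" for n
  proof -
    have An: "ancestor B n \<in> nonsingleton_balls" "ancestor B n \<in> balls"
      by (auto intro: ancestor_ns ancestor_ball B Bb)
    have "(C has_sum lam (ancestor B n)) (above (ancestor B n))"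
      unfolding lam_eq by (rule has_sum_infsum[OF C_summable[OF An(2)]])
    then have "(C \<circ> ancestor (ancestor B n) has_sum lam (ancestor B n)) UNIV"
      unfolding nonsingleton_superballs_eq_range[OF An(1)]
      by (subst (asm) has_sum_reindex[OF inj_ancestor[OF An(2)]])
    then show ?thesis using has_sum_imp_sums by (fastforce simp: c_def o_def funpow_add)
  qed
  have "summable c" using sums[of 0] by (simp add: sums_iff)
  then have "(\<lambda>n. \<Sum>k. c (k + n)) \<longlonglongrightarrow> 0" by (rule suminf_exist_split2)
  then show ?thesis using sums by (simp add: sums_iff)
qed

text \<open>This is symmetry against the constant 1, obtained by approximation. Integrating
  \<open>Lap f\<close> over growing balls \<open>B n\<close> leaves only terms from balls above
  \<open>B n\<close>, bounded by a multiple of \<open>lam (B n)\<close>, which tends to 0;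
  finiteness of the measure makes \<open>Lap f\<close> integrable.\<close>

lemma integral_Lap_eq_0:
  assumes fin: "emeasure m M < \<infinity>"
    and f: "loc_const f" "A \<in> balls" "supported A f" and Lf: "Lap f \<in> L2 m"
  shows "(LINT x|m. Lap f x) = 0"
proof -
  obtain K where K: "0 \<le> K" "bounded_by K f" using test_fun_bounded[OF f] by blast
  define B where "B n = ancestor (parent A) n" for n
  have B: "B n \<in> nonsingleton_balls" "B n \<in> balls" for n
    unfolding B_def using parent_ns[OF f(2)] parent_ball[OF f(2)]
    by (auto intro: ancestor_ns ancestor_ball)
  have \<mu>: "measure m (B n) \<le> measure m M" for n
    using fin B ball_subset by (intro measure_mono_fmeasurable) (auto simp: fmeasurable_def M_sets)
  have int: "integrable m (Lap f)"
    using integrable_L2_mult[OF Lf const_L2[OF fin, of 1]] by simp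
  have "(\<lambda>n. LINT x|m. Lap f x * indicator (B n) x) \<longlonglongrightarrow> (LINT x|m. Lap f x)"
    using tendsto_integral_ancestor[OF int parent_ball[OF f(2)]] by (simp add: B_def mult.commute)
  moreover have "(\<lambda>n. LINT x|m. Lap f x * indicator (B n) x) \<longlonglongrightarrow> 0"
  proof (rule Lim_null_comparison)
    show "\<forall>\<^sub>F n in sequentially. norm (LINT x|m. Lap f x * indicator (B n) x)
        \<le> 2 * K * measure m M * lam (B n)"
    proof (intro always_eventually allI)
      fix n
      have lam0: "0 \<le> lam (B n)"
        unfolding lam_eq using C_pos by (intro infsum_nonneg) (auto intro: less_imp_le)
      have avg: "(LINT x|m. f x * indicator (B n) x) = ball_average m (B n) f * of_real (measure m (B n))"
        using measure_ball_pos[OF B(2)[of n]] by (simp add: ball_average_eq mult.commute)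
      have "(LINT x|m. Lap f x * indicator (B n) x)
          = - outer_avg (B n) f * (LINT x|m. indicator (B n) x) + of_real (lam (B n)) * (LINT x|m. f x * indicator (B n) x)"
      proof (rule integral_Lap_mult[OF f B(2), of _ _ 1])
        show "indicator (B n) \<in> borel_measurable m"
          by (rule borel_measurable_indicator[OF ball_sets[OF B(2)]])
      qed (auto simp: supported_def bounded_by_def indicator_def intro!: const_onI[of _ _ 1])
      also have "\<dots> = (of_real (lam (B n)) * ball_average m (B n) f - outer_avg (B n) f) * of_real (measure m (B n))"
        by (simp add: avg integral_indicator_ball[OF B(2)] algebra_simps)
      also have "norm \<dots> \<le> (lam (B n) * K + K * lam (B n)) * measure m M" unfolding norm_mult
      proof (intro mult_mono order_trans[OF norm_triangle_ineq4] add_mono)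
        show "norm (of_real (lam (B n)) * ball_average m (B n) f) \<le> lam (B n) * K"
          using lam0 norm_ball_average[OF B(2) K(2)] by (simp add: norm_mult mult_left_mono)
        show "norm (outer_avg (B n) f) \<le> K * lam (B n)" by (rule norm_outer_avg[OF K(2) B(2)])
        show "0 \<le> lam (B n) * K + K * lam (B n)" using lam0 K by simp
      qed (use \<mu> in auto)
      finally show "norm (LINT x|m. Lap f x * indicator (B n) x) \<le> 2 * K * measure m M * lam (B n)"
        by (simp add: algebra_simps)
    qed
    show "(\<lambda>n. 2 * K * measure m M * lam (B n)) \<longlonglongrightarrow> 0" unfolding B_def
      by (intro tendsto_mult_right_zero lam_ancestor_tendsto_0 parent_ns f(2))
  qed
  ultimately show ?thesis by (rule LIMSEQ_unique)
qed

text \<open>Balls inside \<open>B\<close> or disjoint from it do not contribute, as the indicator is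
  constant there; each ball above \<open>B\<close> contributes at most twice its weight.\<close>

lemma norm_Lap_indicator:
  assumes B: "B \<in> balls" and x: "x \<in> M"
  shows "cmod (Lap (indicator B) x) \<le> 2 * lam B"
proof -
  have "Lap (indicator B) x = - (\<Sum>\<^sub>\<infinity>Q\<in>above B. of_real (C Q) *
      (if x \<in> Q then ball_average m Q (indicator B) - indicator B x else 0))"
  proof (rule Lap_eq[OF B])
    fix Q assume Q: "Q \<in> nonsingleton_balls" "x \<in> Q" "\<not> B \<subseteq> Q"
    have Qb: "Q \<in> balls" by (rule nonsingletonD[OF Q(1)])
    have "Q \<inter> B = {} \<or> Q \<subseteq> B" using balls_nested[OF Qb B] Q(3) by blast
    then have "indicator B y = (indicator B x :: complex)" if "y \<in> Q" for y
      using that Q(2) by (auto simp: indicator_def)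
    then show "ball_average m Q (indicator B) = indicator B x"
      by (rule ball_average_const[OF Qb])
  qed
  also have "cmod \<dots> \<le> 2 * lam B" unfolding norm_minus_cancel
  proof (rule norm_weighted_sum[OF B])
    fix Q assume "Q \<in> above B"
    then have "cmod (ball_average m Q (indicator B)) \<le> 1"
      by (intro norm_ball_average) (auto intro: nonsingletonD simp: bounded_by_def indicator_def)
    moreover have "cmod (indicator B x) \<le> 1" by (simp add: indicator_def)
    ultimately show "cmod (if x \<in> Q then ball_average m Q (indicator B) - indicator B x else 0) \<le> 2"
      using norm_triangle_ineq4[of "ball_average m Q (indicator B)" "indicator B x"] by auto
  qed
  finally show ?thesis .
qed

text \<open>The indicators of growing balls tend to 1, while their images under \<open>Lap\<close>
  tend to 0 uniformly, hence in norm as the measure is finite. Passing to the limit in the adjoint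
  relation gives the claim.\<close>

lemma adjoint_mean_0:
  assumes fin: "emeasure m M < \<infinity>" and fu: "(f, u) \<in> adjoint_graph m (hier_Laplacian_graph m C)"
  shows "L2_inner m (\<lambda>x. 1) u = 0"
proof -
  have f: "f \<in> L2 m" and u: "u \<in> L2 m"
    and adj: "\<And>g v. (g, v) \<in> hier_Laplacian_graph m C \<Longrightarrow> L2_inner m v f = L2_inner m g u"
    using fu by (auto simp: adjoint_graph_def)
  obtain A where A: "A \<in> balls" using M_nonempty mball_in_balls[of _ 1] by auto
  define B where "B n = ancestor (parent A) n" for n
  have B: "B n \<in> balls" for n unfolding B_def using parent_ball[OF A] by (rule ancestor_ball)
  define L where "L n = Lap (indicator (B n))" for n
  have lc: "loc_const (indicator (B n))" for n by (rule loc_const_indicator[OF B])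
  have meas: "L n \<in> borel_measurable m" for n
    unfolding L_def by (intro loc_const_measurable Lap_loc_const lc)
  have bound: "cmod (L n x) \<le> 2 * lam (B n)" if "x \<in> M" for n x
    unfolding L_def by (rule norm_Lap_indicator[OF B that])
  have lam0: "0 \<le> lam (B n)" for n
    unfolding lam_eq using C_pos by (intro infsum_nonneg) (auto intro: less_imp_le)
  have const_int: "integrable m (\<lambda>x. c :: real)" for c
    using fin by (simp add: integrable_const_iff space_m)
  have sq: "(cmod (L n x))\<^sup>2 \<le> (2 * lam (B n))\<^sup>2" if "x \<in> M" for n x
    using bound[OF that] by (intro power_mono) auto
  have L_L2: "L n \<in> L2 m" for n
  proof -
    have "integrable m (\<lambda>x. (cmod (L n x))\<^sup>2)"
      by (rule Bochner_Integration.integrable_bound[OF const_int[of "(2 * lam (B n))\<^sup>2"]])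
         (use meas sq in \<open>auto intro!: AE_I2 simp: space_m\<close>)
    then show ?thesis using meas by (simp add: L2_def)
  qed
  have L_norm: "L2_norm m (L n) \<le> 2 * lam (B n) * sqrt (measure m M)" for n
  proof -
    have "(LINT x|m. (cmod (L n x))\<^sup>2) \<le> (LINT x|m. (2 * lam (B n))\<^sup>2)"
      by (rule Bochner_Integration.integral_mono)
         (use L2_integrable[OF L_L2] const_int sq in \<open>auto simp: space_m\<close>)
    also have "\<dots> = (2 * lam (B n))\<^sup>2 * measure m M" by (simp add: space_m mult.commute)
    finally have "L2_norm m (L n) \<le> sqrt ((2 * lam (B n))\<^sup>2 * measure m M)"
      unfolding L2_norm_def by (rule real_sqrt_le_mono)
    then show ?thesis using lam0[of n] by (simp add: real_sqrt_mult)
  qed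
  have eq: "L2_inner m (L n) f = L2_inner m (indicator (B n)) u" for n
  proof (rule adj)
    have "indicator (B n) \<in> locally_constant_compact_support mtopology"
      unfolding test_fun_iff
      by (intro conjI lc bexI[OF _ B[of n]]) (auto simp: supported_def indicator_def)
    then show "(indicator (B n), L n) \<in> hier_Laplacian_graph m C"
      unfolding hier_Laplacian_graph_def using L_L2[of n] indicator_L2[OF B[of n]] L_def by auto
  qed
  have "(\<lambda>n. L2_inner m (L n) f) \<longlonglongrightarrow> 0"
  proof (rule Lim_null_comparison)
    show "\<forall>\<^sub>F n in sequentially. norm (L2_inner m (L n) f) \<le> 2 * lam (B n) * sqrt (measure m M) * L2_norm m f"
      using L2_Cauchy_Schwarz[OF L_L2 f] mult_right_mono[OF L_norm L2_norm_nonneg]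
      by (intro always_eventually allI) (rule order_trans)
    have "(\<lambda>n. 2 * sqrt (measure m M) * L2_norm m f * lam (B n)) \<longlonglongrightarrow> 0" unfolding B_def
      by (intro tendsto_mult_right_zero lam_ancestor_tendsto_0 parent_ns A)
    then show "(\<lambda>n. 2 * lam (B n) * sqrt (measure m M) * L2_norm m f) \<longlonglongrightarrow> 0"
      by (simp add: algebra_simps)
  qed
  moreover have "(\<lambda>n. L2_inner m (indicator (B n)) u) \<longlonglongrightarrow> L2_inner m (\<lambda>x. 1) u"
    using tendsto_integral_ancestor[OF integrable_L2_mult[OF const_L2[OF fin, of 1] u] parent_ball[OF A]]
    by (simp add: L2_inner_def B_def)
  ultimately show ?thesis unfolding eq by (metis LIMSEQ_unique)
qed

text \<open>Together with \<open>adjoint_eigen\<close> this yields the two inclusions that identify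
  the self-adjoint extension. Here the given functions must first be replaced by a test function and
  its image.\<close>

lemma graph_eigen:
  assumes fu: "(f, u) \<in> hier_Laplacian_graph m C" and T: "T \<in> basis_index"
  shows "L2_inner m u (bvec T) = of_real (eigenvalue T) * L2_inner m f (bvec T)"
proof -
  obtain g where f: "f \<in> L2 m" and u: "u \<in> L2 m"
    and g: "g \<in> locally_constant_compact_support mtopology"
    and fg: "AE x in m. f x = g x" and ug: "AE x in m. u x = Lap g x"
    using fu unfolding hier_Laplacian_graph_def by blast
  obtain A where A: "loc_const g" "A \<in> balls" "supported A g"
    using g unfolding test_fun_iff by blast
  have gL2: "g \<in> L2 m" by (rule test_fun_L2[OF A])
  have LL2: "Lap g \<in> L2 m"
    by (rule L2_cong_AE[OF u loc_const_measurable[OF Lap_loc_const[OF A(1)]]])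
       (use ug in \<open>auto elim: eventually_mono\<close>)
  have fv: "L2_inner m f (bvec T) = L2_inner m g (bvec T)"
    by (rule L2_inner_cong_AE[OF f gL2 fg bvec_L2[OF T] bvec_L2[OF T]]) simp
  have uv: "L2_inner m u (bvec T) = L2_inner m (Lap g) (bvec T)"
    by (rule L2_inner_cong_AE[OF u LL2 ug bvec_L2[OF T] bvec_L2[OF T]]) simp
  show ?thesis
  proof (cases "T = M")
    case True
    then have "emeasure m M < \<infinity>"
      using T haar_index_not_M by (auto simp: basis_index_def split: if_splits)
    then show ?thesis unfolding uv using integral_Lap_eq_0[OF _ A LL2] True
      by (simp add: eigenvalue_def bvec_def L2_inner_def)
  next
    case False
    then have TI: "T \<in> haar_index" using T by (auto simp: basis_index_def split: if_splits)
    \<comment> \<open>Haar vectors are real, so the inner product is the plain integral treated by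
      \<open>integral_Lap_mult\<close>.\<close>
    have real: "cnj (haar T x) = haar T x" for x
    proof -
      have "cnj (indicator S x) = indicator S x" for S :: "'a set" by (simp add: indicator_def)
      then show ?thesis by (simp add: haar_def)
    qed
    obtain K where K: "bounded_by K (haar T)" using haar_bounded[OF TI] by blast
    have "(LINT x|m. Lap g x * haar T x)
        = - outer_avg (parent T) g * (LINT x|m. haar T x) + of_real (lam (parent T)) * (LINT x|m. g x * haar T x)"
      by (rule integral_Lap_mult[OF A parent_ball[OF haar_index_ball[OF TI]]
            loc_const_measurable[OF haar_loc_const[OF TI]] haar_supported[OF TI] K haar_const_on[OF TI]])
    then show ?thesis unfolding uv fv using False
      by (simp add: bvec_def eigenvalue_def L2_inner_def real integral_haar[OF TI])
  qed
qed

text \<open>Haar vectors with their images lie in the graph and can be tested directly; for the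
  constant function \<open>adjoint_mean_0\<close> takes the place of membership.\<close>

lemma adjoint_eigen:
  assumes fu: "(f, u) \<in> adjoint_graph m (hier_Laplacian_graph m C)" and T: "T \<in> basis_index"
  shows "L2_inner m u (bvec T) = of_real (eigenvalue T) * L2_inner m f (bvec T)"
proof -
  have f: "f \<in> L2 m" and u: "u \<in> L2 m"
    and adj: "\<And>g v. (g, v) \<in> hier_Laplacian_graph m C \<Longrightarrow> L2_inner m v f = L2_inner m g u"
    using fu by (auto simp: adjoint_graph_def)
  have "L2_inner m (bvec T) u = of_real (eigenvalue T) * L2_inner m (bvec T) f"
  proof (cases "T = M")
    case True
    then have "emeasure m M < \<infinity>"
      using T haar_index_not_M by (auto simp: basis_index_def split: if_splits)
    then show ?thesis using adjoint_mean_0[OF _ fu] True by (simp add: bvec_def eigenvalue_def)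
  next
    case False
    then have TI: "T \<in> haar_index" using T by (auto simp: basis_index_def split: if_splits)
    then show ?thesis using adj[OF haar_graph[OF TI]] False
      by (simp add: bvec_def eigenvalue_def L2_inner_scale_left[OF haar_L2[OF TI] f])
  qed
  from arg_cong[OF this, of cnj] show ?thesis by (simp add: L2_inner_cnj)
qed

text \<open>The hypothesis \<open>0 \<in> S\<close> accounts for the eigenvalue of the constants;
  the remaining eigenvalues are exactly the values of \<open>lam\<close> on non-singleton
  balls.\<close>

theorem op_spectrum_hier_Laplacian:
  assumes S: "closed S" "0 \<in> S" "lam ` nonsingleton_balls \<subseteq> S" "S \<subseteq> closure (lam ` nonsingleton_balls)"
  shows "op_spectrum m (hier_Laplacian m C) = complex_of_real ` S"
proof -
  interpret L2_basis m basis
    by (rule L2_basis_basis)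
  let ?G = "hier_Laplacian_graph m C"
  have "?G \<subseteq> diagonal eigenvalues"
  proof clarify
    fix f u assume fu: "(f, u) \<in> ?G"
    then have "f \<in> L2 m" "u \<in> L2 m" by (auto simp: hier_Laplacian_graph_def)
    then show "(f, u) \<in> diagonal eigenvalues"
      using graph_eigen[OF fu enum_in] by (simp add: diagonal_def inner_basis eigenvalues_def)
  qed
  moreover have "adjoint_graph m ?G \<subseteq> diagonal eigenvalues"
  proof clarify
    fix f u assume fu: "(f, u) \<in> adjoint_graph m ?G"
    then have "f \<in> L2 m" "u \<in> L2 m" by (auto simp: adjoint_graph_def)
    then show "(f, u) \<in> diagonal eigenvalues"
      using adjoint_eigen[OF fu enum_in] by (simp add: diagonal_def inner_basis eigenvalues_def)
  qed
  ultimately have "hier_Laplacian m C = diagonal eigenvalues"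
    unfolding hier_Laplacian_def by (rule selfadjoint_extension_eq_diagonal)
  moreover have "op_spectrum m (diagonal eigenvalues) = complex_of_real ` S"
  proof (rule op_spectrum_diagonal[OF S(1)])
    have "eigenvalue T \<in> S" if "T \<in> basis_index" for T
      using that S(2,3) parent_ns[OF haar_index_ball[of T]]
      by (auto simp: eigenvalue_def basis_index_def split: if_splits)
    then show "range eigenvalues \<subseteq> S" unfolding eigenvalues_def using enum_in by blast
    have "lam ` nonsingleton_balls \<subseteq> range eigenvalues"
    proof
      fix t assume "t \<in> lam ` nonsingleton_balls"
      then obtain B where "B \<in> nonsingleton_balls" "t = lam B" by blast
      then obtain T where T: "T \<in> haar_index" "t = lam (parent T)"
        using child_in_haar_index[of B] by metis
      then obtain n where "T = index n"
        using from_nat_into_surj[OF countable_basis_index, of T] by (auto simp: basis_index_def)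
      then show "t \<in> range eigenvalues"
        using T haar_index_not_M[OF T(1)] by (auto simp: eigenvalues_def eigenvalue_def)
    qed
    then show "S \<subseteq> closure (range eigenvalues)" using S(4) closure_mono by blast
  qed
  ultimately show ?thesis by simp
qed

end

section \<open>Choice functions with prescribed sums\<close>

context proper_ultrametric
begin

lemma nonsingleton_of_nonisolated:
  assumes "B \<in> balls" "x \<in> B" "\<not> isolated_point mtopology x"
  shows "B \<in> nonsingleton_balls"
proof -
  have "B \<noteq> {x}"
    using assms openin_ball[OF assms(1)] ball_subset[OF assms(1)] by (auto simp: isolated_point_def)
  then show ?thesis using assms by (auto simp: nonsingleton_balls_def is_singleton_def)
qed

definition spectral_function :: "('a set \<Rightarrow> real) \<Rightarrow> bool" where
  "spectral_function l \<longleftrightarrow>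
     (\<forall>B\<in>nonsingleton_balls. l (parent B) < l B \<and> (\<lambda>n. l (ancestor B n)) \<longlonglongrightarrow> 0) \<and>
     (\<forall>x\<in>M. \<forall>K. \<not> isolated_point mtopology x \<longrightarrow>
        (\<exists>B\<in>balls. x \<in> B \<and> (\<forall>Q\<in>nonsingleton_balls. x \<in> Q \<and> Q \<subseteq> B \<longrightarrow> K \<le> l Q)))"

text \<open>Along the ancestor chain the differences telescope to \<open>l B\<close> minus the limit
  0. Being positive, they are summable in any order.\<close>

lemma choice_function_exists:
  assumes l: "spectral_function l"
  shows "\<exists>C. choice_function C \<and> (\<forall>B\<in>nonsingleton_balls. choice_lambda C B = l B)"
proof -
  have mono: "l (parent B) < l B" and lim: "(\<lambda>n. l (ancestor B n)) \<longlonglongrightarrow> 0"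
    if "B \<in> nonsingleton_balls" for B
    using l that by (simp_all add: spectral_function_def)
  define C where "C B = l B - l (parent B)" for B
  have sum: "(C has_sum l B) {Q \<in> nonsingleton_balls. B \<subseteq> Q}" if B: "B \<in> nonsingleton_balls" for B
  proof -
    have "(\<lambda>n. l (ancestor B n) - l (ancestor B (Suc n))) sums (l (ancestor B 0) - 0)"
      by (rule telescope_sums'[OF lim[OF B]])
    then have "((\<lambda>n. C (ancestor B n)) has_sum l B) UNIV"
      using mono[OF ancestor_ns[OF B]]
      by (intro sums_nonneg_imp_has_sum) (auto simp: C_def less_imp_le)
    then show ?thesis unfolding nonsingleton_superballs_eq_range[OF B]
        has_sum_reindex[OF inj_ancestor[OF nonsingletonD[OF B]]] by (simp add: o_def)
  qed
  have eq: "choice_lambda C B = l B" if "B \<in> nonsingleton_balls" for B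
    unfolding choice_lambda_def by (rule infsumI[OF sum[OF that]])
  have "C summable_on {Q \<in> nonsingleton_balls. B \<subseteq> Q}" if B: "B \<in> balls" for B
  proof (cases "B \<in> nonsingleton_balls")
    case True
    show ?thesis using has_sum_imp_summable[OF sum[OF True]] .
  next
    case False
    \<comment> \<open>A singleton ball is not counted among its own superballs, so its sum is that
      of its parent.\<close>
    then have "{Q \<in> nonsingleton_balls. B \<subseteq> Q} = {Q \<in> nonsingleton_balls. parent B \<subseteq> Q}"
      using nonsingleton_strict_superballs[OF B] by blast
    then show ?thesis using has_sum_imp_summable[OF sum[OF parent_ns[OF B]]] by simp
  qed
  moreover have "filterlim (choice_lambda C) at_top (balls_shrinking_to x)"
    if x: "x \<in> M" "\<not> isolated_point mtopology x" for x
    unfolding filterlim_at_top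
  proof
    fix K
    have "\<exists>B\<in>balls. x \<in> B \<and> (\<forall>Q\<in>nonsingleton_balls. x \<in> Q \<and> Q \<subseteq> B \<longrightarrow> K \<le> l Q)"
      using l x by (simp add: spectral_function_def)
    then obtain B where B: "B \<in> balls" "x \<in> B"
      "\<And>Q. \<lbrakk>Q \<in> nonsingleton_balls; x \<in> Q; Q \<subseteq> B\<rbrakk> \<Longrightarrow> K \<le> l Q" by blast
    have "K \<le> choice_lambda C Q" if "Q \<in> balls" "x \<in> Q" "Q \<subseteq> B" for Q
      using B(3)[of Q] eq[of Q] nonsingleton_of_nonisolated[OF that(1,2) x(2)] that by simp
    then show "\<forall>\<^sub>F Q in balls_shrinking_to x. K \<le> choice_lambda C Q"
      unfolding balls_shrinking_to_def using B
      by (intro eventually_INF1[of B]) (auto simp: eventually_principal)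
  qed
  ultimately have "choice_function C" using mono by (simp add: choice_function_def C_def)
  then show ?thesis using eq by blast
qed

text \<open>The disjoint balls whose values will be free. The finiteness clause lets a ball not
  inside a member count the balls below it that are not strictly inside a member, and it forces
  every sequence of balls shrinking to a non-isolated point to enter a member.\<close>

definition separated_family :: "'a set set \<Rightarrow> bool" where
  "separated_family G \<longleftrightarrow> G \<subseteq> nonsingleton_balls \<and> infinite G \<and>
     (\<forall>P\<in>G. \<forall>Q\<in>G. P \<inter> Q \<noteq> {} \<longrightarrow> P = Q) \<and>
     (\<forall>T\<in>nonsingleton_balls. (\<forall>P\<in>G. \<not> T \<subseteq> P) \<longrightarrow>
        finite {Q \<in> nonsingleton_balls. Q \<subseteq> T \<and> (\<forall>P\<in>G. \<not> Q \<subset> P)})"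

text \<open>The value at the \<open>i\<close>-th member of \<open>G\<close> is the \<open>i\<close>-th element of a dense sequence in \<open>S - {0}\<close>; the values
  strictly inside a member of \<open>G\<close> climb to infinity, and those outside descend to \<open>0\<close> fast enough to stay
  below the values at the finitely many members of \<open>G\<close> they contain.\<close>

lemma spectral_function_exists:
  fixes S :: "real set"
  assumes G: "separated_family G" "countable G"
    and S: "S \<subseteq> {0..}" "0 islimpt S"
    and alt: "(\<forall>P\<in>G. \<forall>Q\<in>nonsingleton_balls. \<not> Q \<subset> P) \<or> \<not> bounded S"
  shows "\<exists>l. spectral_function l \<and> l ` nonsingleton_balls \<subseteq> S \<and> S \<subseteq> closure (l ` nonsingleton_balls)"
proof -
  have G: "G \<subseteq> nonsingleton_balls" "infinite G" "countable G"
    using G by (auto simp: separated_family_def)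
  have disj: "P = Q" if "P \<in> G" "Q \<in> G" "P \<inter> Q \<noteq> {}" for P Q
    using assms(1) that by (simp add: separated_family_def)
  have small: "\<exists>y\<in>S. 0 < y \<and> y < r" if "r > 0" for r
  proof -
    obtain y where "y \<in> S" "y \<noteq> 0" "dist y 0 < r"
      using S(2) \<open>r > 0\<close> unfolding islimpt_approachable by blast
    then show ?thesis using S(1) by (intro bexI[of _ y]) auto
  qed
  \<comment> \<open>Values of a spectral function are positive, so 0 is left out. The closure loses
    nothing, since 0 is an accumulation point of \<open>S\<close>.\<close>
  obtain D where D: "countable D" "D \<subseteq> S - {0}" "S - {0} \<subseteq> closure D" by (rule separable)
  have "D \<noteq> {}" using small[of 1] D(3) by auto
  define s where "s P = from_nat_into D (to_nat_on G P)" for P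
  have sG: "s ` G = D" unfolding s_def image_comp[symmetric, unfolded o_def]
    using image_to_nat_on[OF G(3,2)] range_from_nat_into[OF \<open>D \<noteq> {}\<close> D(1)]
    by (metis (no_types, lifting) image_cong image_image)
  have s: "s P \<in> S" "0 < s P" if "P \<in> G" for P
  proof -
    have "s P \<in> S - {0}" using sG D(2) that by blast
    then show "s P \<in> S" "0 < s P" using S(1) by force+
  qed
  \<comment> \<open>The supply of values for the balls not inside a member of \<open>G\<close>: a
    strictly decreasing null sequence in \<open>S\<close>.\<close>
  have "\<exists>t. \<forall>n. (t n \<in> S \<and> 0 < t n \<and> t n < 1 / Suc n) \<and> t (Suc n) < t n"
  proof (rule dependent_nat_choice)
    show "\<exists>x. x \<in> S \<and> 0 < x \<and> x < 1 / Suc 0" using small[of 1] by auto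
    show "\<exists>y. (y \<in> S \<and> 0 < y \<and> y < 1 / Suc (Suc n)) \<and> y < x" if "x \<in> S \<and> 0 < x \<and> x < 1 / Suc n" for x n
      using small[of "min x (1 / Suc (Suc n))"] that by auto
  qed
  then obtain t where t: "\<And>n. t n \<in> S" "\<And>n. 0 < t n" "\<And>n. t n < 1 / Suc n" "\<And>n. t (Suc n) < t n"
    by blast
  have t_less: "t j < t i" if "i < j" for i j
    using that by (rule lift_Suc_mono_less[of "\<lambda>n. - t n", simplified, OF t(4)])
  have t_lim: "t \<longlonglongrightarrow> 0"
    by (rule tendsto_sandwich[OF _ _ tendsto_const LIMSEQ_inverse_real_of_nat])
       (auto intro!: always_eventually less_imp_le t(2,3) simp: inverse_eq_divide simp del: of_nat_Suc)
  \<comment> \<open>Values for the balls inside \<open>P\<close>, indexed by depth. Steps larger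
    than 1 force divergence. For bounded \<open>S\<close> only depth 0 occurs among non-singleton
    balls, by \<open>alt\<close>, and a constant sequence serves as a dummy.\<close>
  have "\<exists>r. r 0 = s P \<and> (\<not> bounded S \<longrightarrow> (\<forall>n. r n \<in> S \<and> r n + 1 < r (Suc n)))" if P: "P \<in> G" for P
  proof (cases "bounded S")
    case True
    then show ?thesis by (intro exI[of _ "\<lambda>_. s P"]) simp
  next
    case False
    have "\<exists>r. \<forall>n. (r n \<in> S \<and> (n = 0 \<longrightarrow> r n = s P)) \<and> r n + 1 < r (Suc n)"
    proof (rule dependent_nat_choice)
      show "\<exists>x. x \<in> S \<and> (0 = 0 \<longrightarrow> x = s P)" using s[OF P] by simp
      fix x and n :: nat
      assume "x \<in> S \<and> (n = 0 \<longrightarrow> x = s P)"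
      have "\<exists>y\<in>S. x + 1 < y"
      proof (rule ccontr)
        assume "\<not> (\<exists>y\<in>S. x + 1 < y)"
        then have "S \<subseteq> {0..x + 1}" using S(1) by force
        then show False using False bounded_subset[OF bounded_closed_interval] by blast
      qed
      then show "\<exists>y. (y \<in> S \<and> (Suc n = 0 \<longrightarrow> y = s P)) \<and> x + 1 < y" by auto
    qed
    then show ?thesis by blast
  qed
  then obtain r where r0: "\<And>P. P \<in> G \<Longrightarrow> r P 0 = s P"
    and r: "\<And>P n. P \<in> G \<Longrightarrow> \<not> bounded S \<Longrightarrow> r P n \<in> S" "\<And>P n. P \<in> G \<Longrightarrow> \<not> bounded S \<Longrightarrow> r P n + 1 < r P (Suc n)"
    by metis
  have r_ge: "real n \<le> r P n" if "P \<in> G" "\<not> bounded S" for P n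
  proof (induction n)
    case 0
    then show ?case using r0 s that by (simp add: less_imp_le)
  next
    case (Suc n)
    then show ?case using r(2)[OF that, of n] by simp
  qed
  \<comment> \<open>An index at which \<open>t\<close> has dropped below the value of the member
    \<open>Q\<close>; the default 0 is for balls that are not members.\<close>
  define w where "w Q = (if Q \<in> G then SOME n. t n < s Q else 0)" for Q
  have w: "t (w Q) < s Q" if "Q \<in> G" for Q
  proof -
    have "\<exists>n. t n < s Q"
      using order_tendstoD(2)[OF t_lim s(2)[OF that]] eventually_happens trivial_limit_sequentially by blast
    then show ?thesis using that by (auto simp: w_def intro: someI_ex)
  qed
  define Z where "Z T = {Q \<in> nonsingleton_balls. Q \<subseteq> T \<and> (\<forall>P\<in>G. \<not> Q \<subset> P)}" for T
  \<comment> \<open>The summand 1 makes \<open>k\<close> strictly increase from an outer ball to its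
    parent, since the parent itself is newly counted. The summand \<open>w P\<close> gives
    \<open>k T > w P\<close> for every member \<open>P\<close> below \<open>T\<close>, hence
    \<open>t (k T) < t (w P) < s P\<close>.\<close>
  define k where "k T = (\<Sum>Q\<in>Z T. w Q + 1)" for T
  \<comment> \<open>\<open>P\<close> itself is not counted, so its depth is 0 and its value is
    \<open>r P 0 = s P\<close>.\<close>
  define depth where "depth P T = card {Q \<in> balls. T \<subseteq> Q \<and> Q \<subset> P}" for P T
  define outer where "outer T \<longleftrightarrow> T \<in> nonsingleton_balls \<and> (\<forall>P\<in>G. \<not> T \<subseteq> P)" for T
  define l where "l T = (if \<exists>P\<in>G. T \<subseteq> P then r (THE P. P \<in> G \<and> T \<subseteq> P) (depth (THE P. P \<in> G \<and> T \<subseteq> P) T)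
    else t (k T))" for T
  have Gb: "P \<in> balls" if "P \<in> G" for P using that G(1) nonsingletonD by blast
  have l_in: "l T = r P (depth P T)" if "P \<in> G" "T \<subseteq> P" "T \<in> balls" for P T
  proof -
    have "(THE P. P \<in> G \<and> T \<subseteq> P) = P"
    proof (rule the_equality)
      fix P' assume "P' \<in> G \<and> T \<subseteq> P'"
      then show "P' = P" using disj[of P' P] that ball_nonempty[OF that(3)] by blast
    qed (use that in auto)
    then show ?thesis using that by (auto simp: l_def)
  qed
  have l_out: "l T = t (k T)" if "outer T" for T using that by (auto simp: l_def outer_def)
  have l_G: "l P = s P" if "P \<in> G" for P
  proof -
    have "{Q \<in> balls. P \<subseteq> Q \<and> Q \<subset> P} = {}" by blast
    then have "depth P P = 0" unfolding depth_def by (simp only: card.empty)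
    then show ?thesis using l_in[OF that subset_refl Gb[OF that]] r0[OF that] by simp
  qed
  have depth_Suc: "depth P T = Suc (depth P (parent T))" if T: "T \<in> balls" and P: "P \<in> G" "T \<subset> P" for T P
  proof -
    have "{Q \<in> balls. T \<subseteq> Q \<and> Q \<subset> P} = insert T {Q \<in> balls. parent T \<subseteq> Q \<and> Q \<subset> P}"
      using T P psubset_parent[OF T] parent_least[OF T] by blast
    moreover have "finite {Q \<in> balls. parent T \<subseteq> Q \<and> Q \<subset> P}"
      by (rule finite_subset[OF _ finite_balls_between[OF parent_ball[OF T] Gb[OF P(1)]]]) auto
    moreover have "T \<notin> {Q \<in> balls. parent T \<subseteq> Q \<and> Q \<subset> P}" using psubset_parent[OF T] by blast
    ultimately show ?thesis by (simp add: depth_def)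
  qed
  have outer_up: "outer Q" if "outer T" "T \<subseteq> Q" "Q \<in> nonsingleton_balls" for T Q
    using that unfolding outer_def by blast
  have outer_parent_G: "outer (parent P)" if "P \<in> G" for P
  proof -
    have "\<not> parent P \<subseteq> P'" if "P' \<in> G" for P'
      using disj[of P P'] psubset_parent[OF Gb[OF \<open>P \<in> G\<close>]] ball_nonempty[OF Gb[OF \<open>P \<in> G\<close>]] \<open>P \<in> G\<close> that
      by blast
    then show ?thesis using parent_ns[OF Gb[OF that]] by (auto simp: outer_def)
  qed
  have finZ: "finite (Z T)" if "outer T" for T
    using assms(1) that unfolding Z_def outer_def separated_family_def by simp
  have k_parent: "k T < k (parent T)" if T: "outer T" for T
  proof -
    have Tb: "T \<in> balls" using T nonsingletonD by (auto simp: outer_def)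
    have op: "outer (parent T)"
      using outer_up[OF T _ parent_ns[OF Tb]] psubset_parent[OF Tb] by blast
    have "parent T \<in> Z (parent T) - Z T"
      using op psubset_parent[OF Tb] by (auto simp: Z_def outer_def)
    moreover have "Z T \<subseteq> Z (parent T)" using psubset_parent[OF Tb] by (auto simp: Z_def)
    ultimately show ?thesis unfolding k_def using finZ[OF op] by (intro sum_strict_mono2) auto
  qed
  have mono: "l (parent B) < l B" if B: "B \<in> nonsingleton_balls" for B
  proof (cases "outer B")
    case True
    have Bb: "B \<in> balls" using B by (rule nonsingletonD)
    have "outer (parent B)"
      using outer_up[OF True _ parent_ns[OF Bb]] psubset_parent[OF Bb] by blast
    then show ?thesis using l_out True t_less[OF k_parent[OF True]] by simp
  next
    case False
    have Bb: "B \<in> balls" using B by (rule nonsingletonD)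
    obtain P where P: "P \<in> G" "B \<subseteq> P" using False B by (auto simp: outer_def)
    show ?thesis
    proof (cases "B = P")
      case True
      have "P \<in> Z (parent P)"
        using P G(1) psubset_parent[OF Gb[OF P(1)]] disj[of P] ball_nonempty[OF Gb[OF P(1)]]
        unfolding Z_def by blast
      then have "w P + 1 \<le> k (parent P)"
        unfolding k_def by (rule member_le_sum) (simp_all add: finZ[OF outer_parent_G[OF P(1)]])
      then have "t (k (parent P)) < t (w P)" by (intro t_less) simp
      then show ?thesis
        using w[OF P(1)] l_out[OF outer_parent_G[OF P(1)]] l_G[OF P(1)] True by simp
    next
      case False
      then have BP: "B \<subset> P" "parent B \<subseteq> P" using P parent_least[OF Bb Gb[OF P(1)]] by blast+
      have "\<not> bounded S" using alt P(1) B BP by blast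
      then show ?thesis using r(2)[OF P(1), of "depth P (parent B)"] l_in[OF P Bb]
          l_in[OF P(1) BP(2) parent_ball[OF Bb]] depth_Suc[OF Bb P(1) BP(1)] by simp
    qed
  qed
  have lim_outer: "(\<lambda>n. l (ancestor B n)) \<longlonglongrightarrow> 0" if B: "outer B" for B
  proof -
    have Bn: "B \<in> nonsingleton_balls" "B \<in> balls"
      using B nonsingletonD by (auto simp: outer_def)
    have o: "outer (ancestor B n)" for n
      using outer_up[OF B ball_subset_ancestor[OF Bn(2)] ancestor_ns[OF Bn(1)]] .
    have "n \<le> k (ancestor B n)" for n
    proof (induction n)
      case (Suc n)
      then show ?case using k_parent[OF o[of n]] by simp
    qed simp
    then have le: "t (k (ancestor B n)) \<le> t n" for n
      using t_less[of n "k (ancestor B n)"] by (cases "n = k (ancestor B n)") (auto simp: less_imp_le le_less)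
    show ?thesis unfolding l_out[OF o]
      by (rule tendsto_sandwich[OF _ _ tendsto_const t_lim]) (auto simp: le t(2) less_imp_le)
  qed
  have lim: "(\<lambda>n. l (ancestor B n)) \<longlonglongrightarrow> 0" if B: "B \<in> nonsingleton_balls" for B
  proof -
    have Bb: "B \<in> balls" using B by (rule nonsingletonD)
    \<comment> \<open>\<open>B\<close> lies in at most one of two disjoint members. A ball
      containing both \<open>B\<close> and the parent of the other member is an outer ancestor of
      \<open>B\<close>, from which point on the limit is known.\<close>
    obtain P where P: "P \<in> G" "\<not> B \<subseteq> P"
    proof -
      obtain P P' where "P \<in> G" "P' \<in> G" "P \<noteq> P'"
        using G(2) by (metis finite.simps infinite_super insertI1 singletonI subsetI)
      then show thesis using that[of P] that[of P'] disj[of P P'] ball_nonempty[OF Bb] by blast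
    qed
    obtain Q where Q: "Q \<in> balls" "B \<subseteq> Q" "parent P \<subseteq> Q"
      by (rule ball_covering_two[OF Bb parent_ball[OF Gb[OF P(1)]]])
    obtain N where N: "Q = ancestor B N" using superball_is_ancestor[OF Bb Q(1,2)] by blast
    have "outer (ancestor B N)"
      using outer_up[OF outer_parent_G[OF P(1)] Q(3)] ancestor_ns[OF B] N by simp
    then have "(\<lambda>n. l (ancestor (ancestor B N) n)) \<longlonglongrightarrow> 0" by (rule lim_outer)
    then have "(\<lambda>n. l (ancestor B (n + N))) \<longlonglongrightarrow> 0" by (simp add: funpow_add)
    then show ?thesis by (rule LIMSEQ_offset)
  qed
  have blowup: "\<exists>B\<in>balls. x \<in> B \<and> (\<forall>Q\<in>nonsingleton_balls. x \<in> Q \<and> Q \<subseteq> B \<longrightarrow> K \<le> l Q)"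
    if x: "x \<in> M" "\<not> isolated_point mtopology x" for x K
  proof -
    have child: "\<exists>T\<in>balls. x \<in> T \<and> parent T = B" if "B \<in> balls" "x \<in> B" for B
      using point_in_child[OF nonsingleton_of_nonisolated[OF that x(2)] that(2)] by blast
    have "\<exists>B\<in>balls. x \<in> B \<and> (\<exists>P\<in>G. B \<subset> P)"
    proof -
      obtain T0 where T0: "T0 \<in> balls" "x \<in> T0" using mball_in_balls[OF x(1), of 1] x(1) by auto
      show ?thesis
      proof (cases "\<exists>P\<in>G. T0 \<subseteq> P")
        case True
        then show ?thesis using child[OF T0] psubset_parent by (metis psubset_subset_trans)
      next
        case False
        have ns: "T0 \<in> nonsingleton_balls" by (rule nonsingleton_of_nonisolated[OF T0 x(2)])
        show ?thesis
        proof (rule ccontr)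
          \<comment> \<open>Otherwise all balls around \<open>x\<close> inside \<open>T0\<close>
            belong to the finite set \<open>Z T0\<close>, so one of them is minimal. Its child
            around \<open>x\<close> is smaller and, as \<open>x\<close> is not isolated, again not a
            singleton.\<close>
          assume neg: "\<not> ?thesis"
          have "{Q \<in> nonsingleton_balls. x \<in> Q \<and> Q \<subseteq> T0} \<subseteq> Z T0"
            using neg nonsingletonD unfolding Z_def by blast
          moreover have "finite (Z T0)" using finZ ns False by (auto simp: outer_def)
          moreover have "T0 \<in> {Q \<in> nonsingleton_balls. x \<in> Q \<and> Q \<subseteq> T0}" using ns T0 by blast
          ultimately obtain B where B: "B \<in> {Q \<in> nonsingleton_balls. x \<in> Q \<and> Q \<subseteq> T0}"
            "\<And>Q. Q \<in> {Q \<in> nonsingleton_balls. x \<in> Q \<and> Q \<subseteq> T0} \<Longrightarrow> Q \<subseteq> B \<Longrightarrow> Q = B"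
            using finite_has_minimal[of "{Q \<in> nonsingleton_balls. x \<in> Q \<and> Q \<subseteq> T0}"] finite_subset
            by (metis (no_types, lifting) empty_iff)
          then obtain T where T: "T \<in> balls" "x \<in> T" "parent T = B"
            using child[of B] nonsingletonD by blast
          then have "T \<subset> B" using psubset_parent by blast
          moreover have "T \<in> nonsingleton_balls"
            by (rule nonsingleton_of_nonisolated[OF T(1,2) x(2)])
          ultimately show False using B(1) B(2)[of T] T(2) by blast
        qed
      qed
    qed
    then obtain B P where B: "B \<in> balls" "x \<in> B" "P \<in> G" "B \<subset> P" by blast
    have unb: "\<not> bounded S" using alt B nonsingleton_of_nonisolated[OF B(1,2) x(2)] by blast
    have deep: "\<exists>B\<in>balls. x \<in> B \<and> B \<subset> P \<and> n \<le> depth P B" for n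
    proof (induction n)
      case 0
      then show ?case using B by blast
    next
      case (Suc n)
      then obtain B where B: "B \<in> balls" "x \<in> B" "B \<subset> P" "n \<le> depth P B" by blast
      then obtain T where T: "T \<in> balls" "x \<in> T" "parent T = B" using child by blast
      then have "T \<subset> P" using B(3) psubset_parent by blast
      then show ?case using T B(4) depth_Suc[OF T(1) \<open>P \<in> G\<close>] by (intro bexI[OF _ T(1)]) auto
    qed
    obtain n where n: "K \<le> real n" using real_arch_simple by blast
    obtain B' where B': "B' \<in> balls" "x \<in> B'" "B' \<subset> P" "n \<le> depth P B'" using deep by blast
    have "K \<le> l Q" if Q: "Q \<in> nonsingleton_balls" "x \<in> Q" "Q \<subseteq> B'" for Q
    proof -
      have Qb: "Q \<in> balls" by (rule nonsingletonD[OF Q(1)])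
      have "finite {R \<in> balls. Q \<subseteq> R \<and> R \<subset> P}"
        by (rule finite_subset[OF _ finite_balls_between[OF Qb Gb[OF B(3)]]]) auto
      then have "depth P B' \<le> depth P Q"
        unfolding depth_def using Q(3) by (intro card_mono) auto
      then have "K \<le> real (depth P Q)" using n B'(4) by linarith
      also have "\<dots> \<le> l Q" using r_ge[OF B(3) unb] l_in[OF B(3) _ Qb] Q(3) B'(3) by auto
      finally show ?thesis .
    qed
    then show ?thesis using B' by blast
  qed
  have "l T \<in> S" if T: "T \<in> nonsingleton_balls" for T
  proof (cases "outer T")
    case True
    then show ?thesis using l_out t(1) by simp
  next
    case False
    then obtain P where P: "P \<in> G" "T \<subseteq> P" using T by (auto simp: outer_def)
    show ?thesis
    proof (cases "T = P")
      case True
      then show ?thesis using l_G[OF P(1)] s[OF P(1)] by simp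
    next
      case False
      then have "\<not> bounded S" using alt P T by blast
      then show ?thesis using l_in[OF P nonsingletonD[OF T]] r(1)[OF P(1)] by simp
    qed
  qed
  then have sub: "l ` nonsingleton_balls \<subseteq> S" by blast
  have "D \<subseteq> l ` nonsingleton_balls" using sG l_G G(1) by force
  then have "closure D \<subseteq> closure (l ` nonsingleton_balls)" by (rule closure_mono)
  moreover have "S \<subseteq> closure (S - {0})"
  proof
    fix y assume "y \<in> S"
    show "y \<in> closure (S - {0})"
    proof (cases "y = 0")
      case True
      have "0 islimpt (S - {0})" using S(2) by (simp add: islimpt_def) blast
      then show ?thesis using True by (simp add: closure_def)
    next
      case False
      then show ?thesis using \<open>y \<in> S\<close> by (intro closure_subset[THEN subsetD]) simp
    qed
  qed
  moreover have "closure (S - {0}) \<subseteq> closure D" using D(3) by (rule closure_minimal) simp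
  ultimately have dense: "S \<subseteq> closure (l ` nonsingleton_balls)" by simp
  have "spectral_function l" unfolding spectral_function_def using mono lim blowup by simp
  then show ?thesis using sub dense by blast
qed

section \<open>Separated families obtained from a partition\<close>

lemma finite_ball_of_isolated:
  assumes "\<And>x. x \<in> M \<Longrightarrow> isolated_point mtopology x" "B \<in> balls"
  shows "finite B"
proof -
  have "\<exists>F. finite F \<and> F \<subseteq> (\<lambda>x. {x}) ` B \<and> B \<subseteq> \<Union>F"
  proof (rule compactinD[OF compactin_ball[OF assms(2)]])
    show "openin mtopology U" if "U \<in> (\<lambda>x. {x}) ` B" for U
      using that assms(1) ball_subset[OF assms(2)] by (auto simp: isolated_point_def)
  qed auto
  then obtain F where F: "finite F" "F \<subseteq> (\<lambda>x. {x}) ` B" "B \<subseteq> \<Union>F" by blast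
  then have "finite (\<Union>F)" by (intro finite_Union) auto
  then show ?thesis using F(3) finite_subset by blast
qed

text \<open>A ball of this kind is not strictly inside any class, so by nesting it is a union of
  classes. Compactness of \<open>T\<close> leaves only finitely many classes inside
  \<open>T\<close>, hence finitely many such unions.\<close>

lemma partition_family:
  assumes P: "partition_on M P" "P \<subseteq> balls"
    and T: "T \<in> nonsingleton_balls" "\<forall>R\<in>P \<inter> nonsingleton_balls. \<not> T \<subseteq> R"
  shows "finite {Q \<in> nonsingleton_balls. Q \<subseteq> T \<and> (\<forall>R\<in>P \<inter> nonsingleton_balls. \<not> Q \<subset> R)}"
    (is "finite ?Z")
proof -
  have Tb: "T \<in> balls" by (rule nonsingletonD[OF T(1)])
  have cover: "\<Union>P = M" and disj: "\<And>A B. \<lbrakk>A \<in> P; B \<in> P; A \<inter> B \<noteq> {}\<rbrakk> \<Longrightarrow> A = B"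
    using P(1) by (auto simp: partition_on_def disjoint_def)
  \<comment> \<open>A class that properly contains a ball is not a singleton, so the condition on
    non-singleton classes controls all classes.\<close>
  have strict: "R \<in> nonsingleton_balls" if "R \<in> P" "Q \<in> balls" "Q \<subset> R" for Q R
    using psupset_ball_nonsingleton[of Q R] that P(2) by blast
  have "\<exists>F. finite F \<and> F \<subseteq> P \<and> T \<subseteq> \<Union>F"
  proof (rule compactinD[OF compactin_ball[OF Tb]])
    show "T \<subseteq> \<Union>P" using ball_subset[OF Tb] cover by simp
  qed (use P(2) openin_ball in blast)
  then obtain F where F: "finite F" "F \<subseteq> P" "T \<subseteq> \<Union>F" by blast
  have inside: "{R \<in> P. R \<subseteq> T} \<subseteq> F"
  proof clarify
    fix R assume R: "R \<in> P" "R \<subseteq> T"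
    then obtain x where x: "x \<in> R" using ball_nonempty P(2) by blast
    then obtain R' where "R' \<in> F" "x \<in> R'" using F(3) R by blast
    then show "R \<in> F" using disj[of R R'] R(1) F(2) x by blast
  qed
  have Q_eq: "Q = \<Union>{R \<in> P. R \<subseteq> Q}" if Q: "Q \<in> ?Z" for Q
  proof (intro subset_antisym subsetI)
    fix x assume x: "x \<in> Q"
    have Qb: "Q \<in> balls" using Q nonsingletonD by blast
    then obtain R where R: "R \<in> P" "x \<in> R" using x cover ball_subset[OF Qb] by blast
    have "R \<subseteq> Q"
    proof (rule ccontr)
      assume "\<not> R \<subseteq> Q"
      then have "Q \<subset> R" using balls_nested[of Q R] Qb R P(2) x by blast
      then show False using strict[OF R(1) Qb] R(1) Q by blast
    qed
    then show "x \<in> \<Union>{R \<in> P. R \<subseteq> Q}" using R by blast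
  qed auto
  have "inj_on (\<lambda>Q. {R \<in> P. R \<subseteq> Q}) ?Z"
  proof (rule inj_onI)
    fix Q Q' assume "Q \<in> ?Z" "Q' \<in> ?Z" "{R \<in> P. R \<subseteq> Q} = {R \<in> P. R \<subseteq> Q'}"
    then show "Q = Q'" using Q_eq[of Q] Q_eq[of Q'] by simp
  qed
  moreover have "(\<lambda>Q. {R \<in> P. R \<subseteq> Q}) ` ?Z \<subseteq> Pow F" using inside by auto
  ultimately show ?thesis using F(1) by (meson finite_Pow_iff finite_imageD finite_subset)
qed

text \<open>If there is a non-isolated point, \<open>S\<close> is unbounded and the non-singleton
  classes can serve as the family. In a discrete space \<open>S\<close> may be bounded, leaving no
  values for balls inside a member; there all balls are finite, so each non-singleton class contains
  a minimal non-singleton ball, and these minimal balls form the family.\<close>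

lemma spectral_family_exists:
  fixes S :: "real set"
  assumes sep: "separable_space mtopology"
    and P: "partition_on M P" "P \<subseteq> balls" "infinite (P \<inter> nonsingleton_balls)"
    and S: "S \<subseteq> {0..}" "0 islimpt S" "(\<exists>x\<in>M. \<not> isolated_point mtopology x) \<longrightarrow> \<not> bounded S"
  obtains C where "choice_function C" "choice_lambda C ` nonsingleton_balls \<subseteq> S"
    "S \<subseteq> closure (choice_lambda C ` nonsingleton_balls)"
proof -
  have disjP: "A = B" if "A \<in> P" "B \<in> P" "A \<inter> B \<noteq> {}" for A B
    using P(1) that by (auto simp: partition_on_def disjoint_def)
  have "\<exists>G. separated_family G \<and> ((\<forall>P\<in>G. \<forall>Q\<in>nonsingleton_balls. \<not> Q \<subset> P) \<or> \<not> bounded S)"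
  proof (cases "\<exists>x\<in>M. \<not> isolated_point mtopology x")
    case True
    then show ?thesis
      using S(3) P disjP partition_family[OF P(1,2)] unfolding separated_family_def
      by (intro exI[of _ "P \<inter> nonsingleton_balls"]) auto
  next
    case False
    then have fin: "finite B" if "B \<in> balls" for B
      using finite_ball_of_isolated[OF _ that] by blast
    define G where "G = {Q \<in> nonsingleton_balls. \<forall>R\<in>nonsingleton_balls. \<not> R \<subset> Q}"
    have "\<exists>Q\<in>G. Q \<subseteq> R" if R: "R \<in> P \<inter> nonsingleton_balls" for R
    proof -
      have "finite {Q \<in> nonsingleton_balls. Q \<subseteq> R}"
        by (rule finite_subset[of _ "Pow R"]) (use R fin nonsingletonD in auto)
      moreover have "R \<in> {Q \<in> nonsingleton_balls. Q \<subseteq> R}" using R by blast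
      ultimately obtain Q where Q: "Q \<in> {Q \<in> nonsingleton_balls. Q \<subseteq> R}"
        "\<forall>Q'\<in>{Q \<in> nonsingleton_balls. Q \<subseteq> R}. Q' \<subseteq> Q \<longrightarrow> Q = Q'"
        using finite_has_minimal[of "{Q \<in> nonsingleton_balls. Q \<subseteq> R}"] by blast
      then show ?thesis by (intro bexI[of _ Q]) (auto simp: G_def)
    qed
    then obtain q where q: "\<And>R. R \<in> P \<inter> nonsingleton_balls \<Longrightarrow> q R \<in> G \<and> q R \<subseteq> R" by metis
    have Gb: "Q \<in> balls" if "Q \<in> G" for Q using that nonsingletonD by (auto simp: G_def)
    have "inj_on q (P \<inter> nonsingleton_balls)"
    proof (rule inj_onI)
      fix A B assume AB: "A \<in> P \<inter> nonsingleton_balls" "B \<in> P \<inter> nonsingleton_balls" "q A = q B"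
      then have "q A \<subseteq> A \<inter> B" "q A \<noteq> {}" using q[of A] q[of B] ball_nonempty Gb by auto
      then show "A = B" using disjP[of A B] AB by blast
    qed
    then have "infinite (q ` (P \<inter> nonsingleton_balls))" using P(3) finite_imageD by blast
    moreover have "q ` (P \<inter> nonsingleton_balls) \<subseteq> G" using q by blast
    ultimately have "infinite G" using finite_subset by blast
    moreover have "\<forall>A\<in>G. \<forall>B\<in>G. A \<inter> B \<noteq> {} \<longrightarrow> A = B"
    proof (intro ballI impI)
      fix A B assume AB: "A \<in> G" "B \<in> G" "A \<inter> B \<noteq> {}"
      then have "A \<subseteq> B \<or> B \<subseteq> A" by (intro balls_nested Gb)
      then show "A = B" using AB unfolding G_def by blast
    qed
    moreover have "finite {Q \<in> nonsingleton_balls. Q \<subseteq> T \<and> (\<forall>P\<in>G. \<not> Q \<subset> P)}"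
      if "T \<in> nonsingleton_balls" for T
      by (rule finite_subset[of _ "Pow T"]) (use that fin nonsingletonD in auto)
    moreover have "G \<subseteq> nonsingleton_balls" "\<forall>P\<in>G. \<forall>Q\<in>nonsingleton_balls. \<not> Q \<subset> P"
      by (auto simp: G_def)
    ultimately show ?thesis unfolding separated_family_def by (intro exI[of _ G]) simp
  qed
  then obtain G where G: "separated_family G"
    and alt: "(\<forall>P\<in>G. \<forall>Q\<in>nonsingleton_balls. \<not> Q \<subset> P) \<or> \<not> bounded S"
    by (elim exE conjE) (rule that)
  have "countable G"
  proof (rule countable_subset[OF _ countable_balls[OF sep]])
    have "G \<subseteq> nonsingleton_balls" using G by (simp add: separated_family_def)
    then show "G \<subseteq> balls" using nonsingletonD by blast
  qed
  obtain l where l: "spectral_function l" "l ` nonsingleton_balls \<subseteq> S"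
    "S \<subseteq> closure (l ` nonsingleton_balls)"
    using spectral_function_exists[OF G \<open>countable G\<close> S(1,2) alt] by blast
  obtain C where C: "choice_function C" "\<forall>B\<in>nonsingleton_balls. choice_lambda C B = l B"
    using choice_function_exists[OF l(1)] by blast
  have "choice_lambda C ` nonsingleton_balls = l ` nonsingleton_balls"
    using C(2) by (intro image_cong) auto
  then show thesis using that[OF C(1)] l(2,3) by simp
qed

end

theorem (in proper_ultrametric_measure) choice_with_spectrum_exists:
  assumes P: "partition_on M P" "P \<subseteq> balls" "infinite (P \<inter> nonsingleton_balls)"
    and S: "S \<subseteq> {0..}" "closed S" "0 islimpt S" "(\<exists>x\<in>M. \<not> isolated_point mtopology x) \<longrightarrow> \<not> bounded S"
  shows "\<exists>C. choice_function C \<and> op_spectrum m (hier_Laplacian m C) = complex_of_real ` S"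
proof -
  obtain C where C: "choice_function C" "choice_lambda C ` nonsingleton_balls \<subseteq> S"
    "S \<subseteq> closure (choice_lambda C ` nonsingleton_balls)"
    by (rule spectral_family_exists[OF separable P S(1,3,4)])
  interpret hierarchical_laplacian M d m C
    by unfold_locales (rule C(1))
  have "0 \<in> S" using S(2,3) closed_limpt by blast
  then show ?thesis using op_spectrum_hier_Laplacian[OF S(2) _ C(2,3)] C(1) by blast
qed

section \<open>A proper ultrametric with the same topology\<close>

context Ultrametric_space
begin

text \<open>Around each point the balls of small radius are compact by local compactness, and each
  such ball can be recentred at a point of a countable dense set. Taking only the radii 1/(n+1)
  leaves countably many.\<close>

lemma countable_compact_cover:
  assumes "locally_compact_space mtopology" "separable_space mtopology"
  obtains V where "countable V" "V \<subseteq> {B \<in> balls. compactin mtopology B}" "\<Union>V = M"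
proof -
  obtain D where D: "countable D" "D \<subseteq> M" "mtopology closure_of D = M"
    using assms(2) unfolding separable_space_def by auto
  define W where "W = {B. compactin mtopology B} \<inter> (\<Union>q\<in>D. range (\<lambda>n. mball q (1 / real (Suc n))))"
  have "M \<subseteq> \<Union>W"
  proof
    fix x assume x: "x \<in> M"
    obtain U K where U: "openin mtopology U" "compactin mtopology K" "x \<in> U" "U \<subseteq> K"
      using assms(1) x unfolding locally_compact_space_def topspace_mtopology by blast
    then obtain r where r: "0 < r" "mball x r \<subseteq> U" unfolding openin_mtopology by blast
    obtain n where n: "1 / real (Suc n) < r" using r(1) nat_approx_posE by blast
    let ?B = "mball x (1 / real (Suc n))"
    have B: "?B \<in> balls" "x \<in> ?B" using x by (auto intro: mball_in_balls)
    have "\<forall>T. openin mtopology T \<and> T \<noteq> {} \<longrightarrow> D \<inter> T \<noteq> {}"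
      using D(3) dense_intersects_open[of mtopology D] by simp
    then have "D \<inter> ?B \<noteq> {}" using openin_ball[OF B(1)] ball_nonempty[OF B(1)] by blast
    then obtain q where q: "q \<in> D" "q \<in> ?B" by blast
    then have eq: "mball q (1 / real (Suc n)) = ?B" by (intro mball_eq_of_mem)
    have "?B \<subseteq> K" using mball_subset_concentric[of "1 / real (Suc n)" r x] n r(2) U(4) by auto
    then have "compactin mtopology ?B"
      using closed_compactin[OF U(2) _ closedin_ball[OF B(1)]] by blast
    then have "?B \<in> W" unfolding W_def using q(1) eq by blast
    then show "x \<in> \<Union>W" using B(2) by blast
  qed
  moreover have "W \<subseteq> {B \<in> balls. compactin mtopology B}"
    unfolding W_def using D(2) by (auto intro!: mball_in_balls)
  moreover have "countable W" unfolding W_def using D(1) by auto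
  ultimately show thesis using that[of W] ball_subset by blast
qed

text \<open>Assigning to each point the first ball of a countable compact cover that contains it
  gives disjoint compact open fibres. Infinitely many are non-empty, as \<open>M\<close> is not
  compact, so they can be merged in pairs; this guarantees two points in each class.\<close>

lemma compact_open_fibres:
  assumes "locally_compact_space mtopology" "separable_space mtopology" "\<not> compact_space mtopology"
  obtains g :: "'a \<Rightarrow> nat" where
    "\<And>n. compactin mtopology {x \<in> M. g x = n}" "\<And>n. openin mtopology {x \<in> M. g x = n}"
    "\<And>n. \<exists>x\<in>M. \<exists>y\<in>M. g x = n \<and> g y = n \<and> x \<noteq> y"
proof -
  obtain W where W: "countable W" "W \<subseteq> {B \<in> balls. compactin mtopology B}" "\<Union>W = M"
    by (rule countable_compact_cover[OF assms(1,2)])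
  have "M \<noteq> {}" using assms(3) by (auto simp: compact_space_def)
  then have "W \<noteq> {}" using W(3) by blast
  define V where "V = from_nat_into W"
  have V: "V n \<in> balls" "compactin mtopology (V n)" for n
    using from_nat_into[OF \<open>W \<noteq> {}\<close>, of n] W(2) by (auto simp: V_def)
  have cover: "\<exists>n. x \<in> V n" if "x \<in> M" for x
    using that W(3) range_from_nat_into[OF \<open>W \<noteq> {}\<close> W(1)] unfolding V_def by blast
  define idx where "idx x = (LEAST n. x \<in> V n)" for x
  have idx: "x \<in> V (idx x)" if "x \<in> M" for x
    unfolding idx_def using cover[OF that] by (rule LeastI_ex)
  have idx_fibre: "{x \<in> M. idx x = n} = V n - (\<Union>k<n. V k)" for n
  proof (intro subset_antisym subsetI)
    fix x assume x: "x \<in> {x \<in> M. idx x = n}"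
    have "x \<notin> V k" if "k < n" for k
      using x that not_less_Least[of k "\<lambda>n. x \<in> V n"] unfolding idx_def by blast
    then show "x \<in> V n - (\<Union>k<n. V k)" using x idx[of x] by blast
  next
    fix x assume x: "x \<in> V n - (\<Union>k<n. V k)"
    then have "idx x = n"
      unfolding idx_def by (intro Least_equality) (blast, use not_less in blast)
    then show "x \<in> {x \<in> M. idx x = n}" using x ball_subset[OF V(1)[of n]] by auto
  qed
  have fib_open: "openin mtopology {x \<in> M. idx x = n}" for n unfolding idx_fibre using V(1)
    by (intro openin_diff closedin_Union openin_ball) (auto intro: closedin_ball)
  have fib_compact: "compactin mtopology {x \<in> M. idx x = n}" for n
  proof (rule closed_compactin[OF V(2)[of n]])
    show "closedin mtopology {x \<in> M. idx x = n}" unfolding idx_fibre using V(1)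
      by (intro closedin_diff openin_Union closedin_ball) (auto intro: openin_ball)
  qed (auto simp: idx_fibre)
  define J where "J = idx ` M"
  have "infinite J"
  proof
    assume fin: "finite J"
    have "compactin mtopology (\<Union>n\<in>J. V n)" using fin V(2) by (intro compactin_Union) auto
    moreover have "(\<Union>n\<in>J. V n) = M" using idx ball_subset[OF V(1)] unfolding J_def by blast
    ultimately show False using assms(3) by (simp add: compact_space_def)
  qed
  \<comment> \<open>The non-empty fibres are renumbered by all natural numbers, and those numbered
    2n and 2n+1 are joined.\<close>
  define g where "g x = to_nat_on J (idx x) div 2" for x
  let ?j = "from_nat_into J"
  have cJ: "countable J" by simp
  have Jm: "?j i \<in> J" for i using \<open>infinite J\<close> by (intro from_nat_into) auto
  have to_j: "to_nat_on J (?j i) = i" for i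
    using to_nat_on_from_nat_into_infinite[OF cJ \<open>infinite J\<close>] .
  have g_iff: "g x = n \<longleftrightarrow> idx x = ?j (2 * n) \<or> idx x = ?j (2 * n + 1)" if "x \<in> M" for x n
  proof -
    have "idx x \<in> J" using that by (simp add: J_def)
    then have "idx x = ?j i \<longleftrightarrow> to_nat_on J (idx x) = i" for i
      using to_j from_nat_into_to_nat_on[OF cJ] by metis
    then show ?thesis unfolding g_def by (simp only:) presburger
  qed
  have fibre: "{x \<in> M. g x = n} = {x \<in> M. idx x = ?j (2 * n)} \<union> {x \<in> M. idx x = ?j (2 * n + 1)}" for n
    using g_iff by blast
  show thesis
  proof (rule that[of g])
    show "compactin mtopology {x \<in> M. g x = n}" for n
      unfolding fibre by (intro compactin_Un fib_compact)
    show "openin mtopology {x \<in> M. g x = n}" for n unfolding fibre by (intro openin_Un fib_open)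
    show "\<exists>x\<in>M. \<exists>y\<in>M. g x = n \<and> g y = n \<and> x \<noteq> y" for n
    proof -
      obtain x y where xy: "x \<in> M" "?j (2 * n) = idx x" "y \<in> M" "?j (2 * n + 1) = idx y"
        using Jm[of "2 * n"] Jm[of "2 * n + 1"] unfolding J_def by blast
      have "?j (2 * n) \<noteq> ?j (2 * n + 1)" using to_j[of "2 * n"] to_j[of "2 * n + 1"] by auto
      then show ?thesis using xy g_iff[of x n] g_iff[of y n] by metis
    qed
  qed
qed

text \<open>Inside a fibre the distance is capped at 1, while different fibres are at distance at
  least 2, so no detour through another fibre is shorter. Using the larger label keeps the
  ultrametric inequality and leaves only finitely many fibres within a bounded distance.\<close>

definition fibre_dist :: "('a \<Rightarrow> nat) \<Rightarrow> 'a \<Rightarrow> 'a \<Rightarrow> real" where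
  "fibre_dist g x y = (if g x = g y then min (d x y) 1 else 1 + real (max (g x) (g y)))"

lemma fibre_dist_ultrametric: "Ultrametric_space M (fibre_dist g)"
proof -
  have ul: "fibre_dist g x z \<le> max (fibre_dist g x y) (fibre_dist g y z)"
    if "x \<in> M" "y \<in> M" "z \<in> M" for x y z
    using ultra[OF that] by (auto simp: fibre_dist_def min_def max_def split: if_splits)
  have nonneg': "0 \<le> fibre_dist g x y" for x y by (auto simp: fibre_dist_def)
  show ?thesis
  proof
    show "fibre_dist g x y = fibre_dist g y x" for x y
      by (simp add: fibre_dist_def commute max.commute)
    show "fibre_dist g x y = 0 \<longleftrightarrow> x = y" if "x \<in> M" "y \<in> M" for x y
      using that by (auto simp: fibre_dist_def min_def split: if_splits)
    show "fibre_dist g x z \<le> fibre_dist g x y + fibre_dist g y z" if "x \<in> M" "y \<in> M" "z \<in> M" for x y z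
      using ul[OF that] nonneg'[of x y] nonneg'[of y z] by linarith
  qed (use ul nonneg' in auto)
qed

text \<open>Both metrics have the same small balls: an open fibre contains a \<open>d\<close>-ball
  around each of its points, and distance below 1 in the new metric implies the same fibre and
  equality of the two distances.\<close>

lemma mtopology_fibre_dist:
  assumes "\<And>n. openin mtopology {x \<in> M. g x = n}"
  shows "Metric_space.mtopology M (fibre_dist g) = mtopology"
proof -
  interpret D: Ultrametric_space M "fibre_dist g"
    by (rule fibre_dist_ultrametric)
  have in_D: "\<exists>s>0. mball x s \<subseteq> D.mball x r" if x: "x \<in> M" and "r > 0" for x r
  proof -
    obtain s where s: "0 < s" "mball x s \<subseteq> {y \<in> M. g y = g x}"
      using assms[of "g x"] x unfolding openin_mtopology by blast
    have "mball x (min s r) \<subseteq> D.mball x r"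
    proof
      fix y assume y: "y \<in> mball x (min s r)"
      then have "y \<in> mball x s" by auto
      then have "g y = g x" using s(2) by blast
      then show "y \<in> D.mball x r" using y by (auto simp: fibre_dist_def)
    qed
    then show ?thesis using s(1) \<open>r > 0\<close> by (intro exI[of _ "min s r"]) auto
  qed
  have D_in: "\<exists>s>0. D.mball x s \<subseteq> mball x r" if "r > 0" for x r
  proof (intro exI[of _ "min r 1"] conjI subsetI)
    fix y assume "y \<in> D.mball x (min r 1)"
    then show "y \<in> mball x r" by (auto simp: fibre_dist_def min_def split: if_splits)
  qed (use that in auto)
  have "openin D.mtopology U \<longleftrightarrow> openin mtopology U" for U
  proof
    assume U: "openin D.mtopology U"
    show "openin mtopology U" unfolding openin_mtopology
    proof (intro conjI allI impI)
      show "U \<subseteq> M" using U unfolding D.openin_mtopology by blast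
      fix x assume "x \<in> U"
      then obtain r where "0 < r" "D.mball x r \<subseteq> U"
        using U unfolding D.openin_mtopology by blast
      then show "\<exists>r>0. mball x r \<subseteq> U" using in_D[of x r] \<open>x \<in> U\<close> \<open>U \<subseteq> M\<close> by blast
    qed
  next
    assume U: "openin mtopology U"
    show "openin D.mtopology U" unfolding D.openin_mtopology
    proof (intro conjI allI impI)
      show "U \<subseteq> M" using U unfolding openin_mtopology by blast
      fix x assume "x \<in> U"
      then obtain r where "0 < r" "mball x r \<subseteq> U" using U unfolding openin_mtopology by blast
      then show "\<exists>r>0. D.mball x r \<subseteq> U" using D_in[of r x] by blast
    qed
  qed
  then show ?thesis by (simp add: topology_eq)
qed

lemma proper_fibre_dist:
  assumes "\<And>n. openin mtopology {x \<in> M. g x = n}" "\<And>n. compactin mtopology {x \<in> M. g x = n}"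
  shows "Metric_space.proper_metric M (fibre_dist g)"
proof -
  interpret D: Ultrametric_space M "fibre_dist g"
    by (rule fibre_dist_ultrametric)
  have top: "D.mtopology = mtopology" by (rule mtopology_fibre_dist[OF assms(1)])
  show ?thesis unfolding D.proper_metric_def
  proof (intro ballI allI)
    fix x and r :: real
    assume "x \<in> M"
    \<comment> \<open>If \<open>y\<close> lies in another fibre within distance \<open>r\<close>,
      then \<open>1 + g y\<close> is at most \<open>r\<close>; the summand \<open>g x\<close> covers
      the fibre of the centre.\<close>
    define N where "N = g x + nat \<lceil>r\<rceil>"
    have "compactin D.mtopology (\<Union>n\<le>N. {x \<in> M. g x = n})"
      unfolding top by (intro compactin_Union) (auto intro: assms(2))
    moreover have "D.mcball x r \<subseteq> (\<Union>n\<le>N. {x \<in> M. g x = n})"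
    proof
      fix y assume y: "y \<in> D.mcball x r"
      have "g y \<le> N"
      proof (cases "g x = g y")
        case False
        then have "real (g y) \<le> r" using y by (auto simp: fibre_dist_def)
        then show ?thesis unfolding N_def by linarith
      qed (simp add: N_def)
      then show "y \<in> (\<Union>n\<le>N. {x \<in> M. g x = n})" using y by auto
    qed
    ultimately show "compactin D.mtopology (D.mcball x r)"
      by (rule closed_compactin) (rule D.closedin_mcball)
  qed
qed

lemma fibre_partition:
  fixes g :: "'a \<Rightarrow> nat"
  assumes "\<And>n. \<exists>x\<in>M. \<exists>y\<in>M. g x = n \<and> g y = n \<and> x \<noteq> y"
  defines "P \<equiv> range (\<lambda>n. {x \<in> M. g x = n})"
  shows "partition_on M P" "P \<subseteq> Metric_space.balls M (fibre_dist g)"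
    "infinite (P \<inter> Metric_space.nonsingleton_balls M (fibre_dist g))"
proof -
  interpret D: Ultrametric_space M "fibre_dist g"
    by (rule fibre_dist_ultrametric)
  show "partition_on M P"
    unfolding P_def partition_on_def disjoint_def using assms(1) by fastforce
  have ball: "{x \<in> M. g x = n} \<in> D.balls" for n
  proof -
    obtain x where x: "x \<in> M" "g x = n" using assms(1) by blast
    \<comment> \<open>Any radius above 1 and at most 2 separates distances inside a fibre from those
      across fibres.\<close>
    have "{x \<in> M. g x = n} = D.mball x (3 / 2)"
    proof (rule set_eqI)
      fix y
      have "g y = n \<longleftrightarrow> fibre_dist g x y < 3 / 2"
      proof (cases "g y = n")
        case False
        then have "2 \<le> fibre_dist g x y" using x by (simp add: fibre_dist_def)
        then show ?thesis using False by simp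
      qed (use x in \<open>simp add: fibre_dist_def\<close>)
      then show "y \<in> {x \<in> M. g x = n} \<longleftrightarrow> y \<in> D.mball x (3 / 2)" using x by simp
    qed
    then show ?thesis using D.mball_in_balls[OF x(1), of "3 / 2"] by simp
  qed
  then show "P \<subseteq> D.balls" by (auto simp: P_def)
  have "\<not> is_singleton {x \<in> M. g x = n}" for n
  proof
    assume "is_singleton {x \<in> M. g x = n}"
    then obtain z where z: "{x \<in> M. g x = n} = {z}" by (auto simp: is_singleton_def)
    obtain x y where "x \<in> {x \<in> M. g x = n}" "y \<in> {x \<in> M. g x = n}" "x \<noteq> y"
      using assms(1)[of n] by blast
    then show False unfolding z by simp
  qed
  then have "P \<inter> D.nonsingleton_balls = P"
    using ball by (auto simp: P_def D.nonsingleton_balls_def)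
  moreover have "inj (\<lambda>n. {x \<in> M. g x = n})"
  proof (rule injI)
    fix i j assume eq: "{x \<in> M. g x = i} = {x \<in> M. g x = j}"
    obtain x where "x \<in> M" "g x = i" using assms(1) by blast
    then show "i = j" using eq by blast
  qed
  then have "infinite P" unfolding P_def by (simp add: finite_image_iff)
  ultimately show "infinite (P \<inter> D.nonsingleton_balls)" by simp
qed

section \<open>Positivity of the measure on open sets, and the final assembly\<close>

lemma mdiameter_ball_pos:
  assumes "B \<in> balls" "x \<in> B" "y \<in> B" "x \<noteq> y"
  shows "0 < mdiameter B"
proof -
  obtain r where r: "0 < r" "B = mball x r" by (rule ball_recentre[OF assms(1,2)])
  have "d a b \<le> r" if "a \<in> B" "b \<in> B" for a b
    using ultra[of a x b] that unfolding r by (auto simp: commute[of a])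
  then have "bdd_above ((\<lambda>p. d (fst p) (snd p)) ` (B \<times> B))" by (intro bdd_aboveI[of _ r]) auto
  then have "d x y \<le> mdiameter B" unfolding mdiameter_def using assms(2,3)
    by (intro cSUP_upper2[of "(\<lambda>p. d (fst p) (snd p))" _ "(x, y)"]) auto
  moreover have "0 < d x y" using assms ball_subset[OF assms(1)] by (intro mdist_pos_less) auto
  ultimately show ?thesis by simp
qed

text \<open>A non-empty open set contains a ball. If it is a singleton, its point is isolated and
  has positive mass; otherwise the ball has positive diameter.\<close>

lemma open_measure_pos:
  assumes sets: "\<And>U. openin mtopology U \<Longrightarrow> U \<in> sets m"
    and pos: "\<And>B. \<lbrakk>B \<in> balls; 0 < mdiameter B\<rbrakk> \<Longrightarrow> 0 < emeasure m B"
    and atoms: "\<And>x. \<lbrakk>x \<in> M; isolated_point mtopology x\<rbrakk> \<Longrightarrow> emeasure m {x} \<noteq> 0"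
    and U: "openin mtopology U" "U \<noteq> {}"
  shows "0 < emeasure m U"
proof -
  obtain x B where B: "B \<in> balls" "x \<in> B" "B \<subseteq> U" using U unfolding openin_iff_balls by blast
  have xM: "x \<in> M" using B ball_subset by blast
  have "0 < emeasure m B"
  proof (cases "B = {x}")
    case True
    then have "isolated_point mtopology x"
      using openin_ball[OF B(1)] xM by (simp add: isolated_point_def)
    then show ?thesis using atoms[OF xM] True by (simp add: zero_less_iff_neq_zero)
  next
    case False
    then obtain y where "y \<in> B" "x \<noteq> y" using B(2) by blast
    then show ?thesis by (intro pos B(1) mdiameter_ball_pos[OF B(1,2)])
  qed
  also have "\<dots> \<le> emeasure m U" by (rule emeasure_mono[OF B(3) sets[OF U(1)]])
  finally show ?thesis .
qed

end

theorem theorem1p2: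
  fixes M :: "'a set" and d :: "'a \<Rightarrow> 'a \<Rightarrow> real" and m :: "'a measure" and S :: "real set"
  defines "X \<equiv> Metric_space.mtopology M d"
  assumes "Ultrametric_space M d"
    and "locally_compact_space X"
    and "\<not> compact_space X"
    and "separable_space X"
    and "radon_measure X m"
    and "\<forall>B\<in>Metric_space.balls M d. 0 < Metric_space.mdiameter d B \<longrightarrow> 0 < emeasure m B"
    and "\<forall>x\<in>M. emeasure m {x} = 0 \<longleftrightarrow> \<not> isolated_point X x"
    and "S \<subseteq> {0..}"
    and "closed S"
    and "0 islimpt S"
    and "(\<exists>x\<in>M. \<not> isolated_point X x) \<longrightarrow> \<not> bounded S"
  shows "(\<exists>d'. Ultrametric_space M d' \<and> Metric_space.proper_metric M d' \<and>
             Metric_space.mtopology M d' = X \<and>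
             (\<exists>C. Metric_space.choice_function M d' C \<and>
                  op_spectrum m (Metric_space.hier_Laplacian M d' m C) = complex_of_real ` S)) \<and>
         (Metric_space.proper_metric M d \<and>
          (\<exists>P. partition_on M P \<and> P \<subseteq> Metric_space.balls M d \<and>
               infinite (P \<inter> Metric_space.nonsingleton_balls M d)) \<longrightarrow>
          (\<exists>C. Metric_space.choice_function M d C \<and>
               op_spectrum m (Metric_space.hier_Laplacian M d m C) = complex_of_real ` S))"
proof -
  interpret Ultrametric_space M d
    by (rule assms(2))
  have X: "X = mtopology" by (simp add: X_def)
  have m: "space m = M" "sets m = sigma_sets M {U. openin mtopology U}"
    "\<And>K. compactin mtopology K \<Longrightarrow> emeasure m K < \<infinity>"
    using assms(6) by (auto simp: radon_measure_def X)
  have pos: "0 < emeasure m U" if "openin mtopology U" "U \<noteq> {}" for U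
  proof (rule open_measure_pos[OF _ _ _ that])
    show "V \<in> sets m" if "openin mtopology V" for V using that by (auto simp: m(2))
    show "0 < emeasure m B" if "B \<in> balls" "0 < mdiameter B" for B using assms(7) that by blast
    show "emeasure m {x} \<noteq> 0" if "x \<in> M" "isolated_point mtopology x" for x
      using assms(8) that by (simp add: X)
  qed
  \<comment> \<open>Stated for every proper ultrametric with the given topology, so that both claims
    are instances: the second with \<open>d\<close> itself, the first with the fibre metric and its
    partition into fibres.\<close>
  have choice: "\<exists>C. Metric_space.choice_function M d' C \<and>
      op_spectrum m (Metric_space.hier_Laplacian M d' m C) = complex_of_real ` S"
    if "Ultrametric_space M d'" "Metric_space.proper_metric M d'"
      and top: "Metric_space.mtopology M d' = mtopology"
      and P: "partition_on M P" "P \<subseteq> Metric_space.balls M d'"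
        "infinite (P \<inter> Metric_space.nonsingleton_balls M d')" for d' P
  proof -
    interpret D: Ultrametric_space M d'
      by (rule that(1))
    interpret D: proper_ultrametric_measure M d' m
      by unfold_locales (use that(2) assms(4,5) m pos in \<open>simp_all add: top X\<close>)
    show ?thesis
      by (rule D.choice_with_spectrum_exists[OF P assms(9-11)]) (use assms(12) in \<open>simp add: top X\<close>)
  qed
  show ?thesis
  proof (intro conjI impI)
    show "\<exists>d'. Ultrametric_space M d' \<and> Metric_space.proper_metric M d' \<and>
        Metric_space.mtopology M d' = X \<and>
        (\<exists>C. Metric_space.choice_function M d' C \<and>
          op_spectrum m (Metric_space.hier_Laplacian M d' m C) = complex_of_real ` S)"
    proof (rule compact_open_fibres)
      show "locally_compact_space mtopology" "separable_space mtopology" "\<not> compact_space mtopology"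
        using assms(3-5) by (simp_all add: X)
      fix g :: "'a \<Rightarrow> nat"
      assume g: "\<And>n. compactin mtopology {x \<in> M. g x = n}" "\<And>n. openin mtopology {x \<in> M. g x = n}"
        "\<And>n. \<exists>x\<in>M. \<exists>y\<in>M. g x = n \<and> g y = n \<and> x \<noteq> y"
      note d' = fibre_dist_ultrametric[of g] proper_fibre_dist[OF g(2,1)] mtopology_fibre_dist[OF g(2)]
      show ?thesis using d' choice[OF d' fibre_partition[OF g(3)]] unfolding X
        by (intro exI[of _ "fibre_dist g"]) simp
    qed
    assume "proper_metric \<and> (\<exists>P. partition_on M P \<and> P \<subseteq> balls \<and> infinite (P \<inter> nonsingleton_balls))"
    then obtain P where "proper_metric" "partition_on M P" "P \<subseteq> balls" "infinite (P \<inter> nonsingleton_balls)"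
      by blast
    then show "\<exists>C. choice_function C \<and> op_spectrum m (hier_Laplacian m C) = complex_of_real ` S"
      by (intro choice[OF assms(2) _ refl])
  qed
qed

end
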